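(* Let $e\in\boldsymbol{\mathcal S}^{\jmath}(n,r)$ be the idempotent $$e=\sum_{\lambda\in\Lambda(n+1,r)\,:\,\lambda_{n+1}=0}[\operatorname{diag}(\widetilde\lambda)].$$ Then the $\imath$-variant $\boldsymbol{\mathcal S}^{\imath}(n,r)$ of $\boldsymbol{\mathcal S}^{\jmath}(n,r)$ satisfies $$\boldsymbol{\mathcal S}^{\imath}(n,r)\cong e\,\boldsymbol{\mathcal S}^{\jmath}(n,r)\,e$$ as algebras, and consequently $$Z\big(\boldsymbol{\mathcal S}^{\imath}(n,r)\big)\cong Z\big(e\,\boldsymbol{\mathcal S}^{\jmath}(n,r)\,e\big)=e\,Z\big(\boldsymbol{\mathcal S}^{\jmath}(n,r)\big)\,e.$$
   Context: Let $\upsilon$ be an indeterminate, $q=\upsilon^2$, $\mathcal A=\mathbb Z[\upsilon,\upsilon^{-1}]$, $K=\mathbb Q(\upsilon)$, $\mathbb N=\{0,1,2,\dots\}$; $Z(\cdot)$ denotes the center. Hecke algebra of type $B_r$: $(W,S)$ is the Coxeter system of type $B_r$, $S=\{s_1,\dots,s_r\}$, and $\mathcal H_{\mathcal A}(B_r)$ is the $\mathcal A$-algebra generated by $T_i=T_{s_i}$ ($1\le i\le r$) with $T_i^2=(q-1)T_i+q$, $T_iT_j=T_jT_i$ if $|i-j|>1$, $T_iT_{i+1}T_i=T_{i+1}T_iT_{i+1}$ for $1\le i<r-1$, and $T_{r-1}T_rT_{r-1}T_r=T_rT_{r-1}T_rT_{r-1}$. $q$-Schur algebra of type $B$: let $\Lambda(n+1,r)=\{\lambda\in\mathbb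 N^{n+1}\mid\sum_i\lambda_i=r\}$. For $\lambda\in\Lambda(n+1,r)$ let $W_\lambda$ be the parabolic subgroup generated by $S\setminus\{s_{\lambda_1+\cdots+\lambda_i}\mid1\le i\le n\}$, let $\widetilde x_\lambda=\sum_{w\in W_\lambda}T_w$, and let $\widetilde\lambda=(\lambda_1,\dots,\lambda_n,2\lambda_{n+1}+1,\lambda_n,\dots,\lambda_1)$. Put $\mathcal S^{\jmath}(n,r)=\operatorname{End}_{\mathcal H_{\mathcal A}(B_r)}\big(\bigoplus_{\lambda\in\Lambda(n+1,r)}\widetilde x_\lambda\mathcal H_{\mathcal A}(B_r)\big)$ and $\boldsymbol{\mathcal S}^{\jmath}(n,r)=K\otimes_{\mathcal A}\mathcal S^{\jmath}(n,r)$, which is a finite-dimensional split semisimple $K$-algebra. $[\operatorname{diag}(\widetilde\lambda)]$ denotes the element of the normalized BLM-type (Beilinson–Lusztig–MacPherson) basis of $\boldsymbol{\mathcal S}^{\jmath}(n,r)$ indexed by the diagonal matrix $\operatorname{diag}(\widetilde\lambda)$; it is the idempotent projecting $\bigoplus_{\nu}\widetilde x_\nu\mathcal H_{\mathcal A}(B_r)$ (after extension of scalars to $K$) onto the summand indexed by $\lambda$. The $\imath$-variant: $\boldsymbol{\mathcal S}^{\imath}(n,r)=K\otimes_{\mathcal A}\operatorname{End}_{\mathcal H_{\mathcal A}(B_r)}\big(\bigoplus_{\lambda\in\Lambda(n+1,r),\,\lambda_{n+1}=0}\widetilde x_\lambda\mathcal H_{\mathcal A}(B_r)\big)$, the analogous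 endomorphism algebra in which only the compositions with last part $0$ are used. *)

theory Defs
  imports
    "HOL-Computational_Algebra.Polynomial"
    "HOL-Computational_Algebra.Fraction_Field"
    "HOL-Algebra.QuotRing"
    "HOL-Algebra.Module"
    "HOL-Algebra.Generated_Groups"
begin

section \<open>Ground rings\<close>

text \<open>
  \<open>K = \<rat>(\<upsilon>)\<close> is the type \<^typ>\<open>rat poly fract\<close>, and \<open>\<A> = \<int>[\<upsilon>, \<upsilon>\<inverse>]\<close> is a subring of it.
\<close>

type_synonym K = "rat poly fract"

definition vK :: K where
  "vK = Fract [:0, 1:] 1"

definition qK :: K where
  "qK = vK ^ 2"

definition laurentA :: "K set" where
  "laurentA = {Fract (map_poly rat_of_int p) 1 / vK ^ k | (p :: int poly) (k :: nat). True}"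

definition fieldK :: "K ring" where
  "fieldK = \<lparr>carrier = UNIV, mult = (*), one = 1, zero = 0, add = (+)\<rparr>"


section \<open>Algebras: monoid algebras, quotients, scalar extension, corners, centers\<close>

text \<open>
  An algebra is a record of type \<^typ>\<open>('a, 'b) module\<close>. The library locale \<open>algebra\<close> is not used,
  because it covers commutative algebras only.

  The monoid algebra \<open>R[M]\<close> has as coefficient ring a subring \<open>R\<close> of a commutative ring type. Its
  elements are the finitely supported functions, with the convolution product.
\<close>

definition monoid_algebra ::
    "'a::comm_ring_1 set \<Rightarrow> ('m, 'z) monoid_scheme \<Rightarrow> ('a, 'm \<Rightarrow> 'a) module" where
  "monoid_algebra R M =
    \<lparr>carrier = {f. range f \<subseteq> R \<and> {m. f m \<noteq> 0} \<subseteq> carrier M \<and> finite {m. f m \<noteq> 0}},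
     mult = (\<lambda>f g m. \<Sum>(x, y) \<in> {(x, y). f x \<noteq> 0 \<and> g y \<noteq> 0 \<and> x \<otimes>\<^bsub>M\<^esub> y = m}. f x * g y),
     one = (\<lambda>m. if m = \<one>\<^bsub>M\<^esub> then 1 else 0),
     zero = (\<lambda>m. 0),
     add = (\<lambda>f g m. f m + g m),
     smult = (\<lambda>c f m. c * f m)\<rparr>"

definition basis_elt :: "'m \<Rightarrow> 'm \<Rightarrow> 'a::comm_ring_1" where
  "basis_elt x = (\<lambda>m. if m = x then 1 else 0)"

definition quotient_algebra :: "('a, 'b) module \<Rightarrow> 'b set \<Rightarrow> ('a, 'b set) module" where
  "quotient_algebra P I =
    \<lparr>carrier = carrier (P Quot I), mult = mult (P Quot I), one = one (P Quot I),
     zero = zero (P Quot I), add = add (P Quot I),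
     smult = (\<lambda>c X. (I +>\<^bsub>P\<^esub> (c \<odot>\<^bsub>P\<^esub> \<one>\<^bsub>P\<^esub>)) \<otimes>\<^bsub>P Quot I\<^esub> X)\<rparr>"

text \<open>
  The tensor product \<open>k \<otimes>\<^sub>A E\<close> of a field \<open>k\<close> (the whole type) with an algebra \<open>E\<close> over a
  subring \<open>A\<close> of \<open>k\<close>: the free abelian group on the symbols \<open>(c, x)\<close> modulo the subgroup of
  bilinearity and balancing relations. With the product \<open>(c, x) (d, y) = (c d, x y)\<close> this free
  abelian group is the integral monoid algebra of the product monoid \<open>k \<times> E\<close>, in which that subgroup
  is a two-sided ideal. Therefore generating an ideal rather than a subgroup changes nothing.
\<close>

definition symbol_algebra ::
    "('k::field, 'e) module \<Rightarrow> (int, 'k \<times> 'e \<Rightarrow> int) module" where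
  "symbol_algebra E =
    monoid_algebra UNIV (\<lparr>carrier = (UNIV :: 'k set), mult = (*), one = 1\<rparr> \<times>\<times> E)"

definition tensor_relations ::
    "'k::field set \<Rightarrow> ('k, 'e) module \<Rightarrow> ('k \<times> 'e \<Rightarrow> int) set" where
  "tensor_relations A E =
     {basis_elt (c + d, x) \<ominus>\<^bsub>symbol_algebra E\<^esub>
        (basis_elt (c, x) \<oplus>\<^bsub>symbol_algebra E\<^esub> basis_elt (d, x)) | c d x. x \<in> carrier E} \<union>
     {basis_elt (c, x \<oplus>\<^bsub>E\<^esub> y) \<ominus>\<^bsub>symbol_algebra E\<^esub>
        (basis_elt (c, x) \<oplus>\<^bsub>symbol_algebra E\<^esub> basis_elt (c, y)) | c x y.
        x \<in> carrier E \<and> y \<in> carrier E} \<union>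
     {basis_elt (c * a, x) \<ominus>\<^bsub>symbol_algebra E\<^esub> basis_elt (c, a \<odot>\<^bsub>E\<^esub> x) | c a x.
        a \<in> A \<and> x \<in> carrier E}"

definition pure_tensor ::
    "'k::field set \<Rightarrow> ('k, 'e) module \<Rightarrow> 'k \<Rightarrow> 'e \<Rightarrow> ('k \<times> 'e \<Rightarrow> int) set" where
  "pure_tensor A E c x =
     (Idl\<^bsub>symbol_algebra E\<^esub> (tensor_relations A E)) +>\<^bsub>symbol_algebra E\<^esub> basis_elt (c, x)"

definition extend_scalars ::
    "'k::field set \<Rightarrow> ('k, 'e) module \<Rightarrow> ('k, ('k \<times> 'e \<Rightarrow> int) set) module" where
  "extend_scalars A E =
    (let Q = symbol_algebra E Quot (Idl\<^bsub>symbol_algebra E\<^esub> (tensor_relations A E))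
     in \<lparr>carrier = carrier Q, mult = mult Q, one = one Q, zero = zero Q, add = add Q,
         smult = (\<lambda>c X. pure_tensor A E c \<one>\<^bsub>E\<^esub> \<otimes>\<^bsub>Q\<^esub> X)\<rparr>)"

definition corner_algebra :: "('a, 'b) module \<Rightarrow> 'b \<Rightarrow> ('a, 'b) module" where
  "corner_algebra S e = S\<lparr>carrier := {e \<otimes>\<^bsub>S\<^esub> x \<otimes>\<^bsub>S\<^esub> e | x. x \<in> carrier S}, one := e\<rparr>"

definition algebra_center :: "('a, 'b) module \<Rightarrow> ('a, 'b) module" where
  "algebra_center S =
    S\<lparr>carrier := {z \<in> carrier S. \<forall>x \<in> carrier S. z \<otimes>\<^bsub>S\<^esub> x = x \<otimes>\<^bsub>S\<^esub> z}\<rparr>"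

definition algebra_iso ::
    "('a, 'z) ring_scheme \<Rightarrow> ('a, 'b) module \<Rightarrow> ('a, 'c) module \<Rightarrow> ('b \<Rightarrow> 'c) set" where
  "algebra_iso k S T =
    {h \<in> ring_iso S T. \<forall>c \<in> carrier k. \<forall>x \<in> carrier S. h (c \<odot>\<^bsub>S\<^esub> x) = c \<odot>\<^bsub>T\<^esub> h x}"


section \<open>The Coxeter system and the Hecke algebra of type B\<close>

definition coxeter_mat_B :: "nat \<Rightarrow> nat \<Rightarrow> nat \<Rightarrow> nat" where
  "coxeter_mat_B r i j =
    (if i = j then 1
     else if i + 1 < j \<or> j + 1 < i then 2
     else if max i j = r then 4
     else 3)"

text \<open>
  The Coxeter group is presented by \<open>(s\<^sub>i s\<^sub>j)^m(i,j) = 1\<close>, so its elements are classes of words in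
  \<open>{1..r}\<close>. The cases \<open>i = j\<close> make the generators involutions, and the monoid presented is a group.
\<close>

inductive coxeter_cong :: "nat \<Rightarrow> nat list \<Rightarrow> nat list \<Rightarrow> bool" for r :: nat where
  cc_rel: "i \<in> {1..r} \<Longrightarrow> j \<in> {1..r} \<Longrightarrow>
     coxeter_cong r (concat (replicate (coxeter_mat_B r i j) [i, j])) []"
| cc_refl: "u \<in> lists {1..r} \<Longrightarrow> coxeter_cong r u u"
| cc_sym: "coxeter_cong r u w \<Longrightarrow> coxeter_cong r w u"
| cc_trans: "coxeter_cong r u v \<Longrightarrow> coxeter_cong r v w \<Longrightarrow> coxeter_cong r u w"
| cc_append: "coxeter_cong r u u' \<Longrightarrow> coxeter_cong r w w' \<Longrightarrow> coxeter_cong r (u @ w) (u' @ w')"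

definition weyl_class :: "nat \<Rightarrow> nat list \<Rightarrow> nat list set" where
  "weyl_class r u = {w. coxeter_cong r u w}"

definition weyl_B :: "nat \<Rightarrow> nat list set monoid" where
  "weyl_B r =
    \<lparr>carrier = weyl_class r ` lists {1..r},
     mult = (\<lambda>X Y. \<Union>x \<in> X. \<Union>y \<in> Y. weyl_class r (x @ y)),
     one = weyl_class r []\<rparr>"

definition free_algebra :: "nat \<Rightarrow> (K, nat list \<Rightarrow> K) module" where
  "free_algebra r =
    monoid_algebra laurentA \<lparr>carrier = lists {1..r}, mult = (@), one = []\<rparr>"

definition hecke_relations :: "nat \<Rightarrow> (nat list \<Rightarrow> K) set" where
  "hecke_relations r =
     {basis_elt [i, i] \<ominus>\<^bsub>free_algebra r\<^esub>
        (((qK - 1) \<odot>\<^bsub>free_algebra r\<^esub> basis_elt [i]) \<oplus>\<^bsub>free_algebra r\<^esub>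
         (qK \<odot>\<^bsub>free_algebra r\<^esub> basis_elt [])) | i. i \<in> {1..r}} \<union>
     {basis_elt [i, j] \<ominus>\<^bsub>free_algebra r\<^esub> basis_elt [j, i] | i j.
        i \<in> {1..r} \<and> j \<in> {1..r} \<and> (i + 1 < j \<or> j + 1 < i)} \<union>
     {basis_elt [i, i + 1, i] \<ominus>\<^bsub>free_algebra r\<^esub> basis_elt [i + 1, i, i + 1] | i.
        1 \<le> i \<and> i + 1 < r} \<union>
     (if 2 \<le> r
      then {basis_elt [r - 1, r, r - 1, r] \<ominus>\<^bsub>free_algebra r\<^esub> basis_elt [r, r - 1, r, r - 1]}
      else {})"

definition hecke_ideal :: "nat \<Rightarrow> (nat list \<Rightarrow> K) set" where
  "hecke_ideal r = Idl\<^bsub>free_algebra r\<^esub> (hecke_relations r)"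

definition hecke :: "nat \<Rightarrow> (K, (nat list \<Rightarrow> K) set) module" where
  "hecke r = quotient_algebra (free_algebra r) (hecke_ideal r)"

definition hecke_gen :: "nat \<Rightarrow> nat \<Rightarrow> (nat list \<Rightarrow> K) set" where
  "hecke_gen r i = hecke_ideal r +>\<^bsub>free_algebra r\<^esub> basis_elt [i]"

text \<open>
  \<open>T\<^sub>w\<close> is the product of the generators along a reduced word of \<open>w\<close>, that is, a word of least length
  in the class \<open>w\<close>. By Matsumoto's theorem it does not depend on the word chosen.
\<close>

definition hecke_T :: "nat \<Rightarrow> nat list set \<Rightarrow> (nat list \<Rightarrow> K) set" where
  "hecke_T r w =
    foldr (\<lambda>i h. hecke_gen r i \<otimes>\<^bsub>hecke r\<^esub> h) (ARG_MIN length u. u \<in> w) \<one>\<^bsub>hecke r\<^esub>"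


section \<open>The q-Schur algebras of type B\<close>

text \<open>Compositions are functions on \<open>{1..n+1}\<close>, extended by zero.\<close>

definition compositions :: "nat \<Rightarrow> nat \<Rightarrow> (nat \<Rightarrow> nat) set" where
  "compositions n r = {l. (\<forall>i. i \<notin> {1..n+1} \<longrightarrow> l i = 0) \<and> (\<Sum>i = 1..n+1. l i) = r}"

definition compositions0 :: "nat \<Rightarrow> nat \<Rightarrow> (nat \<Rightarrow> nat) set" where
  "compositions0 n r = {l \<in> compositions n r. l (n + 1) = 0}"

definition parabolic :: "nat \<Rightarrow> nat \<Rightarrow> (nat \<Rightarrow> nat) \<Rightarrow> nat list set set" where
  "parabolic n r l =
    generate (weyl_B r)
      ((\<lambda>i. weyl_class r [i]) ` ({1..r} - {\<Sum>j = 1..i. l j | i. i \<in> {1..n}}))"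

definition x_elt :: "nat \<Rightarrow> nat \<Rightarrow> (nat \<Rightarrow> nat) \<Rightarrow> (nat list \<Rightarrow> K) set" where
  "x_elt n r l = (\<Oplus>\<^bsub>hecke r\<^esub>w \<in> parabolic n r l. hecke_T r w)"

definition x_module :: "nat \<Rightarrow> nat \<Rightarrow> (nat \<Rightarrow> nat) \<Rightarrow> (nat list \<Rightarrow> K) set set" where
  "x_module n r l = {x_elt n r l \<otimes>\<^bsub>hecke r\<^esub> h | h. h \<in> carrier (hecke r)}"

text \<open>
  For a set \<open>L\<close> of compositions (finite in all uses), \<open>perm_module n r L\<close> is the direct sum of the
  right ideals \<open>x\<^sub>l H\<close> with \<open>l \<in> L\<close>.
\<close>

type_synonym perm_elt = "(nat \<Rightarrow> nat) \<Rightarrow> (nat list \<Rightarrow> K) set"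

definition perm_module :: "nat \<Rightarrow> nat \<Rightarrow> (nat \<Rightarrow> nat) set \<Rightarrow> perm_elt set" where
  "perm_module n r L = (\<Pi>\<^sub>E l \<in> L. x_module n r l)"

definition pm_zero :: "nat \<Rightarrow> (nat \<Rightarrow> nat) set \<Rightarrow> perm_elt" where
  "pm_zero r L = (\<lambda>l \<in> L. \<zero>\<^bsub>hecke r\<^esub>)"

definition pm_add :: "nat \<Rightarrow> (nat \<Rightarrow> nat) set \<Rightarrow> perm_elt \<Rightarrow> perm_elt \<Rightarrow> perm_elt" where
  "pm_add r L m m' = (\<lambda>l \<in> L. m l \<oplus>\<^bsub>hecke r\<^esub> m' l)"

definition pm_act :: "nat \<Rightarrow> (nat \<Rightarrow> nat) set \<Rightarrow> perm_elt \<Rightarrow> (nat list \<Rightarrow> K) set \<Rightarrow> perm_elt" where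
  "pm_act r L m h = (\<lambda>l \<in> L. m l \<otimes>\<^bsub>hecke r\<^esub> h)"

definition pm_smult :: "nat \<Rightarrow> (nat \<Rightarrow> nat) set \<Rightarrow> K \<Rightarrow> perm_elt \<Rightarrow> perm_elt" where
  "pm_smult r L a m = (\<lambda>l \<in> L. a \<odot>\<^bsub>hecke r\<^esub> m l)"

definition hecke_End ::
    "nat \<Rightarrow> nat \<Rightarrow> (nat \<Rightarrow> nat) set \<Rightarrow> (K, perm_elt \<Rightarrow> perm_elt) module" where
  "hecke_End n r L =
    \<lparr>carrier = {f \<in> perm_module n r L \<rightarrow>\<^sub>E perm_module n r L.
        (\<forall>m \<in> perm_module n r L. \<forall>m' \<in> perm_module n r L.
           f (pm_add r L m m') = pm_add r L (f m) (f m')) \<and>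
        (\<forall>m \<in> perm_module n r L. \<forall>h \<in> carrier (hecke r).
           f (pm_act r L m h) = pm_act r L (f m) h)},
     mult = (\<lambda>f g. compose (perm_module n r L) f g),
     one = (\<lambda>m \<in> perm_module n r L. m),
     zero = (\<lambda>m \<in> perm_module n r L. pm_zero r L),
     add = (\<lambda>f g. \<lambda>m \<in> perm_module n r L. pm_add r L (f m) (g m)),
     smult = (\<lambda>a f. \<lambda>m \<in> perm_module n r L. pm_smult r L a (f m))\<rparr>"

type_synonym schur_elt = "(K \<times> (perm_elt \<Rightarrow> perm_elt) \<Rightarrow> int) set"

definition schur_j :: "nat \<Rightarrow> nat \<Rightarrow> (K, schur_elt) module" where
  "schur_j n r = extend_scalars laurentA (hecke_End n r (compositions n r))"

definition schur_i :: "nat \<Rightarrow> nat \<Rightarrow> (K, schur_elt) module" where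
  "schur_i n r = extend_scalars laurentA (hecke_End n r (compositions0 n r))"

text \<open>
  The BLM-type basis element of the diagonal matrix \<open>diag(\<lambda>\<^sub>1, \<dots>, \<lambda>\<^sub>n, 2\<lambda>\<^sub>n\<^sub>+\<^sub>1 + 1, \<lambda>\<^sub>n, \<dots>, \<lambda>\<^sub>1)\<close> is
  the projection onto the summand of \<open>\<lambda>\<close>. The normalizing power of \<open>\<upsilon>\<close> is \<open>1\<close> in this case.
\<close>

definition proj_End :: "nat \<Rightarrow> nat \<Rightarrow> (nat \<Rightarrow> nat) \<Rightarrow> perm_elt \<Rightarrow> perm_elt" where
  "proj_End n r l =
    (\<lambda>m \<in> perm_module n r (compositions n r).
      \<lambda>l' \<in> compositions n r. if l' = l then m l' else \<zero>\<^bsub>hecke r\<^esub>)"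

definition blm_diag :: "nat \<Rightarrow> nat \<Rightarrow> (nat \<Rightarrow> nat) \<Rightarrow> schur_elt" where
  "blm_diag n r l =
    pure_tensor laurentA (hecke_End n r (compositions n r)) 1 (proj_End n r l)"

end

theory Submission
  imports Defs
begin

text \<open>
Write \<open>H\<close> for the Hecke algebra over \<open>\<A>\<close> and \<open>M\<close> for the direct sum of the right ideals \<open>x\<^sub>\<lambda> H\<close>. The
algebra \<open>K \<otimes> End\<^sub>H(M)\<close> and its idempotent \<open>e\<close> are realised by operators on a finite-dimensional space
over the field \<open>K = \<rat>(\<upsilon>)\<close>. What makes this work is that \<open>K\<close> is an ordered field.

\<^item> The functions on the set \<open>W\<close> of normal words of the Coxeter group carry the right regular
representation. The normal words give elements of \<open>H\<close> which multiply like the standard basis, and this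
defines a map from functions back to \<open>H\<close>. It inverts the coordinate map, so \<open>H\<close> embeds into the
functions \<open>W \<rightarrow> K\<close> (\<open>coords_inj\<close>), and \<open>M\<close> embeds into the functions \<open>X \<rightarrow> K\<close> for a finite set \<open>X\<close>.

\<^item> The generators \<open>T\<^sub>i\<close> are self-adjoint for the form with weight \<open>q\<close> to the length of \<open>w\<close> at \<open>w\<close>.
Since \<open>q = \<upsilon>\<^sup>2\<close> is positive, the form is anisotropic, and there are orthogonal projections onto
subspaces (\<open>orthogonal_projection_exists\<close>). Let \<open>U\<close> be the \<open>K\<close>-span of \<open>M\<close>. An endomorphism of \<open>M\<close>
extends linearly to \<open>U\<close> and by zero to its orthogonal complement. Because \<open>M\<close> is finitely generated,
clearing denominators shows that \<open>K \<otimes> End\<^sub>H(M)\<close> is the algebra of all operators which commute with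
the \<open>T\<^sub>i\<close> and are supported on \<open>U\<close> (the locales \<open>scalar_extension\<close> and \<open>schur_block\<close>).

\<^item> Let \<open>V \<subseteq> U\<close> be the span of the summands with last part zero. Then \<open>e\<close> is the orthogonal
projection onto \<open>V\<close>, and the operators supported on \<open>V\<close> are literally the corner of those supported
on \<open>U\<close> (\<open>corner_commutant\<close>). This gives the first isomorphism, and the one between the centers.

\<^item> One inclusion between the centers holds for every idempotent of every ring. For the other one, a
central operator \<open>z\<close> on \<open>V\<close> is transported to the space spanned by all \<open>B v\<close> with \<open>v \<in> V\<close>, by the rule
\<open>B v \<mapsto> B (z v)\<close>, and extended by zero to the orthogonal complement (\<open>center_lift\<close>). The rule is well
defined because the operators have adjoints; this is the place where semisimplicity enters.
\<close>

section \<open>Monoid algebras\<close>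

definition coeff_ring :: "'a::comm_ring_1 set \<Rightarrow> bool" where
  "coeff_ring R \<longleftrightarrow> 0 \<in> R \<and> 1 \<in> R \<and> (\<forall>a\<in>R. - a \<in> R) \<and> (\<forall>a\<in>R. \<forall>b\<in>R. a + b \<in> R \<and> a * b \<in> R)"

lemma coeff_ring_sum:
  assumes "coeff_ring R" "\<And>i. i \<in> I \<Longrightarrow> f i \<in> R"
  shows "sum f I \<in> R"
  using assms(2)
proof (induction I rule: infinite_finite_induct)
  case (insert x F)
  then show ?case using assms(1) by (auto simp: coeff_ring_def)
qed (use assms(1) in \<open>auto simp: coeff_ring_def\<close>)

text \<open>
The linear extension of a function \<open>F\<close> on the monoid to the monoid algebra, along a map \<open>\<kappa>\<close> of
coefficient rings. Representations are evaluated entry by entry, so scalar values suffice.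
\<close>

definition ma_eval :: "('a::comm_ring_1 \<Rightarrow> 'b::comm_ring_1) \<Rightarrow> ('m \<Rightarrow> 'b) \<Rightarrow> ('m \<Rightarrow> 'a) \<Rightarrow> 'b" where
  "ma_eval \<kappa> F f = (\<Sum>m | f m \<noteq> 0. \<kappa> (f m) * F m)"

definition coeff_hom :: "('a::comm_ring_1 \<Rightarrow> 'b::comm_ring_1) \<Rightarrow> bool" where
  "coeff_hom \<kappa> \<longleftrightarrow> \<kappa> 0 = 0 \<and> \<kappa> 1 = 1 \<and> (\<forall>a b. \<kappa> (a + b) = \<kappa> a + \<kappa> b) \<and> (\<forall>a b. \<kappa> (a * b) = \<kappa> a * \<kappa> b)"

lemma coeff_hom_id: "coeff_hom (\<lambda>x. x)" by (simp add: coeff_hom_def)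
lemma coeff_hom_of_int: "coeff_hom of_int" by (simp add: coeff_hom_def)

lemma coeff_hom_sum:
  assumes "coeff_hom \<kappa>"
  shows "\<kappa> (sum f I) = (\<Sum>i\<in>I. \<kappa> (f i))"
  by (induction I rule: infinite_finite_induct) (use assms in \<open>auto simp: coeff_hom_def\<close>)

lemma ma_eval_superset:
  assumes "coeff_hom \<kappa>" "finite S" "{m. f m \<noteq> 0} \<subseteq> S"
  shows "ma_eval \<kappa> F f = (\<Sum>m\<in>S. \<kappa> (f m) * F m)"
  unfolding ma_eval_def
  by (rule sum.mono_neutral_left) (use assms in \<open>auto simp: coeff_hom_def\<close>)

lemma ma_eval_add:
  assumes "coeff_hom \<kappa>" "finite {m. f m \<noteq> 0}" "finite {m. g m \<noteq> 0}"
  shows "ma_eval \<kappa> F (\<lambda>m. f m + g m) = ma_eval \<kappa> F f + ma_eval \<kappa> F g"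
proof -
  let ?S = "{m. f m \<noteq> 0} \<union> {m. g m \<noteq> 0}"
  have "ma_eval \<kappa> F (\<lambda>m. f m + g m) = (\<Sum>m\<in>?S. \<kappa> (f m + g m) * F m)"
    by (rule ma_eval_superset) (use assms in auto)
  moreover have "ma_eval \<kappa> F f = (\<Sum>m\<in>?S. \<kappa> (f m) * F m)"
    by (rule ma_eval_superset) (use assms in auto)
  moreover have "ma_eval \<kappa> F g = (\<Sum>m\<in>?S. \<kappa> (g m) * F m)"
    by (rule ma_eval_superset) (use assms in auto)
  ultimately show ?thesis
    using assms(1) by (simp add: coeff_hom_def sum.distrib[symmetric] algebra_simps)
qed

lemma ma_eval_scale:
  assumes "coeff_hom \<kappa>" "finite {m. f m \<noteq> 0}"
  shows "ma_eval \<kappa> F (\<lambda>m. c * f m) = \<kappa> c * ma_eval \<kappa> F f"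
proof -
  have "ma_eval \<kappa> F (\<lambda>m. c * f m) = (\<Sum>m | f m \<noteq> 0. \<kappa> (c * f m) * F m)"
    by (rule ma_eval_superset) (use assms in auto)
  then show ?thesis
    using assms(1) by (simp add: coeff_hom_def ma_eval_def sum_distrib_left algebra_simps)
qed

lemma ma_eval_basis:
  assumes "coeff_hom \<kappa>"
  shows "ma_eval \<kappa> F (basis_elt m) = F m"
proof -
  have "ma_eval \<kappa> F (basis_elt m) = (\<Sum>m\<in>{m}. \<kappa> (basis_elt m m) * F m)"
    by (subst ma_eval_superset[OF assms, of "{m}"]) (auto simp: basis_elt_def)
  then show ?thesis using assms by (simp add: basis_elt_def coeff_hom_def)
qed

lemma ma_eval_zero: "ma_eval \<kappa> F (\<lambda>m. 0) = 0"
  by (simp add: ma_eval_def)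

lemma ma_mult_eq:
  assumes "finite {m. f m \<noteq> 0}" "finite {m. g m \<noteq> 0}"
  shows "(f \<otimes>\<^bsub>monoid_algebra R M\<^esub> g) m =
    (\<Sum>x | f x \<noteq> 0. \<Sum>y | g y \<noteq> 0. if x \<otimes>\<^bsub>M\<^esub> y = m then f x * g y else 0)"
proof -
  let ?P = "{m. f m \<noteq> 0} \<times> {m. g m \<noteq> 0}"
  have "(f \<otimes>\<^bsub>monoid_algebra R M\<^esub> g) m =
      (\<Sum>p \<in> {p \<in> ?P. fst p \<otimes>\<^bsub>M\<^esub> snd p = m}. f (fst p) * g (snd p))"
    by (auto simp: monoid_algebra_def intro!: sum.cong)
  also have "\<dots> = (\<Sum>p \<in> ?P. if fst p \<otimes>\<^bsub>M\<^esub> snd p = m then f (fst p) * g (snd p) else 0)"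
    by (rule sum.inter_filter) (use assms in simp)
  finally show ?thesis by (simp add: sum.cartesian_product case_prod_beta)
qed

lemma ma_mult_support:
  assumes "finite {m. f m \<noteq> 0}" "finite {m. g m \<noteq> 0}"
  shows "{m. (f \<otimes>\<^bsub>monoid_algebra R M\<^esub> g) m \<noteq> 0} \<subseteq>
    (\<lambda>(x, y). x \<otimes>\<^bsub>M\<^esub> y) ` ({m. f m \<noteq> 0} \<times> {m. g m \<noteq> 0})"
proof
  fix m assume "m \<in> {m. (f \<otimes>\<^bsub>monoid_algebra R M\<^esub> g) m \<noteq> 0}"
  then have "(\<Sum>x | f x \<noteq> 0. \<Sum>y | g y \<noteq> 0. if x \<otimes>\<^bsub>M\<^esub> y = m then f x * g y else 0) \<noteq> 0"
    by (simp add: ma_mult_eq[OF assms])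
  then obtain x where x: "x \<in> {x. f x \<noteq> 0}" "(\<Sum>y | g y \<noteq> 0. if x \<otimes>\<^bsub>M\<^esub> y = m then f x * g y else 0) \<noteq> 0"
    by (rule sum.not_neutral_contains_not_neutral)
  from this(2) obtain y where "y \<in> {y. g y \<noteq> 0}" "(if x \<otimes>\<^bsub>M\<^esub> y = m then f x * g y else 0) \<noteq> 0"
    by (rule sum.not_neutral_contains_not_neutral)
  then show "m \<in> (\<lambda>(x, y). x \<otimes>\<^bsub>M\<^esub> y) ` ({m. f m \<noteq> 0} \<times> {m. g m \<noteq> 0})"
    using x by (auto split: if_splits)
qed

text \<open>
If \<open>F\<close> is a matrix entry of a representation of the monoid, the right-hand side is the corresponding
entry of a product. Hence representations of the monoid extend to the algebra. With \<open>F\<close> an indicator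
function the formula also yields associativity.
\<close>

lemma ma_eval_mult:
  assumes \<kappa>: "coeff_hom \<kappa>" and f: "finite {m. f m \<noteq> 0}" and g: "finite {m. g m \<noteq> 0}"
  shows "ma_eval \<kappa> F (f \<otimes>\<^bsub>monoid_algebra R M\<^esub> g) =
    (\<Sum>x | f x \<noteq> 0. \<Sum>y | g y \<noteq> 0. \<kappa> (f x) * \<kappa> (g y) * F (x \<otimes>\<^bsub>M\<^esub> y))"
proof -
  let ?X = "{m. f m \<noteq> 0}" and ?Y = "{m. g m \<noteq> 0}"
  let ?S = "(\<lambda>(x, y). x \<otimes>\<^bsub>M\<^esub> y) ` (?X \<times> ?Y)"
  have fS: "finite ?S" using f g by auto
  have "ma_eval \<kappa> F (f \<otimes>\<^bsub>monoid_algebra R M\<^esub> g) =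
      (\<Sum>m\<in>?S. \<kappa> ((f \<otimes>\<^bsub>monoid_algebra R M\<^esub> g) m) * F m)"
    by (rule ma_eval_superset[OF \<kappa> fS ma_mult_support[OF f g]])
  also have "\<dots> = (\<Sum>m\<in>?S. \<Sum>x\<in>?X. \<Sum>y\<in>?Y. if x \<otimes>\<^bsub>M\<^esub> y = m then \<kappa> (f x) * \<kappa> (g y) * F m else 0)"
    using \<kappa> by (intro sum.cong refl)
      (auto simp: ma_mult_eq[OF f g] coeff_hom_sum[OF \<kappa>] sum_distrib_right coeff_hom_def intro!: sum.cong)
  also have "\<dots> = (\<Sum>x\<in>?X. \<Sum>m\<in>?S. \<Sum>y\<in>?Y. if x \<otimes>\<^bsub>M\<^esub> y = m then \<kappa> (f x) * \<kappa> (g y) * F m else 0)"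
    by (rule sum.swap)
  also have "\<dots> = (\<Sum>x\<in>?X. \<Sum>y\<in>?Y. \<Sum>m\<in>?S. if x \<otimes>\<^bsub>M\<^esub> y = m then \<kappa> (f x) * \<kappa> (g y) * F m else 0)"
    by (intro sum.cong refl sum.swap)
  also have "\<dots> = (\<Sum>x\<in>?X. \<Sum>y\<in>?Y. \<kappa> (f x) * \<kappa> (g y) * F (x \<otimes>\<^bsub>M\<^esub> y))"
    by (intro sum.cong refl) (subst sum.delta'[OF fS], auto)
  finally show ?thesis .
qed

lemma ma_carrier_iff:
  "f \<in> carrier (monoid_algebra R M) \<longleftrightarrow>
    range f \<subseteq> R \<and> {m. f m \<noteq> 0} \<subseteq> carrier M \<and> finite {m. f m \<noteq> 0}"
  by (simp add: monoid_algebra_def)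

lemma ma_finite: "f \<in> carrier (monoid_algebra R M) \<Longrightarrow> finite {m. f m \<noteq> 0}"
  by (simp add: ma_carrier_iff)

lemma basis_elt_carrier:
  "coeff_ring R \<Longrightarrow> x \<in> carrier M \<Longrightarrow> basis_elt x \<in> carrier (monoid_algebra R M)"
  by (auto simp: ma_carrier_iff basis_elt_def coeff_ring_def)

lemma ma_mult_closed:
  assumes R: "coeff_ring R" and M: "monoid M"
    and f: "f \<in> carrier (monoid_algebra R M)" and g: "g \<in> carrier (monoid_algebra R M)"
  shows "f \<otimes>\<^bsub>monoid_algebra R M\<^esub> g \<in> carrier (monoid_algebra R M)"
  unfolding ma_carrier_iff
proof (intro conjI)
  let ?S = "(\<lambda>(x, y). x \<otimes>\<^bsub>M\<^esub> y) ` ({m. f m \<noteq> 0} \<times> {m. g m \<noteq> 0})"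
  note sup = ma_mult_support[OF ma_finite[OF f] ma_finite[OF g], of R M]
  show "range (f \<otimes>\<^bsub>monoid_algebra R M\<^esub> g) \<subseteq> R"
  proof -
    have "f x * g y \<in> R" "0 \<in> R" for x y
      using f g R by (simp_all add: ma_carrier_iff coeff_ring_def image_subset_iff)
    then show ?thesis
      by (auto simp: ma_mult_eq[OF ma_finite[OF f] ma_finite[OF g]] intro!: coeff_ring_sum[OF R])
  qed
  have "?S \<subseteq> carrier M"
    using f g by (auto simp: ma_carrier_iff subset_iff intro!: monoid.m_closed[OF M])
  then show "{m. (f \<otimes>\<^bsub>monoid_algebra R M\<^esub> g) m \<noteq> 0} \<subseteq> carrier M" using sup by blast
  have "finite ?S" using f g by (auto simp: ma_carrier_iff)
  then show "finite {m. (f \<otimes>\<^bsub>monoid_algebra R M\<^esub> g) m \<noteq> 0}" using sup finite_subset by blast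
qed

lemma ma_mult_eval_left:
  assumes "finite {m. f m \<noteq> 0}" "finite {m. g m \<noteq> 0}"
  shows "(f \<otimes>\<^bsub>monoid_algebra R M\<^esub> g) m =
    ma_eval (\<lambda>x. x) (\<lambda>x. \<Sum>y | g y \<noteq> 0. if x \<otimes>\<^bsub>M\<^esub> y = m then g y else 0) f"
  unfolding ma_mult_eq[OF assms] ma_eval_def
  by (auto simp: sum_distrib_left intro!: sum.cong)

lemma ma_mult_eval_right:
  assumes "finite {m. f m \<noteq> 0}" "finite {m. g m \<noteq> 0}"
  shows "(f \<otimes>\<^bsub>monoid_algebra R M\<^esub> g) m =
    ma_eval (\<lambda>x. x) (\<lambda>y. \<Sum>x | f x \<noteq> 0. if x \<otimes>\<^bsub>M\<^esub> y = m then f x else 0) g"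
  unfolding ma_mult_eq[OF assms] ma_eval_def
  by (subst sum.swap) (auto simp: sum_distrib_left mult.commute intro!: sum.cong)

lemma ma_mult_assoc:
  assumes M: "monoid M"
    and f: "f \<in> carrier (monoid_algebra R M)" and g: "g \<in> carrier (monoid_algebra R M)"
    and h: "h \<in> carrier (monoid_algebra R M)" and R: "coeff_ring R"
  shows "(f \<otimes>\<^bsub>monoid_algebra R M\<^esub> g) \<otimes>\<^bsub>monoid_algebra R M\<^esub> h =
    f \<otimes>\<^bsub>monoid_algebra R M\<^esub> (g \<otimes>\<^bsub>monoid_algebra R M\<^esub> h)"
proof
  fix m
  note fin = ma_finite[OF f] ma_finite[OF g] ma_finite[OF h]
  have "((f \<otimes>\<^bsub>monoid_algebra R M\<^esub> g) \<otimes>\<^bsub>monoid_algebra R M\<^esub> h) m =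
     (\<Sum>x | f x \<noteq> 0. \<Sum>y | g y \<noteq> 0. f x * g y * (\<Sum>z | h z \<noteq> 0. if (x \<otimes>\<^bsub>M\<^esub> y) \<otimes>\<^bsub>M\<^esub> z = m then h z else 0))"
    by (subst ma_mult_eval_left[OF ma_finite[OF ma_mult_closed[OF R M f g]] fin(3)])
      (subst ma_eval_mult[OF coeff_hom_id fin(1,2)], rule refl)
  also have "\<dots> = (\<Sum>x | f x \<noteq> 0. \<Sum>y | g y \<noteq> 0. \<Sum>z | h z \<noteq> 0.
      if x \<otimes>\<^bsub>M\<^esub> (y \<otimes>\<^bsub>M\<^esub> z) = m then f x * g y * h z else 0)"
  proof (intro sum.cong refl)
    fix x y assume "x \<in> {x. f x \<noteq> 0}" "y \<in> {y. g y \<noteq> 0}"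
    then have xy: "x \<in> carrier M" "y \<in> carrier M" using f g by (auto simp: ma_carrier_iff)
    show "f x * g y * (\<Sum>z | h z \<noteq> 0. if (x \<otimes>\<^bsub>M\<^esub> y) \<otimes>\<^bsub>M\<^esub> z = m then h z else 0) =
      (\<Sum>z | h z \<noteq> 0. if x \<otimes>\<^bsub>M\<^esub> (y \<otimes>\<^bsub>M\<^esub> z) = m then f x * g y * h z else 0)"
      unfolding sum_distrib_left
    proof (intro sum.cong refl)
      fix z assume "z \<in> {z. h z \<noteq> 0}"
      then have "z \<in> carrier M" using h by (auto simp: ma_carrier_iff)
      then show "f x * g y * (if (x \<otimes>\<^bsub>M\<^esub> y) \<otimes>\<^bsub>M\<^esub> z = m then h z else 0) =
          (if x \<otimes>\<^bsub>M\<^esub> (y \<otimes>\<^bsub>M\<^esub> z) = m then f x * g y * h z else 0)"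
        using xy by (simp add: monoid.m_assoc[OF M])
    qed
  qed
  also have "\<dots> = (\<Sum>y | g y \<noteq> 0. \<Sum>z | h z \<noteq> 0. \<Sum>x | f x \<noteq> 0.
      if x \<otimes>\<^bsub>M\<^esub> (y \<otimes>\<^bsub>M\<^esub> z) = m then f x * g y * h z else 0)"
    by (subst sum.swap) (intro sum.cong refl sum.swap)
  also have "\<dots> = (\<Sum>y | g y \<noteq> 0. \<Sum>z | h z \<noteq> 0. g y * h z *
      (\<Sum>x | f x \<noteq> 0. if x \<otimes>\<^bsub>M\<^esub> (y \<otimes>\<^bsub>M\<^esub> z) = m then f x else 0))"
    by (intro sum.cong refl) (auto simp: sum_distrib_left intro!: sum.cong)
  also have "\<dots> = (f \<otimes>\<^bsub>monoid_algebra R M\<^esub> (g \<otimes>\<^bsub>monoid_algebra R M\<^esub> h)) m"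
    by (subst ma_mult_eval_right[OF fin(1) ma_finite[OF ma_mult_closed[OF R M g h]]])
      (subst ma_eval_mult[OF coeff_hom_id fin(2,3)], rule refl)
  finally show "((f \<otimes>\<^bsub>monoid_algebra R M\<^esub> g) \<otimes>\<^bsub>monoid_algebra R M\<^esub> h) m =
    (f \<otimes>\<^bsub>monoid_algebra R M\<^esub> (g \<otimes>\<^bsub>monoid_algebra R M\<^esub> h)) m" .
qed

lemma ma_add: "f \<oplus>\<^bsub>monoid_algebra R M\<^esub> g = (\<lambda>m. f m + g m)"
  by (simp add: monoid_algebra_def)

lemma ma_zero: "\<zero>\<^bsub>monoid_algebra R M\<^esub> = (\<lambda>m. 0)"
  by (simp add: monoid_algebra_def)

lemma ma_one: "\<one>\<^bsub>monoid_algebra R M\<^esub> = basis_elt \<one>\<^bsub>M\<^esub>"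
  by (simp add: monoid_algebra_def basis_elt_def)

lemma ma_smult: "c \<odot>\<^bsub>monoid_algebra R M\<^esub> f = (\<lambda>m. c * f m)"
  by (simp add: monoid_algebra_def)

lemma ma_abelian_group:
  assumes R: "coeff_ring R"
  shows "abelian_group (monoid_algebra R M)"
proof (rule abelian_groupI)
  fix f g assume fg: "f \<in> carrier (monoid_algebra R M)" "g \<in> carrier (monoid_algebra R M)"
  have "{m. f m + g m \<noteq> 0} \<subseteq> {m. f m \<noteq> 0} \<union> {m. g m \<noteq> 0}" by auto
  moreover have "finite ({m. f m \<noteq> 0} \<union> {m. g m \<noteq> 0})" using fg by (simp add: ma_carrier_iff)
  ultimately have "finite {m. f m + g m \<noteq> 0}" by (rule finite_subset)
  then show "f \<oplus>\<^bsub>monoid_algebra R M\<^esub> g \<in> carrier (monoid_algebra R M)"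
    using fg R by (auto simp: ma_add ma_carrier_iff coeff_ring_def image_subset_iff subset_iff)
      (metis add.right_neutral)
next
  fix f assume f: "f \<in> carrier (monoid_algebra R M)"
  have "(\<lambda>m. - f m) \<in> carrier (monoid_algebra R M)"
    using f R by (auto simp: ma_carrier_iff coeff_ring_def)
  then show "\<exists>g\<in>carrier (monoid_algebra R M). g \<oplus>\<^bsub>monoid_algebra R M\<^esub> f = \<zero>\<^bsub>monoid_algebra R M\<^esub>"
    by (rule bexI[rotated]) (simp add: ma_add ma_zero)
qed (use R in \<open>auto simp: ma_add ma_zero ma_carrier_iff add_ac coeff_ring_def\<close>)

lemma ma_minus:
  assumes R: "coeff_ring R" and "f \<in> carrier (monoid_algebra R M)" and g: "g \<in> carrier (monoid_algebra R M)"
  shows "f \<ominus>\<^bsub>monoid_algebra R M\<^esub> g = (\<lambda>m. f m - g m)"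
proof -
  interpret abelian_group "monoid_algebra R M" by (rule ma_abelian_group[OF R])
  have "(\<lambda>m. - g m) \<in> carrier (monoid_algebra R M)"
    using g R by (auto simp: ma_carrier_iff coeff_ring_def)
  then have "\<ominus>\<^bsub>monoid_algebra R M\<^esub> g = (\<lambda>m. - g m)"
    using g by (intro minus_equality) (auto simp: ma_add ma_zero)
  then show ?thesis by (simp add: a_minus_def ma_add)
qed

lemma ma_ring:
  assumes R: "coeff_ring R" and M: "monoid M"
  shows "ring (monoid_algebra R M)"
proof (rule ringI)
  interpret M: monoid M by (rule M)
  interpret A: abelian_group "monoid_algebra R M" by (rule ma_abelian_group[OF R])
  show "abelian_group (monoid_algebra R M)" by (rule ma_abelian_group[OF R])
  have eval_delta: "ma_eval (\<lambda>x. x) (\<lambda>y. if y = m then 1 else 0) f = f m"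
    if "finite {m. f m \<noteq> 0}" for f :: "'b \<Rightarrow> 'a" and m
    using that by (simp add: ma_eval_def if_distrib[of "\<lambda>z. _ * z"] cong: if_cong)
  show "monoid (monoid_algebra R M)"
  proof (rule monoidI)
    show "\<one>\<^bsub>monoid_algebra R M\<^esub> \<in> carrier (monoid_algebra R M)"
      by (simp add: ma_one basis_elt_carrier[OF R])
    fix f assume f: "f \<in> carrier (monoid_algebra R M)"
    have [simp]: "finite {m. basis_elt \<one>\<^bsub>M\<^esub> m \<noteq> (0::'a)}" by (simp add: basis_elt_def)
    have s: "{x. basis_elt \<one>\<^bsub>M\<^esub> x \<noteq> (0::'a)} = {\<one>\<^bsub>M\<^esub>}" by (auto simp: basis_elt_def)
    have c: "f x \<noteq> 0 \<Longrightarrow> x \<in> carrier M" for x using f by (auto simp: ma_carrier_iff)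
    show "\<one>\<^bsub>monoid_algebra R M\<^esub> \<otimes>\<^bsub>monoid_algebra R M\<^esub> f = f"
    proof
      fix m
      show "(\<one>\<^bsub>monoid_algebra R M\<^esub> \<otimes>\<^bsub>monoid_algebra R M\<^esub> f) m = f m"
        using ma_finite[OF f] c
        by (auto simp: ma_one ma_mult_eq s basis_elt_def cong: if_cong)
    qed
    show "f \<otimes>\<^bsub>monoid_algebra R M\<^esub> \<one>\<^bsub>monoid_algebra R M\<^esub> = f"
    proof
      fix m
      have "(\<Sum>x | f x \<noteq> 0. if x \<otimes>\<^bsub>M\<^esub> \<one>\<^bsub>M\<^esub> = m then f x else 0) = (\<Sum>x | f x \<noteq> 0. if x = m then f x else 0)"
        using c by (intro sum.cong) auto
      then show "(f \<otimes>\<^bsub>monoid_algebra R M\<^esub> \<one>\<^bsub>monoid_algebra R M\<^esub>) m = f m"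
        using ma_finite[OF f] 
        by (auto simp: ma_one ma_mult_eq s basis_elt_def cong: if_cong)
    qed
  qed (auto intro: ma_mult_closed[OF R M] ma_mult_assoc[OF M _ _ _ R])
next
  interpret A: abelian_group "monoid_algebra R M" by (rule ma_abelian_group[OF R])
  fix f g h assume c: "f \<in> carrier (monoid_algebra R M)" "g \<in> carrier (monoid_algebra R M)"
    "h \<in> carrier (monoid_algebra R M)"
  note fin = c[THEN ma_finite]
  have fin': "finite {m. f m + g m \<noteq> 0}"
    using A.add.m_closed[OF c(1,2)] by (simp add: ma_carrier_iff ma_add)
  show "(f \<oplus>\<^bsub>monoid_algebra R M\<^esub> g) \<otimes>\<^bsub>monoid_algebra R M\<^esub> h =
    f \<otimes>\<^bsub>monoid_algebra R M\<^esub> h \<oplus>\<^bsub>monoid_algebra R M\<^esub> g \<otimes>\<^bsub>monoid_algebra R M\<^esub> h"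
    by (auto simp: ma_add ma_mult_eval_left[OF fin'] ma_mult_eval_left fin ma_eval_add[OF coeff_hom_id])
  show "h \<otimes>\<^bsub>monoid_algebra R M\<^esub> (f \<oplus>\<^bsub>monoid_algebra R M\<^esub> g) =
    h \<otimes>\<^bsub>monoid_algebra R M\<^esub> f \<oplus>\<^bsub>monoid_algebra R M\<^esub> h \<otimes>\<^bsub>monoid_algebra R M\<^esub> g"
    by (auto simp: ma_add ma_mult_eval_right[OF _ fin'] ma_mult_eval_right fin ma_eval_add[OF coeff_hom_id])
qed

lemma ma_mult_basis:
  fixes R :: "'a::comm_ring_1 set" and M :: "('m, 'z) monoid_scheme"
  shows "basis_elt x \<otimes>\<^bsub>monoid_algebra R M\<^esub> basis_elt y = basis_elt (x \<otimes>\<^bsub>M\<^esub> y)"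
proof
  fix m
  have s: "{z. basis_elt x z \<noteq> (0::'a)} = {x}" for x :: 'm by (auto simp: basis_elt_def)
  show "(basis_elt x \<otimes>\<^bsub>monoid_algebra R M\<^esub> basis_elt y) m = (basis_elt (x \<otimes>\<^bsub>M\<^esub> y) m :: 'a)"
    by (subst ma_mult_eq) (auto simp: s basis_elt_def)
qed

lemma ma_induct [consumes 2, case_names zero scaled_basis add]:
  assumes "f \<in> carrier (monoid_algebra R M)" "coeff_ring R"
    and z: "P (\<lambda>m. 0)"
    and b: "\<And>a x. a \<in> R \<Longrightarrow> x \<in> carrier M \<Longrightarrow> P (\<lambda>m. a * basis_elt x m)"
    and s: "\<And>f g. f \<in> carrier (monoid_algebra R M) \<Longrightarrow> g \<in> carrier (monoid_algebra R M) \<Longrightarrow>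
      P f \<Longrightarrow> P g \<Longrightarrow> P (\<lambda>m. f m + g m)"
  shows "P f"
proof -
  have "f \<in> carrier (monoid_algebra R M) \<Longrightarrow> {m. f m \<noteq> 0} \<subseteq> S \<Longrightarrow> P f" if "finite S" for S f
    using that
  proof (induction S arbitrary: f)
    case empty
    then have "f = (\<lambda>m. 0)" by auto
    then show ?case using z by simp
  next
    case (insert x S)
    show ?case
    proof (cases "f x = 0")
      case True
      then show ?thesis using insert by auto
    next
      case False
      let ?g = "\<lambda>m. if m = x then 0 else f m" and ?h = "\<lambda>m. f x * basis_elt x m"
      have x: "x \<in> carrier M" "f x \<in> R" using False insert.prems by (auto simp: ma_carrier_iff)
      have "{m. ?g m \<noteq> 0} \<subseteq> {m. f m \<noteq> 0}" by auto
      then have fg: "finite {m. ?g m \<noteq> 0}" by (rule finite_subset[OF _ ma_finite[OF insert.prems(1)]])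
      then have g: "?g \<in> carrier (monoid_algebra R M)"
        using insert.prems(1) assms(2) by (auto simp: ma_carrier_iff coeff_ring_def)
      have "P ?g" by (rule insert.IH[OF g]) (use insert.prems(2) in auto)
      moreover have h: "?h \<in> carrier (monoid_algebra R M)"
        using x assms(2) by (auto simp: ma_carrier_iff basis_elt_def coeff_ring_def)
      moreover have "P ?h" using b x by blast
      ultimately have "P (\<lambda>m. ?g m + ?h m)" using s[OF g h] by blast
      also have "(\<lambda>m. ?g m + ?h m) = f" by (auto simp: basis_elt_def)
      finally show ?thesis .
    qed
  qed
  then show ?thesis using assms(1) ma_finite by blast
qed

section \<open>Commutants of self-adjoint families over an ordered field\<close>

definition lin_op :: "(('x \<Rightarrow> 'k::field) \<Rightarrow> ('y \<Rightarrow> 'k)) \<Rightarrow> bool" where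
  "lin_op B \<longleftrightarrow> (\<forall>c d u v. B (\<lambda>x. c * u x + d * v x) = (\<lambda>x. c * B u x + d * B v x))"

lemma lin_opD: "lin_op B \<Longrightarrow> B (\<lambda>x. c * u x + d * v x) = (\<lambda>x. c * B u x + d * B v x)"
  by (simp add: lin_op_def)

lemma lin_op_zero: "lin_op B \<Longrightarrow> B (\<lambda>x. 0) = (\<lambda>x. 0)"
  using lin_opD[of B 0 "\<lambda>x. 0" 0 "\<lambda>x. 0"] by simp

lemma lin_op_scale: "lin_op B \<Longrightarrow> B (\<lambda>x. c * u x) = (\<lambda>x. c * B u x)"
  using lin_opD[of B c u 0 u] by simp

lemma lin_op_add: "lin_op B \<Longrightarrow> B (\<lambda>x. u x + v x) = (\<lambda>x. B u x + B v x)"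
  using lin_opD[of B 1 u 1 v] by simp

lemma lin_op_sum:
  assumes "lin_op B"
  shows "B (\<lambda>x. \<Sum>i\<in>I. c i * u i x) = (\<lambda>x. \<Sum>i\<in>I. c i * B (u i) x)"
proof (induction I rule: infinite_finite_induct)
  case (insert i I)
  have "B (\<lambda>x. c i * u i x + 1 * (\<Sum>i\<in>I. c i * u i x)) =
      (\<lambda>x. c i * B (u i) x + 1 * B (\<lambda>x. \<Sum>i\<in>I. c i * u i x) x)"
    by (rule lin_opD[OF assms])
  then show ?case using insert by simp
qed (simp_all add: lin_op_zero[OF assms])

lemma lin_op_comp: "lin_op B \<Longrightarrow> lin_op C \<Longrightarrow> lin_op (\<lambda>v. B (C v))"
  by (simp add: lin_op_def)

definition subspace_fun :: "('x \<Rightarrow> 'k::field) set \<Rightarrow> bool" where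
  "subspace_fun U \<longleftrightarrow> (\<lambda>x. 0) \<in> U \<and> (\<forall>c d. \<forall>u\<in>U. \<forall>v\<in>U. (\<lambda>x. c * u x + d * v x) \<in> U)"

lemma subspace_funD: "subspace_fun U \<Longrightarrow> u \<in> U \<Longrightarrow> v \<in> U \<Longrightarrow> (\<lambda>x. c * u x + d * v x) \<in> U"
  by (simp add: subspace_fun_def)

lemma subspace_fun_zero: "subspace_fun U \<Longrightarrow> (\<lambda>x. 0) \<in> U"
  by (simp add: subspace_fun_def)

lemma subspace_fun_add: "subspace_fun U \<Longrightarrow> u \<in> U \<Longrightarrow> v \<in> U \<Longrightarrow> (\<lambda>x. u x + v x) \<in> U"
  using subspace_funD[of U u v 1 1] by simp

lemma subspace_fun_diff: "subspace_fun U \<Longrightarrow> u \<in> U \<Longrightarrow> v \<in> U \<Longrightarrow> (\<lambda>x. u x - v x) \<in> U"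
  using subspace_funD[of U u v 1 "-1"] by simp

definition wform :: "'x set \<Rightarrow> ('x \<Rightarrow> 'k) \<Rightarrow> ('x \<Rightarrow> 'k) \<Rightarrow> ('x \<Rightarrow> 'k) \<Rightarrow> 'k::field" where
  "wform X \<omega> u v = (\<Sum>x\<in>X. \<omega> x * u x * v x)"

lemma wform_lin: "wform X \<omega> (\<lambda>x. c * u x + d * v x) w = c * wform X \<omega> u w + d * wform X \<omega> v w"
  by (simp add: wform_def sum_distrib_left sum.distrib[symmetric] algebra_simps)

lemma wform_sym: "wform X \<omega> u v = wform X \<omega> v u"
  by (simp add: wform_def mult_ac)

lemma wform_zero [simp]: "wform X \<omega> (\<lambda>x. 0) v = 0" "wform X \<omega> v (\<lambda>x. 0) = 0"
  by (simp_all add: wform_def)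

lemma wform_diff: "wform X \<omega> (\<lambda>x. u x - v x) w = wform X \<omega> u w - wform X \<omega> v w"
  using wform_lin[of X \<omega> 1 u "-1" v w] by simp

lemma wform_lin_right: "wform X \<omega> w (\<lambda>x. c * u x + d * v x) = c * wform X \<omega> w u + d * wform X \<omega> w v"
  by (simp add: wform_sym[of _ _ w] wform_lin)

lemma wform_anisotropic:
  fixes \<omega> :: "'x \<Rightarrow> 'k::linordered_field"
  assumes "finite X" "\<And>x. x \<in> X \<Longrightarrow> \<omega> x > 0" "wform X \<omega> u u = 0" "x \<in> X"
  shows "u x = 0"
proof -
  have "\<forall>x\<in>X. \<omega> x * u x * u x = 0"
    using assms(3) sum_nonneg_eq_0_iff[OF assms(1), of "\<lambda>x. \<omega> x * u x * u x"] assms(2)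
    by (simp add: wform_def mult.assoc less_imp_le)
  then show ?thesis using assms(2,4) by fastforce
qed

text \<open>
Induction on \<open>X\<close>. For a new point \<open>a\<close>, the vectors of \<open>U\<close> vanishing at \<open>a\<close> are covered by the
induction hypothesis, and they are of codimension at most one in \<open>U\<close>. A vector of \<open>U\<close> which does not
vanish at \<open>a\<close> is made orthogonal to them, as in the Gram-Schmidt process.
\<close>

lemma orthogonal_projection_exists:
  fixes \<omega> :: "'x \<Rightarrow> 'k::linordered_field"
  assumes "finite X" "\<And>x. x \<in> X \<Longrightarrow> \<omega> x > 0" "subspace_fun U" "\<And>u x. u \<in> U \<Longrightarrow> x \<notin> X \<Longrightarrow> u x = 0"
  shows "\<exists>u\<in>U. \<forall>u'\<in>U. wform X \<omega> (\<lambda>x. v x - u x) u' = 0"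
  using assms
proof (induction X arbitrary: U v rule: finite_induct)
  case empty
  then show ?case using subspace_fun_zero by (fastforce simp: wform_def)
next
  case (insert a X)
  let ?f = "wform (insert a X) \<omega>"
  let ?U = "{u \<in> U. u a = 0}"
  have U': "subspace_fun ?U" using insert.prems(2) by (auto simp: subspace_fun_def)
  have form: "?f s u = wform X \<omega> s u" if "u a = 0" for s u
    using that insert.hyps by (simp add: wform_def)
  have IH: "\<exists>p\<in>?U. \<forall>u'\<in>?U. ?f (\<lambda>x. v x - p x) u' = 0" for v
  proof -
    have "\<exists>p\<in>?U. \<forall>u'\<in>?U. wform X \<omega> (\<lambda>x. v x - p x) u' = 0"
    proof (rule insert.IH[OF _ U'])
      show "x \<in> X \<Longrightarrow> \<omega> x > 0" for x using insert.prems(1) by blast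
      fix u x assume u: "u \<in> ?U" "x \<notin> X"
      then show "u x = 0" using insert.prems(3)[of u x] by (cases "x = a") simp_all
    qed
    then show ?thesis by (simp add: form cong: ball_cong)
  qed
  show ?case
  proof (cases "\<exists>u\<in>U. u a \<noteq> 0")
    case False
    then have "?U = U" by auto
    then show ?thesis using IH[of v] by simp
  next
    case True
    then obtain u0 where u0: "u0 \<in> U" "u0 a \<noteq> 0" by blast
    obtain p where p: "p \<in> ?U" "\<And>u'. u' \<in> ?U \<Longrightarrow> ?f (\<lambda>x. u0 x - p x) u' = 0"
      using IH[of u0] by blast
    define u1 where "u1 = (\<lambda>x. u0 x - p x)"
    have u1: "u1 \<in> U" "u1 a \<noteq> 0" "\<And>u'. u' \<in> ?U \<Longrightarrow> ?f u1 u' = 0"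
      using u0 p subspace_fun_diff[OF insert.prems(2)] by (auto simp: u1_def)
    have n: "?f u1 u1 \<noteq> 0"
      using wform_anisotropic[of "insert a X" \<omega> u1 a] insert.hyps insert.prems(1) u1(2) by blast
    obtain p' where p': "p' \<in> ?U" "\<And>u'. u' \<in> ?U \<Longrightarrow> ?f (\<lambda>x. v x - p' x) u' = 0"
      using IH[of v] by blast
    \<comment> \<open>The coefficient of \<open>v\<close> along the new orthogonal direction \<open>u1\<close>.\<close>
    define c where "c = ?f v u1 / ?f u1 u1"
    define u where "u = (\<lambda>x. 1 * p' x + c * u1 x)"
    have "u \<in> U" unfolding u_def using p' u1 by (intro subspace_funD insert.prems(2)) auto
    moreover have "?f (\<lambda>x. v x - u x) u' = 0" if u': "u' \<in> U" for u'
    proof -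
      define d where "d = u' a / u1 a"
      define u2 where "u2 = (\<lambda>x. 1 * u' x + (- d) * u1 x)"
      have "u2 \<in> U" unfolding u2_def using u' u1 by (intro subspace_funD insert.prems(2)) auto
      moreover have "u2 a = 0" using u1(2) by (simp add: u2_def d_def)
      ultimately have u2: "u2 \<in> ?U" by simp
      have e: "(\<lambda>x. v x - u x) = (\<lambda>x. 1 * (v x - p' x) + (- c) * u1 x)" by (simp add: u_def algebra_simps)
      have 1: "?f (\<lambda>x. v x - u x) u2 = 0"
        unfolding e wform_lin using p'(2)[OF u2] u1(3)[OF u2] by simp
      have "?f p' u1 = 0" using u1(3)[OF p'(1)] by (simp add: wform_sym)
      then have 2: "?f (\<lambda>x. v x - u x) u1 = 0"
        unfolding e wform_lin wform_diff using n by (simp add: c_def)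
      have "u' = (\<lambda>x. 1 * u2 x + d * u1 x)" by (simp add: u2_def)
      then show ?thesis using 1 2 by (simp only: wform_lin_right)
    qed
    ultimately show ?thesis by blast
  qed
qed

text \<open>
The operators act on all functions on the type, while the form only sees the values on \<open>X\<close>. The
subspaces of interest consist of functions vanishing outside \<open>X\<close>, on which the form is anisotropic.
\<close>

locale selfadjoint_family =
  fixes X :: "'x set" and \<omega> :: "'x \<Rightarrow> 'k::linordered_field"
    and \<Theta> :: "(('x \<Rightarrow> 'k) \<Rightarrow> ('x \<Rightarrow> 'k)) set"
  assumes fin: "finite X" and pos: "x \<in> X \<Longrightarrow> \<omega> x > 0"
    and Theta_lin: "T \<in> \<Theta> \<Longrightarrow> lin_op T"
    and Theta_adj: "T \<in> \<Theta> \<Longrightarrow> wform X \<omega> (T u) v = wform X \<omega> u (T v)"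
begin

abbreviation form ("\<langle>_, _\<rangle>") where "\<langle>u, v\<rangle> \<equiv> wform X \<omega> u v"

definition stable :: "('x \<Rightarrow> 'k) set \<Rightarrow> bool" where
  "stable U \<longleftrightarrow> subspace_fun U \<and> (\<forall>u\<in>U. \<forall>x. x \<notin> X \<longrightarrow> u x = 0) \<and> (\<forall>T\<in>\<Theta>. \<forall>u\<in>U. T u \<in> U)"

definition proj :: "('x \<Rightarrow> 'k) set \<Rightarrow> ('x \<Rightarrow> 'k) \<Rightarrow> ('x \<Rightarrow> 'k)" where
  "proj U v = (SOME u. u \<in> U \<and> (\<forall>u'\<in>U. \<langle>\<lambda>x. v x - u x, u'\<rangle> = 0))"

text \<open>
An operator is \<open>proj U B proj U\<close> for some \<open>B\<close> commuting with \<open>\<Theta>\<close>: operators on \<open>U\<close> are extended by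
zero to the orthogonal complement. With this convention operators on a smaller subspace are operators
on a larger one, without any change of type.
\<close>

definition commutant_ops :: "('x \<Rightarrow> 'k) set \<Rightarrow> (('x \<Rightarrow> 'k) \<Rightarrow> ('x \<Rightarrow> 'k)) set" where
  "commutant_ops U = {B. lin_op B \<and> (\<forall>v. B v \<in> U) \<and> (\<forall>v. B (proj U v) = B v) \<and>
     (\<forall>T\<in>\<Theta>. \<forall>v. B (T v) = T (B v))}"

definition commutant :: "('x \<Rightarrow> 'k) set \<Rightarrow> ('k, ('x \<Rightarrow> 'k) \<Rightarrow> ('x \<Rightarrow> 'k)) module" where
  "commutant U = \<lparr>carrier = commutant_ops U, mult = (\<lambda>B C v. B (C v)), one = proj U,
     zero = (\<lambda>v x. 0), add = (\<lambda>B C v x. B v x + C v x), smult = (\<lambda>c B v x. c * B v x)\<rparr>"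

lemma commutant_simps [simp]:
  "carrier (commutant U) = commutant_ops U"
  "B \<otimes>\<^bsub>commutant U\<^esub> C = (\<lambda>v. B (C v))"
  "\<one>\<^bsub>commutant U\<^esub> = proj U"
  "\<zero>\<^bsub>commutant U\<^esub> = (\<lambda>v x. 0)"
  "B \<oplus>\<^bsub>commutant U\<^esub> C = (\<lambda>v x. B v x + C v x)"
  "c \<odot>\<^bsub>commutant U\<^esub> B = (\<lambda>v x. c * B v x)"
  by (simp_all add: commutant_def)

lemma stable_subspace: "stable U \<Longrightarrow> subspace_fun U" by (simp add: stable_def)
lemma stable_support: "stable U \<Longrightarrow> u \<in> U \<Longrightarrow> x \<notin> X \<Longrightarrow> u x = 0" by (simp add: stable_def)
lemma stable_Theta: "stable U \<Longrightarrow> T \<in> \<Theta> \<Longrightarrow> u \<in> U \<Longrightarrow> T u \<in> U" by (simp add: stable_def)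

lemma anisotropic:
  assumes "stable U" "u \<in> U" "\<langle>u, u\<rangle> = 0"
  shows "u = (\<lambda>x. 0)"
proof
  fix x
  show "u x = 0"
    using wform_anisotropic[OF fin pos assms(3)] stable_support[OF assms(1,2)] by (cases "x \<in> X") auto
qed

lemma eq_if_form_eq:
  assumes U: "stable U" and u: "u \<in> U" "v \<in> U" and e: "\<And>w. \<langle>u, w\<rangle> = \<langle>v, w\<rangle>"
  shows "u = v"
proof -
  have "(\<lambda>x. u x - v x) = (\<lambda>x. 0)"
    by (rule anisotropic[OF U subspace_fun_diff[OF stable_subspace[OF U] u]]) (simp add: wform_diff e)
  then show ?thesis by (metis eq_iff_diff_eq_0 ext)
qed

context
  fixes U assumes U: "stable U"
begin

lemma proj_in: "proj U v \<in> U"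
  and proj_orth: "u \<in> U \<Longrightarrow> \<langle>\<lambda>x. v x - proj U v x, u\<rangle> = 0"
proof -
  have "\<exists>u. u \<in> U \<and> (\<forall>u'\<in>U. \<langle>\<lambda>x. v x - u x, u'\<rangle> = 0)"
    using orthogonal_projection_exists[of X \<omega> U v] fin pos stable_subspace[OF U] stable_support[OF U] by blast
  note this[THEN someI_ex]
  then show "proj U v \<in> U" "u \<in> U \<Longrightarrow> \<langle>\<lambda>x. v x - proj U v x, u\<rangle> = 0"
    unfolding proj_def by blast+
qed

lemma proj_form: "u \<in> U \<Longrightarrow> \<langle>proj U v, u\<rangle> = \<langle>v, u\<rangle>"
  using proj_orth[of u v] by (simp add: wform_diff)

lemma proj_unique:
  assumes "u \<in> U" "\<And>u'. u' \<in> U \<Longrightarrow> \<langle>v, u'\<rangle> = \<langle>u, u'\<rangle>"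
  shows "proj U v = u"
proof -
  let ?d = "\<lambda>x. proj U v x - u x"
  have d: "?d \<in> U" by (rule subspace_fun_diff[OF stable_subspace[OF U] proj_in assms(1)])
  have "\<langle>?d, ?d\<rangle> = 0" using proj_form[OF d] assms(2)[OF d] by (simp add: wform_diff)
  from anisotropic[OF U d this] show ?thesis by (metis eq_iff_diff_eq_0 ext)
qed

lemma proj_id: "u \<in> U \<Longrightarrow> proj U u = u"
  by (rule proj_unique) auto

lemma proj_self: "\<langle>proj U u, v\<rangle> = \<langle>u, proj U v\<rangle>"
  using proj_form[OF proj_in, of u v] proj_form[OF proj_in, of v u] by (simp add: wform_sym)

lemma proj_lin: "lin_op (proj U)"
  unfolding lin_op_def
  by (intro allI proj_unique)
    (auto simp: wform_lin proj_form intro!: subspace_funD[OF stable_subspace[OF U]] proj_in)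

lemma proj_Theta: "T \<in> \<Theta> \<Longrightarrow> proj U (T v) = T (proj U v)"
  by (rule proj_unique) (auto simp: Theta_adj proj_form stable_Theta[OF U] proj_in)

end

lemma proj_sub:
  assumes "stable U" "stable V" "V \<subseteq> U"
  shows "proj U (proj V v) = proj V v" "proj V (proj U v) = proj V v"
proof -
  show "proj U (proj V v) = proj V v" using proj_in[OF assms(2)] assms(3) by (intro proj_id[OF assms(1)]) auto
  show "proj V (proj U v) = proj V v"
    by (rule proj_unique[OF assms(2)])
      (use assms in \<open>auto simp: proj_in proj_form subset_iff\<close>)
qed

lemma commutant_opsD:
  assumes "B \<in> commutant_ops U"
  shows "lin_op B" "B v \<in> U" "B (proj U v) = B v" "T \<in> \<Theta> \<Longrightarrow> B (T v) = T (B v)"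
  using assms by (auto simp: commutant_ops_def)

lemma proj_commutant: "stable U \<Longrightarrow> stable V \<Longrightarrow> V \<subseteq> U \<Longrightarrow> proj V \<in> commutant_ops U"
  by (auto simp: commutant_ops_def proj_lin proj_sub proj_Theta dest: proj_in)

lemma commutant_mult:
  "B \<in> commutant_ops U \<Longrightarrow> C \<in> commutant_ops U \<Longrightarrow> (\<lambda>v. B (C v)) \<in> commutant_ops U"
  by (auto simp: commutant_ops_def intro: lin_op_comp)

lemma commutant_lin:
  assumes U: "stable U" and B: "B \<in> commutant_ops U" and C: "C \<in> commutant_ops U"
  shows "(\<lambda>v x. c * B v x + d * C v x) \<in> commutant_ops U"
  unfolding commutant_ops_def
proof (intro CollectI conjI allI ballI)
  show "lin_op (\<lambda>v x. c * B v x + d * C v x)"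
    using commutant_opsD(1)[OF B] commutant_opsD(1)[OF C] by (auto simp: lin_op_def algebra_simps)
  fix v
  show "(\<lambda>x. c * B v x + d * C v x) \<in> U"
    by (rule subspace_funD[OF stable_subspace[OF U] commutant_opsD(2)[OF B] commutant_opsD(2)[OF C]])
  show "(\<lambda>x. c * B (proj U v) x + d * C (proj U v) x) = (\<lambda>x. c * B v x + d * C v x)"
    by (simp add: commutant_opsD(3)[OF B] commutant_opsD(3)[OF C])
  fix T assume T: "T \<in> \<Theta>"
  show "(\<lambda>x. c * B (T v) x + d * C (T v) x) = T (\<lambda>x. c * B v x + d * C v x)"
    by (simp add: commutant_opsD(4)[OF B T] commutant_opsD(4)[OF C T] lin_opD[OF Theta_lin[OF T]])
qed

lemma commutant_zero: "stable U \<Longrightarrow> (\<lambda>v x. 0) \<in> commutant_ops U"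
  by (auto simp: commutant_ops_def lin_op_def lin_op_zero[OF Theta_lin] stable_subspace subspace_fun_zero)

lemma commutant_add:
  "stable U \<Longrightarrow> B \<in> commutant_ops U \<Longrightarrow> C \<in> commutant_ops U \<Longrightarrow> (\<lambda>v x. B v x + C v x) \<in> commutant_ops U"
  using commutant_lin[of U B C 1 1] by simp

lemma commutant_smult:
  "stable U \<Longrightarrow> B \<in> commutant_ops U \<Longrightarrow> (\<lambda>v x. c * B v x) \<in> commutant_ops U"
  using commutant_lin[of U B B c 0] by simp

lemma proj_commutant_op:
  assumes U: "stable U" and B: "B \<in> commutant_ops U"
  shows "proj U (B v) = B v"
  by (rule proj_id[OF U commutant_opsD(2)[OF B]])

lemma commutant_ring:
  assumes U: "stable U"
  shows "ring (commutant U)"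
proof (rule ringI)
  show "abelian_group (commutant U)"
  proof (rule abelian_groupI)
    fix B assume "B \<in> carrier (commutant U)"
    then have "(\<lambda>v x. (-1) * B v x) \<in> carrier (commutant U)" by (simp only: commutant_simps commutant_smult[OF U])
    then show "\<exists>C\<in>carrier (commutant U). C \<oplus>\<^bsub>commutant U\<^esub> B = \<zero>\<^bsub>commutant U\<^esub>"
      by (rule bexI[rotated]) simp
  qed (use U in \<open>auto simp: commutant_add commutant_zero add_ac\<close>)
  show "monoid (commutant U)"
    by (rule monoidI) (use U in \<open>auto simp: commutant_mult proj_commutant proj_commutant_op commutant_opsD(3)\<close>)
qed (auto simp: lin_op_add commutant_opsD(1))

text \<open>
An equality rather than an isomorphism, thanks to the extension by zero.
\<close>

lemma corner_commutant:
  assumes U: "stable U" and V: "stable V" and VU: "V \<subseteq> U"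
  shows "corner_algebra (commutant U) (proj V) = commutant V"
proof -
  have "{\<lambda>v. proj V (B (proj V v)) | B. B \<in> commutant_ops U} = commutant_ops V"
  proof (intro equalityI subsetI)
    fix C assume "C \<in> {\<lambda>v. proj V (B (proj V v)) | B. B \<in> commutant_ops U}"
    then obtain B where B: "B \<in> commutant_ops U" "C = (\<lambda>v. proj V (B (proj V v)))" by auto
    show "C \<in> commutant_ops V" unfolding B(2) commutant_ops_def
      by (auto simp: proj_in[OF V] proj_id[OF V] proj_Theta[OF V] commutant_opsD(4)[OF B(1)]
          intro!: lin_op_comp[OF proj_lin[OF V]] lin_op_comp[OF commutant_opsD(1)[OF B(1)]] proj_lin[OF V])
  next
    fix C assume C: "C \<in> commutant_ops V"
    have "C (proj U v) = C v" for v
      by (metis commutant_opsD(3)[OF C] proj_sub(2)[OF U V VU])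
    then have "C \<in> commutant_ops U"
      using C VU by (auto simp: commutant_ops_def)
    moreover have "C = (\<lambda>v. proj V (C (proj V v)))"
      by (simp add: proj_commutant_op[OF V C] commutant_opsD(3)[OF C])
    ultimately show "C \<in> {\<lambda>v. proj V (B (proj V v)) | B. B \<in> commutant_ops U}" by blast
  qed
  then show ?thesis by (simp add: corner_algebra_def) (simp add: commutant_def)
qed

text \<open>
The adjoint exists as a matrix on \<open>X\<close> and is then projected to \<open>U\<close>. It commutes with \<open>\<Theta>\<close> because
\<open>\<Theta>\<close> is self-adjoint.
\<close>

lemma commutant_adjoint:
  assumes U: "stable U" and B: "B \<in> commutant_ops U"
  obtains C where "C \<in> commutant_ops U" "\<And>u v. \<langle>B u, v\<rangle> = \<langle>u, C v\<rangle>"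
proof -
  let ?d = "\<lambda>x y. if x = y then 1 else 0 :: 'k"
  define y where "y = (\<lambda>v x. if x \<in> X then \<langle>B (?d x), v\<rangle> / \<omega> x else 0)"
  define C where "C = (\<lambda>v. proj U (y v))"
  have expand: "(\<lambda>z. \<Sum>x\<in>X. u x * ?d x z) = u" if "u \<in> U" for u
    using fin stable_support[OF U that] by (auto simp: if_distrib[of "\<lambda>t. _ * t"] cong: if_cong)
  have form_y: "\<langle>u, y v\<rangle> = \<langle>B u, v\<rangle>" if u: "u \<in> U" for u v
  proof -
    have "\<langle>u, y v\<rangle> = (\<Sum>x\<in>X. u x * \<langle>B (?d x), v\<rangle>)"
      unfolding wform_def[where u=u] using pos by (intro sum.cong) (auto simp: y_def less_imp_neq[symmetric])
    also have "\<dots> = (\<Sum>x\<in>X. \<Sum>z\<in>X. u x * (\<omega> z * B (?d x) z * v z))"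
      by (simp add: wform_def sum_distrib_left)
    also have "\<dots> = (\<Sum>z\<in>X. \<Sum>x\<in>X. u x * (\<omega> z * B (?d x) z * v z))"
      by (rule sum.swap)
    also have "\<dots> = (\<Sum>z\<in>X. \<omega> z * (\<Sum>x\<in>X. u x * B (?d x) z) * v z)"
      by (simp add: sum_distrib_left sum_distrib_right mult_ac)
    also have "\<dots> = \<langle>\<lambda>z. \<Sum>x\<in>X. u x * B (?d x) z, v\<rangle>" by (simp add: wform_def)
    also have "(\<lambda>z. \<Sum>x\<in>X. u x * B (?d x) z) = B u"
      using lin_op_sum[OF commutant_opsD(1)[OF B], where I=X and c=u and u="?d"] expand[OF u] by simp
    finally show ?thesis .
  qed
  have adj: "\<langle>B u, v\<rangle> = \<langle>u, C v\<rangle>" for u v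
  proof -
    have "\<langle>u, C v\<rangle> = \<langle>proj U u, y v\<rangle>" unfolding C_def by (rule proj_self[OF U, symmetric])
    also have "\<dots> = \<langle>B u, v\<rangle>" using form_y[OF proj_in[OF U]] by (simp add: commutant_opsD(3)[OF B])
    finally show ?thesis by simp
  qed
  have C_in: "C v \<in> U" for v by (simp add: C_def proj_in[OF U])
  have adj': "\<langle>C v, u\<rangle> = \<langle>v, B u\<rangle>" for u v using adj[of u v] by (simp add: wform_sym)
  have "C \<in> commutant_ops U"
    unfolding commutant_ops_def
  proof (intro CollectI conjI allI ballI)
    show "lin_op C" unfolding lin_op_def
    proof (intro allI)
      fix c d u v
      show "C (\<lambda>x. c * u x + d * v x) = (\<lambda>x. c * C u x + d * C v x)"
        by (rule eq_if_form_eq[OF U C_in subspace_funD[OF stable_subspace[OF U] C_in C_in]])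
          (simp add: adj' wform_lin)
    qed
    fix v
    show "C v \<in> U" by (rule C_in)
    show "C (proj U v) = C v"
      by (rule eq_if_form_eq[OF U C_in C_in]) (simp add: adj' proj_self[OF U] proj_commutant_op[OF U B])
    fix T assume T: "T \<in> \<Theta>"
    show "C (T v) = T (C v)"
      by (rule eq_if_form_eq[OF U C_in stable_Theta[OF U T C_in]])
        (simp add: adj' Theta_adj[OF T] commutant_opsD(4)[OF B T])
  qed
  then show ?thesis using that adj by blast
qed

section \<open>Lifting central elements from a corner\<close>

text \<open>
The linear relation generated by all pairs \<open>(B v, B (z v))\<close>. It is the graph of the lift of \<open>z\<close> on the
span of all \<open>B v\<close>. Scalar multiples are covered since \<open>B\<close> ranges over a vector space.
\<close>

inductive transport :: "('x \<Rightarrow> 'k) set \<Rightarrow> ('x \<Rightarrow> 'k) set \<Rightarrow> (('x \<Rightarrow> 'k) \<Rightarrow> ('x \<Rightarrow> 'k)) \<Rightarrow>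
    ('x \<Rightarrow> 'k) \<Rightarrow> ('x \<Rightarrow> 'k) \<Rightarrow> bool" for U V z where
  tr_zero: "transport U V z (\<lambda>x. 0) (\<lambda>x. 0)"
| tr_step: "B \<in> commutant_ops U \<Longrightarrow> v \<in> V \<Longrightarrow> transport U V z u w \<Longrightarrow>
    transport U V z (\<lambda>x. B v x + u x) (\<lambda>x. B (z v) x + w x)"

text \<open>
The relation is the graph of a function: if \<open>(0, w)\<close> belongs to it, then the component in \<open>V\<close> of \<open>C w\<close>
vanishes for every \<open>C\<close>, because \<open>z\<close> is central on \<open>V\<close>. Applied to the adjoints \<open>C\<close> of the operators \<open>B\<close>
this says that \<open>w\<close> is orthogonal to every \<open>B v\<close>. But \<open>w\<close> is itself in their span, so \<open>w = 0\<close>. The function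
obtained commutes with everything by construction, and it is extended by zero.
\<close>

lemma center_lift:
  assumes U: "stable U" and V: "stable V" and VU: "V \<subseteq> U"
    and z: "z \<in> commutant_ops V" and zc: "\<And>B. B \<in> commutant_ops V \<Longrightarrow> (\<lambda>v. z (B v)) = (\<lambda>v. B (z v))"
  shows "\<exists>z'\<in>commutant_ops U. (\<forall>B\<in>commutant_ops U. (\<lambda>v. z' (B v)) = (\<lambda>v. B (z' v))) \<and>
    (\<forall>v. proj V (z' (proj V v)) = z v)"
proof -
  let ?G = "transport U V z"
  define N where "N = {u. \<exists>w. ?G u w}"
  have step: "?G (B v) (B (z v))" if "B \<in> commutant_ops U" "v \<in> V" for B v
    using tr_step[OF that tr_zero] by simp
  have G_add: "?G (\<lambda>x. u x + u' x) (\<lambda>x. w x + w' x)" if "?G u w" "?G u' w'" for u w u' w'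
    using that
  proof (induction rule: transport.induct)
    case tr_zero
    then show ?case by simp
  next
    case (tr_step B v u w)
    have "?G (\<lambda>x. B v x + (u x + u' x)) (\<lambda>x. B (z v) x + (w x + w' x))"
      by (rule transport.tr_step) (use tr_step in auto)
    then show ?case by (simp add: add.assoc)
  qed
  have G_op: "?G (C u) (C w)" if "?G u w" "C \<in> commutant_ops U" for C u w
    using that(1)
  proof (induction rule: transport.induct)
    case tr_zero
    then show ?case using transport.tr_zero[of U V z] by (simp add: lin_op_zero[OF commutant_opsD(1)[OF that(2)]])
  next
    case (tr_step B v u w)
    have "?G (\<lambda>x. C (B v) x + C u x) (\<lambda>x. C (B (z v)) x + C w x)"
      by (rule transport.tr_step[OF commutant_mult[OF that(2)]]) (use tr_step in auto)
    then show ?case by (simp add: lin_op_add[OF commutant_opsD(1)[OF that(2)]])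
  qed
  have U_N: "u \<in> U" "w \<in> U" if "?G u w" for u w
    using that by (induction rule: transport.induct)
      (auto simp: subspace_fun_zero[OF stable_subspace[OF U]]
        intro!: subspace_fun_add[OF stable_subspace[OF U]] dest: commutant_opsD(2))
  have G_scale: "?G (\<lambda>x. c * u x) (\<lambda>x. c * w x)" if "?G u w" for c u w
  proof -
    let ?C = "\<lambda>v x. c * proj U v x"
    have "?C \<in> commutant_ops U" by (rule commutant_smult[OF U proj_commutant[OF U U]]) simp
    from G_op[OF that this] show ?thesis using U_N[OF that] by (simp add: proj_id[OF U])
  qed
  have G_Theta: "?G (T u) (T w)" if "?G u w" "T \<in> \<Theta>" for u w T
    using that(1)
  proof (induction rule: transport.induct)
    case tr_zero
    then show ?case using transport.tr_zero[of U V z] by (simp add: lin_op_zero[OF Theta_lin[OF that(2)]])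
  next
    case (tr_step B v u w)
    have "?G (\<lambda>x. B (T v) x + T u x) (\<lambda>x. B (z (T v)) x + T w x)"
      by (rule transport.tr_step) (use tr_step stable_Theta[OF V that(2)] in auto)
    then show ?case
      by (simp add: lin_op_add[OF Theta_lin[OF that(2)]] commutant_opsD(4)[OF tr_step(1) that(2)]
          commutant_opsD(4)[OF z that(2)])
  qed
  \<comment> \<open>Centrality of \<open>z\<close> enters here: \<open>v \<mapsto> proj V (C (B v))\<close> is an operator on \<open>V\<close>.\<close>
  have G_z: "proj V (C w) = z (proj V (C u))" if "?G u w" "C \<in> commutant_ops U" for C u w
    using that(1)
  proof (induction rule: transport.induct)
    case tr_zero
    then show ?case
      by (simp add: lin_op_zero[OF commutant_opsD(1)[OF that(2)]] lin_op_zero[OF proj_lin[OF V]]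
          lin_op_zero[OF commutant_opsD(1)[OF z]])
  next
    case (tr_step B v u w)
    let ?D = "\<lambda>v. proj V (C (B (proj V v)))"
    have "?D \<in> carrier (corner_algebra (commutant U) (proj V))"
      using commutant_mult[OF that(2) tr_step(1)] by (auto simp: corner_algebra_def)
    then have D: "?D \<in> commutant_ops V" using corner_commutant[OF U V VU] by simp
    have "proj V (C (B (z v))) = z (proj V (C (B v)))"
      using fun_cong[OF zc[OF D], of v] tr_step(2)
      by (simp add: proj_id[OF V] proj_commutant_op[OF V z])
    then show ?case
      by (simp add: lin_op_add[OF commutant_opsD(1)[OF that(2)]] lin_op_add[OF proj_lin[OF V]]
          lin_op_add[OF commutant_opsD(1)[OF z]] tr_step)
  qed
  have G_image: "w \<in> N" if "?G u w" for u w
    using that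
  proof (induction rule: transport.induct)
    case tr_zero
    then show ?case using transport.tr_zero[of U V z] by (auto simp: N_def)
  next
    case (tr_step B v u w)
    then show ?case
      using transport.tr_step[OF tr_step(1), of "z v" V z] commutant_opsD(2)[OF z] by (auto simp: N_def)
  qed
  have orth: "\<langle>w, u\<rangle> = 0" if w: "?G (\<lambda>x. 0) w" and u: "?G u t" for w u t
    using u
  proof (induction rule: transport.induct)
    case tr_zero
    then show ?case by simp
  next
    case (tr_step B v u t)
    obtain C where C: "C \<in> commutant_ops U" "\<And>u v. \<langle>B u, v\<rangle> = \<langle>u, C v\<rangle>"
      using commutant_adjoint[OF U tr_step(1)] by metis
    have "proj V (C w) = (\<lambda>x. 0)"
      using G_z[OF w C(1)]
      by (simp add: lin_op_zero[OF commutant_opsD(1)[OF C(1)]] lin_op_zero[OF proj_lin[OF V]]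
          lin_op_zero[OF commutant_opsD(1)[OF z]])
    then have "\<langle>w, B v\<rangle> = 0"
      using C(2)[of v w] proj_form[OF V tr_step(2), of "C w"] by (simp add: wform_sym)
    then show ?case using tr_step.IH wform_lin_right[of X \<omega> w 1 "B v" 1 u] by simp
  qed
  have G_unique: "w = w'" if "?G u w" "?G u w'" for u w w'
  proof -
    have d: "?G (\<lambda>x. 0) (\<lambda>x. w x + (-1) * w' x)"
      using G_add[OF that(1) G_scale[OF that(2), of "-1"]] by simp
    have "\<langle>\<lambda>x. w x + (-1) * w' x, u\<rangle> = 0" if "u \<in> N" for u
      using orth[OF d] that by (auto simp: N_def)
    moreover have "(\<lambda>x. w x + (-1) * w' x) \<in> N" by (rule G_image[OF d])
    ultimately have "(\<lambda>x. w x + (-1) * w' x) = (\<lambda>x. 0)"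
      using anisotropic[OF U] U_N[OF d] by blast
    then show ?thesis by (simp add: fun_eq_iff)
  qed
  have N: "stable N"
    unfolding stable_def subspace_fun_def
  proof (intro conjI allI ballI impI)
    show "(\<lambda>x. 0) \<in> N" using tr_zero[of U V z] by (auto simp: N_def)
    fix c d u v assume "u \<in> N" "v \<in> N"
    then obtain w w' where "?G u w" "?G v w'" by (auto simp: N_def)
    from G_add[OF G_scale[OF this(1), of c] G_scale[OF this(2), of d]]
    show "(\<lambda>x. c * u x + d * v x) \<in> N" by (auto simp: N_def)
  next
    fix u x assume "u \<in> N" "x \<notin> X"
    then show "u x = 0" using U_N(1) stable_support[OF U] by (auto simp: N_def)
  next
    fix T u assume "T \<in> \<Theta>" "u \<in> N"
    then show "T u \<in> N" using G_Theta by (auto simp: N_def)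
  qed
  have NU: "N \<subseteq> U" using U_N(1) by (auto simp: N_def)
  define z' where "z' = (\<lambda>v. THE w. ?G (proj N v) w)"
  have Gz': "?G (proj N v) (z' v)" for v
  proof -
    obtain w where w: "?G (proj N v) w" using proj_in[OF N, of v] by (auto simp: N_def)
    then show ?thesis unfolding z'_def using G_unique[OF _ w] by (rule theI[of "?G (proj N v)"])
  qed
  have z'I: "z' v = w" if "?G (proj N v) w" for v w by (rule G_unique[OF Gz' that])
  have "z' \<in> commutant_ops U"
    unfolding commutant_ops_def lin_op_def
  proof (intro CollectI conjI allI ballI)
    fix c d u v
    show "z' (\<lambda>x. c * u x + d * v x) = (\<lambda>x. c * z' u x + d * z' v x)"
      by (rule z'I) (simp add: lin_opD[OF proj_lin[OF N]] G_add[OF G_scale[OF Gz'] G_scale[OF Gz']])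
  next
    fix v show "z' v \<in> U" by (rule U_N(2)[OF Gz'])
    show "z' (proj U v) = z' v" by (simp add: z'_def proj_sub(2)[OF U N NU])
  next
    fix T v assume "T \<in> \<Theta>"
    then show "z' (T v) = T (z' v)"
      by (intro z'I) (simp add: proj_Theta[OF N] G_Theta[OF Gz'])
  qed
  moreover have "(\<lambda>v. z' (B v)) = (\<lambda>v. B (z' v))" if B: "B \<in> commutant_ops U" for B
  proof
    fix v
    obtain C where C: "C \<in> commutant_ops U" "\<And>u v. \<langle>B u, v\<rangle> = \<langle>u, C v\<rangle>"
      using commutant_adjoint[OF U B] by metis
    have "proj N (B v) = B (proj N v)"
    proof (rule proj_unique[OF N])
      show "B (proj N v) \<in> N" using G_op[OF Gz' B] by (auto simp: N_def)
      fix u assume "u \<in> N"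
      then have "C u \<in> N" using G_op[OF _ C(1)] by (auto simp: N_def)
      then show "\<langle>B v, u\<rangle> = \<langle>B (proj N v), u\<rangle>" by (simp add: C(2) proj_form[OF N])
    qed
    then show "z' (B v) = B (z' v)" by (intro z'I) (simp add: G_op[OF Gz' B])
  qed
  moreover have "proj V (z' (proj V v)) = z v" for v
  proof -
    let ?p = "proj V v"
    have "?G (proj V ?p) (proj V (z ?p))"
      by (rule step[OF proj_commutant[OF U V VU] proj_in[OF V]])
    then have G: "?G ?p (z v)"
      by (simp add: proj_id[OF V proj_in[OF V]] commutant_opsD(3)[OF z] proj_commutant_op[OF V z])
    then have "?p \<in> N" by (auto simp: N_def)
    then have "z' ?p = z v" by (intro z'I) (simp add: proj_id[OF N] G)
    then show ?thesis by (simp add: proj_commutant_op[OF V z])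
  qed
  ultimately show ?thesis by blast
qed

end

section \<open>The regular representation of the Hecke algebra of type B\<close>

text \<open>
The elements of the Weyl group are encoded by iterated coset representatives. The parabolic subgroup
on the nodes \<open>{i + 1..r}\<close> has \<open>2 (r - i + 1)\<close> cosets in the one on \<open>{i..r}\<close>, namely the possible
positions and signs of a token in a signed permutation. A token \<open>(p, s)\<close> starts at \<open>(i - 1, True)\<close>,
moves to the right with increasing \<open>p\<close>, turns to \<open>s = False\<close> at the special node \<open>r\<close>, and moves back.
A generator \<open>j\<close> not adjacent to the token passes it. To the left of the token it passes as the
generator \<open>j + 1\<close> of the smaller parabolic subgroup, because removing the token shifts the places.
\<close>

fun token_act :: "nat \<Rightarrow> nat \<Rightarrow> (nat \<times> bool) list \<Rightarrow> (nat \<times> bool) list" where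
  "token_act r j [] = []"
| "token_act r j ((p, s) # u) =
    (if j = p + 1 then (if j < r then (j, s) else (p, \<not> s)) # u
     else if j = p then (p - 1, s) # u
     else (p, s) # token_act r (if p < j then j else j + 1) u)"

text \<open>
Whether multiplication by the generator \<open>j\<close> increases the length.
\<close>

fun token_up :: "nat \<Rightarrow> (nat \<times> bool) list \<Rightarrow> bool" where
  "token_up j [] = True"
| "token_up j ((p, s) # u) =
    (if j = p + 1 then s else if j = p then \<not> s else token_up (if p < j then j else j + 1) u)"

fun token_valid :: "nat \<Rightarrow> nat \<Rightarrow> (nat \<times> bool) list \<Rightarrow> bool" where
  "token_valid r i [] = (i = r + 1)"
| "token_valid r i ((p, s) # u) = (i \<le> p + 1 \<and> p < r \<and> token_valid r (i + 1) u)"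

lemma token_act_valid: "token_valid r i w \<Longrightarrow> i \<le> j \<Longrightarrow> j \<le> r \<Longrightarrow> token_valid r i (token_act r j w)"
  by (induction r j w arbitrary: i rule: token_act.induct) (auto split: if_splits)

lemma token_act_involution: "token_valid r i w \<Longrightarrow> i \<le> j \<Longrightarrow> j \<le> r \<Longrightarrow> token_act r j (token_act r j w) = w"
  by (induction r j w arbitrary: i rule: token_act.induct) (auto split: if_splits)

lemma token_up_act:
  assumes "token_valid r i w" "1 \<le> i" "i \<le> j" "j \<le> r"
  shows "token_up j (token_act r j w) = (\<not> token_up j w)"
  using assms
proof (induction w arbitrary: i j)
  case (Cons t u)
  obtain p s where t: "t = (p, s)" by (cases t)
  consider "j = p" | "j = p + 1" | "j < p" | "p + 1 < j" using Cons.prems by linarith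
  then show ?case
    by cases (use Cons.prems Cons.IH[of "i + 1" "j + 1"] Cons.IH[of "i + 1" j] in \<open>auto simp: t\<close>)
qed simp

lemma token_act_commute:
  assumes "token_valid r i w" "i \<le> j" "j + 1 < k" "k \<le> r"
  shows "token_act r j (token_act r k w) = token_act r k (token_act r j w) \<and> token_up j (token_act r k w) = token_up j w \<and> token_up k (token_act r j w) = token_up k w"
  using assms
proof (induction w arbitrary: i j k)
  case (Cons t u)
  obtain p s where t: "t = (p, s)" by (cases t)
  consider "k < p" | "k = p" | "k = p + 1" | "j < p" "p + 1 < k" | "j = p" "p + 1 < k" | "j = p + 1" | "p + 1 < j"
    using Cons.prems by linarith
  then show ?case
    by cases (use Cons.prems Cons.IH[of "i + 1" "j + 1" "k + 1"] Cons.IH[of "i + 1" "j + 1" k] Cons.IH[of "i + 1" j k] in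
      \<open>auto simp: t\<close>)
qed simp

text \<open>
Besides the braid relation for the action this describes how the six edges of an orbit of
\<open>\<langle>s\<^sub>j, s\<^sub>k\<rangle>\<close> are oriented: opposite edges are parallel, and if the two simple reflections have
the same sign then the third one has it too. So every orbit has one source and one sink, opposite to each other.
\<close>

lemma token_act_braid3:
  assumes "token_valid r i w" "1 \<le> i" "i \<le> j" "k = j + 1" "k < r"
  shows "token_act r j (token_act r k (token_act r j w)) = token_act r k (token_act r j (token_act r k w)) \<and>
    token_up j (token_act r k w) = token_up k (token_act r j w) \<and>
    token_up j (token_act r k (token_act r j w)) = token_up k w \<and> token_up k (token_act r j (token_act r k w)) = token_up j w \<and>
    (token_up j w = token_up k w \<longrightarrow> token_up k (token_act r j w) = token_up j w)"
  using assms
proof (induction w arbitrary: i j k)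
  case (Cons t u)
  obtain p s where t: "t = (p, s)" by (cases t)
  consider "k < p" | "k = p" | "k = p + 1" | "j = p + 1" | "p + 1 < j"
    using Cons.prems by linarith
  then show ?case
    by cases (use Cons.prems Cons.IH[of "i + 1" "j + 1" "k + 1"] Cons.IH[of "i + 1" j k] in
      \<open>auto simp: t\<close>)
qed simp

text \<open>
The same for the orbits with eight edges at the special node. The last two conditions say that the
signs of the four reflections, in their cyclic order, change at most once.
\<close>

lemma token_act_braid4:
  assumes "token_valid r i w" "1 \<le> i" "i \<le> j" "r = j + 1"
  shows "token_act r j (token_act r r (token_act r j (token_act r r w))) = token_act r r (token_act r j (token_act r r (token_act r j w))) \<and>
    token_up j (token_act r r (token_act r j w)) = token_up j (token_act r r w) \<and> token_up r (token_act r j (token_act r r w)) = token_up r (token_act r j w) \<and>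
    token_up r (token_act r j (token_act r r (token_act r j w))) = token_up r w \<and> token_up j (token_act r r (token_act r j (token_act r r w))) = token_up j w \<and>
    (token_up j w = token_up r w \<longrightarrow> token_up r (token_act r j w) = token_up j w \<and> token_up j (token_act r r w) = token_up j w) \<and>
    (token_up j w \<noteq> token_up r w \<longrightarrow> token_up r (token_act r j w) = token_up j w \<or> token_up j (token_act r r w) = token_up r w)"
  using assms
proof (induction w arbitrary: i)
  case (Cons t u)
  obtain p s where t: "t = (p, s)" by (cases t)
  consider "j = p" | "j = p + 1" | "p + 1 < j"
    using Cons.prems t by fastforce
  then show ?case
    by cases (use Cons.prems Cons.IH[of "i + 1"] in \<open>auto simp: t\<close>)
qed simp

definition token_states :: "nat \<Rightarrow> (nat \<times> bool) list set" where
  "token_states r = {w. token_valid r 1 w}"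

lemma finite_token_states: "finite (token_states r)"
proof -
  have "token_valid r i w \<Longrightarrow> length w + i = r + 1 \<and> set w \<subseteq> {..<r} \<times> UNIV" for i w
    by (induction r i w rule: token_valid.induct) auto
  then have "token_states r \<subseteq> {w. set w \<subseteq> {..<r} \<times> UNIV \<and> length w = r}"
    by (fastforce simp: token_states_def)
  then show ?thesis by (rule finite_subset) (simp add: finite_lists_length_eq)
qed

text \<open>
Up to a constant factor, the power of \<open>q\<close> whose exponent is the length. This is the norm which makes
the generators self-adjoint.
\<close>

fun token_weight :: "'k::comm_ring_1 \<Rightarrow> nat \<Rightarrow> (nat \<times> bool) list \<Rightarrow> 'k" where
  "token_weight q r [] = 1"
| "token_weight q r ((p, s) # u) = (if s then q ^ p else q ^ (2 * r - 1 - p)) * token_weight q r u"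

lemma token_weight_up: "token_valid r i w \<Longrightarrow> 1 \<le> i \<Longrightarrow> i \<le> j \<Longrightarrow> j \<le> r \<Longrightarrow> token_up j w \<Longrightarrow> token_weight q r (token_act r j w) = q * token_weight q r w"
proof (induction w arbitrary: i j)
  case (Cons t u)
  obtain p s where t: "t = (p, s)" by (cases t)
  consider "j = p" | "j = p + 1" "j < r" | "j = p + 1" "j = r" | "j < p" | "p + 1 < j" using Cons.prems by linarith
  then show ?case
  proof cases
    case 1
    then have "2 * r - Suc (p - Suc 0) = Suc (2 * r - Suc p)" using Cons.prems by (simp add: t) arith
    then show ?thesis using 1 Cons.prems by (auto simp: t)
  next
    case 3
    then have "2 * r - 1 - p = Suc p" by simp
    then show ?thesis using 3 Cons.prems by (auto simp: t)
  qed (use Cons.prems Cons.IH[of "i + 1" "j + 1"] Cons.IH[of "i + 1" j] in \<open>auto simp: t mult_ac\<close>)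
qed simp

text \<open>
Right multiplication by \<open>T\<^sub>j\<close> on coordinate vectors. Outside the set of valid states it is the scalar
\<open>q\<close>, the index representation, so that all relations hold as identities between operators on the whole
function space.
\<close>

definition hecke_op :: "'k::comm_ring_1 \<Rightarrow> nat \<Rightarrow> nat \<Rightarrow> ((nat \<times> bool) list \<Rightarrow> 'k) \<Rightarrow> (nat \<times> bool) list \<Rightarrow> 'k" where
  "hecke_op q r j v w =
    (if w \<in> token_states r then (if token_up j w then q * v (token_act r j w) else v (token_act r j w) + (q - 1) * v w) else q * v w)"

lemma hecke_op_quadratic:
  assumes "1 \<le> j" "j \<le> r"
  shows "hecke_op q r j (hecke_op q r j v) = (\<lambda>w. (q - 1) * hecke_op q r j v w + q * v w)"
proof
  fix w
  show "hecke_op q r j (hecke_op q r j v) w = (q - 1) * hecke_op q r j v w + q * v w"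
  proof (cases "w \<in> token_states r")
    case True
    then have "token_act r j w \<in> token_states r" "token_act r j (token_act r j w) = w" "token_up j (token_act r j w) = (\<not> token_up j w)"
      using assms token_act_valid token_act_involution token_up_act by (auto simp: token_states_def)
    then show ?thesis using True by (simp add: hecke_op_def algebra_simps)
  qed (simp add: hecke_op_def algebra_simps)
qed

lemma hecke_op_commute:
  assumes "1 \<le> j" "j + 1 < k" "k \<le> r"
  shows "hecke_op q r j (hecke_op q r k v) = hecke_op q r k (hecke_op q r j v)"
proof
  fix w
  show "hecke_op q r j (hecke_op q r k v) w = hecke_op q r k (hecke_op q r j v) w"
  proof (cases "w \<in> token_states r")
    case True
    then have "token_act r j w \<in> token_states r" "token_act r k w \<in> token_states r"
      using assms token_act_valid by (auto simp: token_states_def)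
    then show ?thesis using True token_act_commute[of r 1 w j k] assms
      by (simp add: hecke_op_def token_states_def algebra_simps)
  qed (simp add: hecke_op_def algebra_simps)
qed

lemma hecke_op_braid3:
  assumes "1 \<le> j" "k = j + 1" "k < r"
  shows "hecke_op q r j (hecke_op q r k (hecke_op q r j v)) = hecke_op q r k (hecke_op q r j (hecke_op q r k v))"
proof
  fix w
  show "hecke_op q r j (hecke_op q r k (hecke_op q r j v)) w = hecke_op q r k (hecke_op q r j (hecke_op q r k v)) w"
  proof (cases "w \<in> token_states r")
    case True
    have c: "token_act r i x \<in> token_states r \<and> token_act r i (token_act r i x) = x \<and> token_up i (token_act r i x) = (\<not> token_up i x)"
      if "i \<in> {j, k}" "x \<in> token_states r" for i x
      using assms that token_act_valid token_act_involution token_up_act by (auto simp: token_states_def)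
    note b = token_act_braid3[of r 1 w j k]
    show ?thesis using True c b assms
      by (cases "token_up j w"; cases "token_up k w"; cases "token_up k (token_act r j w)")
        (simp_all add: hecke_op_def token_states_def algebra_simps)
  qed (simp add: hecke_op_def algebra_simps)
qed

lemma hecke_op_braid4:
  assumes "1 \<le> j" "r = j + 1"
  shows "hecke_op q r j (hecke_op q r r (hecke_op q r j (hecke_op q r r v))) = hecke_op q r r (hecke_op q r j (hecke_op q r r (hecke_op q r j v)))"
proof
  fix w
  show "hecke_op q r j (hecke_op q r r (hecke_op q r j (hecke_op q r r v))) w = hecke_op q r r (hecke_op q r j (hecke_op q r r (hecke_op q r j v))) w"
  proof (cases "w \<in> token_states r")
    case True
    have c: "token_act r i x \<in> token_states r \<and> token_act r i (token_act r i x) = x \<and> token_up i (token_act r i x) = (\<not> token_up i x)"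
      if "i \<in> {j, r}" "x \<in> token_states r" for i x
      using assms that token_act_valid token_act_involution token_up_act by (auto simp: token_states_def)
    note b = token_act_braid4[of r 1 w j]
    show ?thesis using True c b assms
      by (cases "token_up j w"; cases "token_up r w"; cases "token_up r (token_act r j w)"; cases "token_up j (token_act r r w)")
        (simp_all add: hecke_op_def token_states_def algebra_simps)
  qed (simp add: hecke_op_def algebra_simps)
qed

lemma token_weight_pos: "0 < q \<Longrightarrow> 0 < token_weight (q::'k::linordered_field) r w"
  by (induction q r w rule: token_weight.induct) auto

lemma hecke_op_lin: "lin_op (hecke_op q r j)"
  by (auto simp: lin_op_def hecke_op_def algebra_simps)

lemma token_act_bij:
  assumes "1 \<le> j" "j \<le> r"
  shows "bij_betw (token_act r j) (token_states r) (token_states r)"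
  by (rule bij_betw_byWitness[where f' = "token_act r j"])
    (use assms token_act_involution token_act_valid in \<open>auto simp: token_states_def\<close>)

text \<open>
The operator couples \<open>w\<close> only to \<open>w s\<^sub>j\<close>, so this is a statement about pairs \<open>{w, w s\<^sub>j}\<close>: the
coefficients of the two directions are \<open>1\<close> and \<open>q\<close>, and the norms differ by the factor \<open>q\<close>.
\<close>

lemma hecke_op_adjoint:
  assumes j: "1 \<le> j" "j \<le> r"
  shows "wform (token_states r) (token_weight q r) (hecke_op q r j u) v = wform (token_states r) (token_weight q r) u (hecke_op q r j v)"
proof -
  define c where "c w = (if token_up j w then q else 1)" for w
  define d where "d w = (if token_up j w then 0 else q - 1)" for w
  have h: "hecke_op q r j v w = c w * v (token_act r j w) + d w * v w" if "w \<in> token_states r" for v w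
    using that by (simp add: hecke_op_def c_def d_def)
  have cw: "token_weight q r (token_act r j w) * c (token_act r j w) = token_weight q r w * c w" if "w \<in> token_states r" for w
  proof -
    have w: "token_valid r 1 w" "token_valid r 1 (token_act r j w)" using that token_act_valid j by (auto simp: token_states_def)
    note a = token_act_involution[OF w(1) j] token_up_act[OF w(1) _ j]
    show ?thesis
      using token_weight_up[OF w(1) _ j, of q] token_weight_up[OF w(2) _ j, of q] a
      by (cases "token_up j w") (auto simp: c_def mult_ac)
  qed
  have "(\<Sum>w\<in>token_states r. token_weight q r w * c w * u (token_act r j w) * v w) =
      (\<Sum>w\<in>token_states r. token_weight q r (token_act r j w) * c (token_act r j w) * u (token_act r j (token_act r j w)) * v (token_act r j w))"
    by (rule sum.reindex_bij_betw[OF token_act_bij[OF j], symmetric])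
  also have "\<dots> = (\<Sum>w\<in>token_states r. token_weight q r w * c w * u w * v (token_act r j w))"
    by (rule sum.cong) (use j token_act_involution cw in \<open>auto simp: token_states_def\<close>)
  finally have "(\<Sum>w\<in>token_states r. token_weight q r w * c w * u (token_act r j w) * v w) =
     (\<Sum>w\<in>token_states r. token_weight q r w * c w * u w * v (token_act r j w))" .
  then show ?thesis
    by (simp add: wform_def h sum.distrib algebra_simps)
qed

section \<open>The ground rings\<close>

abbreviation int_poly_K :: "int poly \<Rightarrow> K" where
  "int_poly_K p \<equiv> Fract (map_poly rat_of_int p) 1"

lemma int_poly_K_add: "int_poly_K (p + p') = int_poly_K p + int_poly_K p'"
proof -
  have "map_poly rat_of_int (p + p') = map_poly rat_of_int p + map_poly rat_of_int p'"
    by (rule poly_eqI) (simp add: coeff_map_poly)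
  then show ?thesis by simp
qed

lemma int_poly_K_uminus: "int_poly_K (- p) = - int_poly_K p"
proof -
  have "map_poly rat_of_int (- p) = - map_poly rat_of_int p"
    by (rule poly_eqI) (simp add: coeff_map_poly)
  then show ?thesis by simp
qed

lemma int_poly_K_mult: "int_poly_K (p * p') = int_poly_K p * int_poly_K p'"
proof -
  have "map_poly rat_of_int (p * p') = map_poly rat_of_int p * map_poly rat_of_int p'"
    by (rule poly_eqI) (simp add: coeff_map_poly coeff_mult)
  then show ?thesis by simp
qed

lemma int_poly_K_vK: "int_poly_K ([:0, 1:] ^ k) = vK ^ k"
proof (induction k)
  case 0
  then show ?case by (simp add: One_fract_def)
next
  case (Suc k)
  have "int_poly_K [:0, 1:] = vK" by (simp add: vK_def map_poly_pCons)
  then show ?case using Suc int_poly_K_mult[of "[:0, 1:]" "[:0, 1:] ^ k"] by (simp only: power_Suc)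
qed

lemma vK_nonzero: "vK \<noteq> 0"
  by (simp add: vK_def Zero_fract_def eq_fract)

lemma qK_pos: "qK > 0"
  using vK_nonzero by (simp add: qK_def)

lemma laurentA_I: "int_poly_K p / vK ^ k \<in> laurentA"
  by (auto simp: laurentA_def)

lemma int_poly_in_laurentA: "int_poly_K p \<in> laurentA"
  using laurentA_I[of p 0] by simp

lemma coeff_ring_laurentA: "coeff_ring laurentA"
  unfolding coeff_ring_def
proof (intro conjI ballI)
  show "0 \<in> laurentA" using int_poly_in_laurentA[of 0] by (simp add: Zero_fract_def)
  show "1 \<in> laurentA" using int_poly_in_laurentA[of 1] by (simp add: One_fract_def)
  fix a assume "a \<in> laurentA"
  then obtain p k where a: "a = int_poly_K p / vK ^ k" by (auto simp: laurentA_def)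
  have "- a = int_poly_K (- p) / vK ^ k" by (simp only: a int_poly_K_uminus minus_divide_left)
  then show "- a \<in> laurentA" by (simp only: laurentA_I)
  fix b assume "b \<in> laurentA"
  then obtain p' k' where b: "b = int_poly_K p' / vK ^ k'" by (auto simp: laurentA_def)
  have "a * b = int_poly_K (p * p') / vK ^ (k + k')"
    by (simp only: a b int_poly_K_mult power_add times_divide_times_eq)
  then show "a * b \<in> laurentA" by (simp only: laurentA_I)
  have "a + b = (int_poly_K p * vK ^ k' + int_poly_K p' * vK ^ k) / vK ^ (k + k')"
    using vK_nonzero by (simp only: a b) (simp add: field_simps power_add)
  also have "\<dots> = int_poly_K (p * [:0, 1:] ^ k' + p' * [:0, 1:] ^ k) / vK ^ (k + k')"
    by (simp only: int_poly_K_add int_poly_K_mult int_poly_K_vK)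
  finally show "a + b \<in> laurentA" by (simp only: laurentA_I)
qed

lemma laurentA_closed:
  "0 \<in> laurentA" "1 \<in> laurentA" "a \<in> laurentA \<Longrightarrow> - a \<in> laurentA"
  "a \<in> laurentA \<Longrightarrow> b \<in> laurentA \<Longrightarrow> a + b \<in> laurentA" "a \<in> laurentA \<Longrightarrow> b \<in> laurentA \<Longrightarrow> a * b \<in> laurentA"
  using coeff_ring_laurentA by (auto simp: coeff_ring_def)

lemma qK_laurentA: "qK \<in> laurentA" "qK - 1 \<in> laurentA"
proof -
  show "qK \<in> laurentA" using int_poly_in_laurentA[of "[:0, 1:] ^ 2"] by (simp only: int_poly_K_vK qK_def)
  from laurentA_closed(4)[OF this laurentA_closed(3)[OF laurentA_closed(2)]]
  show "qK - 1 \<in> laurentA" by simp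
qed

text \<open>
Common denominators of rational polynomials; they show that \<open>K\<close> is the fraction field of \<open>\<A>\<close>.
\<close>

lemma rat_poly_denominator: "\<exists>n p. n \<noteq> 0 \<and> Polynomial.smult (rat_of_int n) a = map_poly rat_of_int p"
proof (induction a)
  case 0
  show ?case by (rule exI[of _ 1], rule exI[of _ 0]) simp
next
  case (pCons c a)
  then obtain n p where np: "n \<noteq> 0" "Polynomial.smult (rat_of_int n) a = map_poly rat_of_int p" by auto
  obtain x y where xy: "c = rat_of_int x / rat_of_int y" "y > 0"
    by (metis quotient_of_denom_pos' quotient_of_div prod.collapse)
  have "Polynomial.smult (rat_of_int (n * y)) (pCons c a) = pCons (rat_of_int (n * x)) (Polynomial.smult (rat_of_int y) (Polynomial.smult (rat_of_int n) a))"
    using xy by (simp add: mult_ac)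
  also have "Polynomial.smult (rat_of_int y) (Polynomial.smult (rat_of_int n) a) = map_poly rat_of_int (Polynomial.smult y p)"
    unfolding np(2) by (rule poly_eqI) (simp add: coeff_map_poly)
  finally have "Polynomial.smult (rat_of_int (n * y)) (pCons c a) = map_poly rat_of_int (pCons (n * x) (Polynomial.smult y p))"
    by (simp add: map_poly_pCons)
  then show ?case using np(1) xy(2) by (intro exI[of _ "n * y"] exI[of _ "pCons (n * x) (Polynomial.smult y p)"]) auto
qed

lemma laurentA_fractions: "\<exists>a\<in>laurentA. \<exists>d\<in>laurentA. d \<noteq> 0 \<and> c = a / d"
proof -
  obtain p p' where c: "c = Fract p p'" "p' \<noteq> 0" by (cases c) auto
  obtain n x where x: "n \<noteq> 0" "Polynomial.smult (rat_of_int n) p = map_poly rat_of_int x" using rat_poly_denominator by blast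
  obtain m y where y: "m \<noteq> 0" "Polynomial.smult (rat_of_int m) p' = map_poly rat_of_int y" using rat_poly_denominator by blast
  have "Polynomial.smult (rat_of_int m) (map_poly rat_of_int x) = map_poly rat_of_int (Polynomial.smult m x)"
       "Polynomial.smult (rat_of_int n) (map_poly rat_of_int y) = map_poly rat_of_int (Polynomial.smult n y)"
    by (auto intro!: poly_eqI simp: coeff_map_poly)
  then have e: "map_poly rat_of_int (Polynomial.smult m x) = Polynomial.smult (rat_of_int (m * n)) p"
    "map_poly rat_of_int (Polynomial.smult n y) = Polynomial.smult (rat_of_int (m * n)) p'"
    using x(2)[symmetric] y(2)[symmetric] by (simp_all add: mult_ac)
  have nz: "rat_of_int (m * n) \<noteq> 0" using x y by simp
  have "int_poly_K (Polynomial.smult m x) / int_poly_K (Polynomial.smult n y) = c"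
    unfolding e c(1) using nz c(2) by (simp add: eq_fract)
  moreover have "int_poly_K (Polynomial.smult n y) \<noteq> 0" unfolding e using nz c(2) by (simp add: Zero_fract_def eq_fract)
  ultimately show ?thesis using int_poly_in_laurentA by metis
qed

section \<open>The Hecke algebra acting on functions\<close>

lemma ring_cong:
  fixes R :: "('a, 'm) ring_scheme" and S :: "('a, 'n) ring_scheme"
  assumes R: "ring R" and eq: "carrier S = carrier R" "mult S = mult R" "one S = one R" "zero S = zero R" "add S = add R"
  shows "ring S"
proof -
  interpret R: ring R by (rule R)
  show ?thesis
  proof (rule ringI)
    show "abelian_group S"
      by (rule abelian_groupI) (auto simp: eq R.a_ac intro: R.l_neg)
    show "monoid S" by (rule monoidI) (auto simp: eq R.m_assoc)
  qed (auto simp: eq R.l_distr R.r_distr)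
qed

definition words :: "nat \<Rightarrow> nat list monoid" where
  "words r = \<lparr>carrier = lists {1..r}, mult = (@), one = []\<rparr>"

lemma words_simps [simp]: "carrier (words r) = lists {1..r}" "u \<otimes>\<^bsub>words r\<^esub> u' = u @ u'" "\<one>\<^bsub>words r\<^esub> = []"
  by (simp_all add: words_def)

lemma words_monoid: "monoid (words r)"
  by (rule monoidI) auto

lemma free_algebra_eq: "free_algebra r = monoid_algebra laurentA (words r)"
  by (simp add: free_algebra_def words_def)

lemma free_algebra_ring: "ring (free_algebra r)"
  unfolding free_algebra_eq by (rule ma_ring[OF coeff_ring_laurentA words_monoid])

text \<open>
Words act from left to right, so that this is a right action of the free algebra.
\<close>

definition right_act :: "nat \<Rightarrow> (nat list \<Rightarrow> K) \<Rightarrow> ((nat \<times> bool) list \<Rightarrow> K) \<Rightarrow> (nat \<times> bool) list \<Rightarrow> K" where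
  "right_act r f v w = ma_eval (\<lambda>c. c) (\<lambda>u. fold (hecke_op qK r) u v w) f"

lemma fold_hecke_op_lin: "lin_op (fold (hecke_op q r) u)"
proof (induction u)
  case Nil
  show ?case by (simp add: lin_op_def)
next
  case (Cons i u)
  show ?case using lin_op_comp[OF Cons hecke_op_lin[of q r i]] by (simp add: comp_def)
qed

lemma right_act_mult:
  assumes f: "f \<in> carrier (free_algebra r)" and g: "g \<in> carrier (free_algebra r)"
  shows "right_act r (f \<otimes>\<^bsub>free_algebra r\<^esub> g) v = right_act r g (right_act r f v)"
proof
  fix w
  have fin: "finite {m. f m \<noteq> 0}" "finite {m. g m \<noteq> 0}"
    using f g by (auto simp: free_algebra_eq ma_carrier_iff)
  have "right_act r (f \<otimes>\<^bsub>free_algebra r\<^esub> g) v w =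
     (\<Sum>x | f x \<noteq> 0. \<Sum>y | g y \<noteq> 0. f x * g y * fold (hecke_op qK r) y (fold (hecke_op qK r) x v) w)"
    unfolding right_act_def free_algebra_eq by (subst ma_eval_mult[OF coeff_hom_id fin]) simp
  also have "\<dots> = (\<Sum>y | g y \<noteq> 0. \<Sum>x | f x \<noteq> 0. f x * g y * fold (hecke_op qK r) y (fold (hecke_op qK r) x v) w)"
    by (rule sum.swap)
  also have "\<dots> = (\<Sum>y | g y \<noteq> 0. g y * (\<Sum>x | f x \<noteq> 0. f x * fold (hecke_op qK r) y (fold (hecke_op qK r) x v) w))"
    by (simp add: sum_distrib_left mult_ac)
  also have "\<dots> = right_act r g (right_act r f v) w"
    unfolding right_act_def ma_eval_def
    by (intro sum.cong refl) (simp add: lin_op_sum[OF fold_hecke_op_lin])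
  finally show "right_act r (f \<otimes>\<^bsub>free_algebra r\<^esub> g) v w = right_act r g (right_act r f v) w" .
qed

lemma right_act_basis: "right_act r (basis_elt u) v = fold (hecke_op qK r) u v"
  by (simp add: right_act_def fun_eq_iff ma_eval_basis[OF coeff_hom_id])

lemma right_act_scale: "finite {m. f m \<noteq> 0} \<Longrightarrow> right_act r (\<lambda>m. c * f m) v = (\<lambda>w. c * right_act r f v w)"
  by (simp add: right_act_def fun_eq_iff ma_eval_scale[OF coeff_hom_id])

lemma right_act_zero: "right_act r (\<lambda>m. 0) v = (\<lambda>w. 0)"
  by (simp add: right_act_def fun_eq_iff ma_eval_zero)

lemma right_act_add: "finite {m. f m \<noteq> 0} \<Longrightarrow> finite {m. g m \<noteq> 0} \<Longrightarrow>
    right_act r (\<lambda>m. f m + g m) v = (\<lambda>w. right_act r f v w + right_act r g v w)"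
  by (simp add: right_act_def fun_eq_iff ma_eval_add[OF coeff_hom_id])

lemma right_act_lin: "lin_op (right_act r f)"
  unfolding lin_op_def right_act_def ma_eval_def
  by (auto simp: lin_opD[OF fold_hecke_op_lin] sum_distrib_left sum.distrib[symmetric] algebra_simps)

lemma fa_scale_closed:
  "c \<in> laurentA \<Longrightarrow> f \<in> carrier (free_algebra r) \<Longrightarrow> (\<lambda>m. c * f m) \<in> carrier (free_algebra r)"
  by (auto simp: free_algebra_eq ma_carrier_iff laurentA_closed intro: finite_subset[rotated])

lemma fa_basis_closed: "u \<in> lists {1..r} \<Longrightarrow> basis_elt u \<in> carrier (free_algebra r)"
  unfolding free_algebra_eq by (rule basis_elt_carrier[OF coeff_ring_laurentA]) simp

lemma fa_add: "f \<oplus>\<^bsub>free_algebra r\<^esub> g = (\<lambda>m. f m + g m)" by (simp add: free_algebra_eq ma_add)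

lemma fa_zero: "\<zero>\<^bsub>free_algebra r\<^esub> = (\<lambda>m. 0)" by (simp add: free_algebra_eq ma_zero)

lemma fa_one: "\<one>\<^bsub>free_algebra r\<^esub> = basis_elt []" by (simp add: free_algebra_eq ma_one)

lemma fa_smult: "c \<odot>\<^bsub>free_algebra r\<^esub> f = (\<lambda>m. c * f m)" by (simp add: free_algebra_eq ma_smult)

lemma fa_finite: "f \<in> carrier (free_algebra r) \<Longrightarrow> finite {m. f m \<noteq> 0}" by (simp add: free_algebra_eq ma_carrier_iff)

lemma fa_minus:
  "f \<in> carrier (free_algebra r) \<Longrightarrow> g \<in> carrier (free_algebra r) \<Longrightarrow>
    f \<ominus>\<^bsub>free_algebra r\<^esub> g = (\<lambda>m. f m - g m)"
  unfolding free_algebra_eq by (rule ma_minus[OF coeff_ring_laurentA])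

lemma fa_mult_basis: "basis_elt u \<otimes>\<^bsub>free_algebra r\<^esub> basis_elt u' = basis_elt (u @ u')"
  by (simp add: free_algebra_eq ma_mult_basis)

lemma fa_mult_scale_left:
  assumes "f \<in> carrier (free_algebra r)" "g \<in> carrier (free_algebra r)" "c \<in> laurentA"
  shows "(\<lambda>m. c * f m) \<otimes>\<^bsub>free_algebra r\<^esub> g = (\<lambda>m. c * (f \<otimes>\<^bsub>free_algebra r\<^esub> g) m)"
  using assms fa_finite[OF fa_scale_closed[OF assms(3,1)]]
  by (auto simp: free_algebra_eq ma_mult_eval_left ma_finite ma_eval_scale[OF coeff_hom_id])

lemma fa_mult_scale_right:
  assumes "f \<in> carrier (free_algebra r)" "g \<in> carrier (free_algebra r)" "c \<in> laurentA"
  shows "f \<otimes>\<^bsub>free_algebra r\<^esub> (\<lambda>m. c * g m) = (\<lambda>m. c * (f \<otimes>\<^bsub>free_algebra r\<^esub> g) m)"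
  using assms fa_finite[OF fa_scale_closed[OF assms(3,2)]]
  by (auto simp: free_algebra_eq ma_mult_eval_right ma_finite ma_eval_scale[OF coeff_hom_id])

lemma hecke_relations_closed: "hecke_relations r \<subseteq> carrier (free_algebra r)"
proof -
  interpret ring "free_algebra r" by (rule free_algebra_ring)
  show ?thesis
    unfolding hecke_relations_def
    by (auto simp: fa_smult split: if_splits intro!: minus_closed a_closed fa_basis_closed fa_scale_closed qK_laurentA)
qed

lemma right_act_minus:
  assumes "f \<in> carrier (free_algebra r)" "g \<in> carrier (free_algebra r)"
  shows "right_act r (f \<ominus>\<^bsub>free_algebra r\<^esub> g) v = (\<lambda>w. right_act r f v w - right_act r g v w)"
proof -
  have "(\<lambda>m. f m - g m) = (\<lambda>m. f m + (-1) * g m)" by simp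
  moreover have "(\<lambda>m. (-1) * g m) \<in> carrier (free_algebra r)"
    by (rule fa_scale_closed[OF laurentA_closed(3)[OF laurentA_closed(2)] assms(2)])
  then have "right_act r (\<lambda>m. f m + (-1) * g m) v = (\<lambda>w. right_act r f v w + (-1) * right_act r g v w)"
    by (simp only: right_act_add[OF fa_finite[OF assms(1)] fa_finite] right_act_scale[OF fa_finite[OF assms(2)]])
  ultimately show ?thesis by (simp add: fa_minus[OF assms])
qed

lemma right_act_relations:
  assumes "f \<in> hecke_relations r"
  shows "right_act r f v = (\<lambda>w. 0)"
proof -
  have z: "right_act r (basis_elt u \<ominus>\<^bsub>free_algebra r\<^esub> basis_elt u') v = (\<lambda>w. 0)"
    if "u \<in> lists {1..r}" "u' \<in> lists {1..r}" "fold (hecke_op qK r) u v = fold (hecke_op qK r) u' v" for u u'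
    using that by (simp add: right_act_minus fa_basis_closed right_act_basis)
  from assms consider
      (quad) i where "i \<in> {1..r}" "f = basis_elt [i, i] \<ominus>\<^bsub>free_algebra r\<^esub>
        (((qK - 1) \<odot>\<^bsub>free_algebra r\<^esub> basis_elt [i]) \<oplus>\<^bsub>free_algebra r\<^esub> (qK \<odot>\<^bsub>free_algebra r\<^esub> basis_elt []))"
    | (comm) i j where "i \<in> {1..r}" "j \<in> {1..r}" "i + 1 < j \<or> j + 1 < i"
        "f = basis_elt [i, j] \<ominus>\<^bsub>free_algebra r\<^esub> basis_elt [j, i]"
    | (b3) i where "1 \<le> i" "i + 1 < r" "f = basis_elt [i, i + 1, i] \<ominus>\<^bsub>free_algebra r\<^esub> basis_elt [i + 1, i, i + 1]"
    | (b4) "2 \<le> r" "f = basis_elt [r - 1, r, r - 1, r] \<ominus>\<^bsub>free_algebra r\<^esub> basis_elt [r, r - 1, r, r - 1]"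
    by (auto simp: hecke_relations_def split: if_splits)
  then show ?thesis
  proof cases
    case quad
    let ?g = "\<lambda>u m. (qK - 1) * basis_elt [i] m" and ?h = "\<lambda>m. qK * basis_elt [] m"
    have b: "basis_elt [i] \<in> carrier (free_algebra r)" "basis_elt [] \<in> carrier (free_algebra r)"
      "basis_elt [i, i] \<in> carrier (free_algebra r)"
      using quad(1) by (auto intro!: fa_basis_closed)
    note c = fa_scale_closed[OF qK_laurentA(2) b(1)] fa_scale_closed[OF qK_laurentA(1) b(2)]
    have "right_act r f v = (\<lambda>w. right_act r (basis_elt [i, i]) v w -
        ((qK - 1) * right_act r (basis_elt [i]) v w + qK * right_act r (basis_elt []) v w))"
      unfolding quad(2) fa_smult fa_add
      using ring.ring_simprules(1)[OF free_algebra_ring c, unfolded fa_add]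
      by (subst right_act_minus)
        (simp_all add: b right_act_add[OF fa_finite[OF c(1)] fa_finite[OF c(2)]] right_act_scale[OF fa_finite[OF b(1)]]
          right_act_scale[OF fa_finite[OF b(2)]])
    then show ?thesis using hecke_op_quadratic[of i r qK v] quad(1) by (simp add: right_act_basis)
  next
    case comm
    then show ?thesis unfolding comm(4) by (intro z) (auto simp: hecke_op_commute[of i j r] hecke_op_commute[of j i r])
  next
    case b3
    then show ?thesis unfolding b3(3) by (intro z) (auto simp: hecke_op_braid3[of i "Suc i" r])
  next
    case b4
    then show ?thesis unfolding b4(2) by (intro z) (auto simp: hecke_op_braid4[of "r - Suc 0" r])
  qed
qed

lemma hecke_ideal_ideal: "ideal (hecke_ideal r) (free_algebra r)"
  unfolding hecke_ideal_def by (rule ring.genideal_ideal[OF free_algebra_ring hecke_relations_closed])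

text \<open>
The elements acting by zero form a two-sided ideal which contains the defining relations.
\<close>

lemma right_act_hecke_ideal:
  assumes "f \<in> hecke_ideal r"
  shows "right_act r f v = (\<lambda>w. 0)"
proof -
  interpret ring "free_algebra r" by (rule free_algebra_ring)
  let ?J = "{f \<in> carrier (free_algebra r). \<forall>v. right_act r f v = (\<lambda>w. 0)}"
  have "ideal ?J (free_algebra r)"
  proof (rule idealI[OF free_algebra_ring])
    show "subgroup ?J (add_monoid (free_algebra r))"
    proof (rule add.subgroupI)
      show "?J \<subseteq> carrier (free_algebra r)" by auto
      show "?J \<noteq> {}" using zero_closed by (auto simp: fa_zero right_act_zero)
      fix f assume f: "f \<in> ?J"
      have "right_act r (\<zero>\<^bsub>free_algebra r\<^esub> \<ominus>\<^bsub>free_algebra r\<^esub> f) v = (\<lambda>w. 0)" for v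
        using f right_act_minus[OF zero_closed, of f v] by (simp add: fa_zero right_act_zero)
      then show "\<ominus>\<^bsub>free_algebra r\<^esub> f \<in> ?J" using f by (simp add: a_minus_def)
      fix g assume "g \<in> ?J"
      then show "f \<oplus>\<^bsub>free_algebra r\<^esub> g \<in> ?J"
        using f a_closed[of f g] by (auto simp: fa_add right_act_add fa_finite)
    qed
    fix f g assume "f \<in> ?J" "g \<in> carrier (free_algebra r)"
    then show "g \<otimes>\<^bsub>free_algebra r\<^esub> f \<in> ?J" "f \<otimes>\<^bsub>free_algebra r\<^esub> g \<in> ?J"
      by (auto simp: right_act_mult lin_op_zero[OF right_act_lin])
  qed
  then have "hecke_ideal r \<subseteq> ?J"
    unfolding hecke_ideal_def
    by (rule genideal_minimal) (use hecke_relations_closed right_act_relations in auto)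
  then show ?thesis using assms by auto
qed

definition hecke_class :: "nat \<Rightarrow> (nat list \<Rightarrow> K) \<Rightarrow> (nat list \<Rightarrow> K) set" where
  "hecke_class r f = hecke_ideal r +>\<^bsub>free_algebra r\<^esub> f"

lemma hecke_ring: "ring (hecke r)"
  by (rule ring_cong[OF ideal.quotient_is_ring[OF hecke_ideal_ideal, of r]])
    (simp_all add: hecke_def quotient_algebra_def)

lemma hecke_carrier: "carrier (hecke r) = hecke_class r ` carrier (free_algebra r)"
  by (auto simp: hecke_def quotient_algebra_def FactRing_def A_RCOSETS_def' hecke_class_def)

lemma hecke_class_hom:
  assumes "f \<in> carrier (free_algebra r)" "g \<in> carrier (free_algebra r)"
  shows "hecke_class r (f \<otimes>\<^bsub>free_algebra r\<^esub> g) = hecke_class r f \<otimes>\<^bsub>hecke r\<^esub> hecke_class r g"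
    "hecke_class r (\<lambda>m. f m + g m) = hecke_class r f \<oplus>\<^bsub>hecke r\<^esub> hecke_class r g"
    "hecke_class r (basis_elt []) = \<one>\<^bsub>hecke r\<^esub>"
    "hecke_class r (\<lambda>m. 0) = \<zero>\<^bsub>hecke r\<^esub>"
proof -
  interpret ring_hom_ring "free_algebra r" "free_algebra r Quot hecke_ideal r" "hecke_class r"
    unfolding hecke_class_def by (rule ideal.rcos_ring_hom_ring[OF hecke_ideal_ideal])
  show "hecke_class r (f \<otimes>\<^bsub>free_algebra r\<^esub> g) = hecke_class r f \<otimes>\<^bsub>hecke r\<^esub> hecke_class r g"
    using assms by (simp add: hecke_def quotient_algebra_def)
  show "hecke_class r (\<lambda>m. f m + g m) = hecke_class r f \<oplus>\<^bsub>hecke r\<^esub> hecke_class r g"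
    using hom_add[OF assms] by (simp add: hecke_def quotient_algebra_def fa_add)
  show "hecke_class r (basis_elt []) = \<one>\<^bsub>hecke r\<^esub>"
    using hom_one by (simp add: hecke_def quotient_algebra_def fa_one)
  show "hecke_class r (\<lambda>m. 0) = \<zero>\<^bsub>hecke r\<^esub>"
    using hom_zero by (simp add: hecke_def quotient_algebra_def fa_zero)
qed

lemma hecke_class_smult:
  assumes f: "f \<in> carrier (free_algebra r)" and c: "c \<in> laurentA"
  shows "c \<odot>\<^bsub>hecke r\<^esub> hecke_class r f = hecke_class r (\<lambda>m. c * f m)"
proof -
  interpret ring "free_algebra r" by (rule free_algebra_ring)
  have b: "basis_elt [] \<in> carrier (free_algebra r)" by (rule fa_basis_closed) simp
  have "c \<odot>\<^bsub>hecke r\<^esub> hecke_class r f = hecke_class r (\<lambda>m. c * basis_elt [] m) \<otimes>\<^bsub>hecke r\<^esub> hecke_class r f"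
    by (simp add: hecke_def quotient_algebra_def hecke_class_def fa_smult fa_one)
  also have "\<dots> = hecke_class r ((\<lambda>m. c * basis_elt [] m) \<otimes>\<^bsub>free_algebra r\<^esub> f)"
    by (rule hecke_class_hom(1)[OF fa_scale_closed[OF c b] f, symmetric])
  also have "(\<lambda>m. c * basis_elt [] m) \<otimes>\<^bsub>free_algebra r\<^esub> f = (\<lambda>m. c * f m)"
    using fa_mult_scale_left[OF b f c] l_one[OF f] by (simp add: fa_one)
  finally show ?thesis .
qed

lemma hecke_smult_closed:
  "X \<in> carrier (hecke r) \<Longrightarrow> c \<in> laurentA \<Longrightarrow> c \<odot>\<^bsub>hecke r\<^esub> X \<in> carrier (hecke r)"
  by (auto simp: hecke_carrier hecke_class_smult fa_scale_closed)

lemma hecke_smult_laws: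
  assumes X: "X \<in> carrier (hecke r)" and Y: "Y \<in> carrier (hecke r)" and c: "c \<in> laurentA" "d \<in> laurentA"
  shows "c \<odot>\<^bsub>hecke r\<^esub> (X \<oplus>\<^bsub>hecke r\<^esub> Y) = c \<odot>\<^bsub>hecke r\<^esub> X \<oplus>\<^bsub>hecke r\<^esub> c \<odot>\<^bsub>hecke r\<^esub> Y"
    "(c + d) \<odot>\<^bsub>hecke r\<^esub> X = c \<odot>\<^bsub>hecke r\<^esub> X \<oplus>\<^bsub>hecke r\<^esub> d \<odot>\<^bsub>hecke r\<^esub> X"
    "(c * d) \<odot>\<^bsub>hecke r\<^esub> X = c \<odot>\<^bsub>hecke r\<^esub> (d \<odot>\<^bsub>hecke r\<^esub> X)"
    "(c \<odot>\<^bsub>hecke r\<^esub> X) \<otimes>\<^bsub>hecke r\<^esub> Y = c \<odot>\<^bsub>hecke r\<^esub> (X \<otimes>\<^bsub>hecke r\<^esub> Y)"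
    "X \<otimes>\<^bsub>hecke r\<^esub> (c \<odot>\<^bsub>hecke r\<^esub> Y) = c \<odot>\<^bsub>hecke r\<^esub> (X \<otimes>\<^bsub>hecke r\<^esub> Y)"
    "1 \<odot>\<^bsub>hecke r\<^esub> X = X" "0 \<odot>\<^bsub>hecke r\<^esub> X = \<zero>\<^bsub>hecke r\<^esub>"
proof -
  interpret FA: ring "free_algebra r" by (rule free_algebra_ring)
  obtain f g where f: "f \<in> carrier (free_algebra r)" "X = hecke_class r f" and g: "g \<in> carrier (free_algebra r)" "Y = hecke_class r g"
    using X Y by (auto simp: hecke_carrier)
  note fg = FA.a_closed[OF f(1) g(1), unfolded fa_add] FA.m_closed[OF f(1) g(1)]
  note sc = fa_scale_closed[OF c(1) f(1)] fa_scale_closed[OF c(2) f(1)] fa_scale_closed[OF c(1) g(1)]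
  show "c \<odot>\<^bsub>hecke r\<^esub> (X \<oplus>\<^bsub>hecke r\<^esub> Y) = c \<odot>\<^bsub>hecke r\<^esub> X \<oplus>\<^bsub>hecke r\<^esub> c \<odot>\<^bsub>hecke r\<^esub> Y"
    unfolding f(2) g(2) by (simp add: hecke_class_hom(2)[symmetric] f g fg sc hecke_class_smult c distrib_left)
  show "(c + d) \<odot>\<^bsub>hecke r\<^esub> X = c \<odot>\<^bsub>hecke r\<^esub> X \<oplus>\<^bsub>hecke r\<^esub> d \<odot>\<^bsub>hecke r\<^esub> X"
    unfolding f(2) g(2) by (simp add: hecke_class_hom(2)[symmetric] f g fg sc hecke_class_smult c laurentA_closed distrib_right)
  show "(c * d) \<odot>\<^bsub>hecke r\<^esub> X = c \<odot>\<^bsub>hecke r\<^esub> (d \<odot>\<^bsub>hecke r\<^esub> X)"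
    unfolding f(2) g(2) by (simp add: f g fg sc hecke_class_smult c laurentA_closed mult.assoc)
  show "(c \<odot>\<^bsub>hecke r\<^esub> X) \<otimes>\<^bsub>hecke r\<^esub> Y = c \<odot>\<^bsub>hecke r\<^esub> (X \<otimes>\<^bsub>hecke r\<^esub> Y)"
    unfolding f(2) g(2) by (simp add: hecke_class_hom(1)[symmetric] f g fg sc hecke_class_smult c fa_mult_scale_left)
  show "X \<otimes>\<^bsub>hecke r\<^esub> (c \<odot>\<^bsub>hecke r\<^esub> Y) = c \<odot>\<^bsub>hecke r\<^esub> (X \<otimes>\<^bsub>hecke r\<^esub> Y)"
    unfolding f(2) g(2) by (simp add: hecke_class_hom(1)[symmetric] f g fg sc hecke_class_smult c fa_mult_scale_right)
  show "1 \<odot>\<^bsub>hecke r\<^esub> X = X" unfolding f(2) by (simp add: hecke_class_smult f laurentA_closed)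
  show "0 \<odot>\<^bsub>hecke r\<^esub> X = \<zero>\<^bsub>hecke r\<^esub>"
    unfolding f(2) by (simp add: hecke_class_smult f laurentA_closed hecke_class_hom(4)[OF f(1) f(1)])
qed

section \<open>Normal words and the faithfulness of the regular representation\<close>

definition T_word :: "nat \<Rightarrow> nat list \<Rightarrow> (nat list \<Rightarrow> K) set" where
  "T_word r u = hecke_class r (basis_elt u)"

lemma T_word_closed: "u \<in> lists {1..r} \<Longrightarrow> T_word r u \<in> carrier (hecke r)"
  by (simp add: T_word_def hecke_carrier fa_basis_closed)

lemma T_word_append:
  "u \<in> lists {1..r} \<Longrightarrow> u' \<in> lists {1..r} \<Longrightarrow> T_word r (u @ u') = T_word r u \<otimes>\<^bsub>hecke r\<^esub> T_word r u'"
  by (simp add: T_word_def hecke_class_hom(1)[symmetric] fa_basis_closed fa_mult_basis)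

lemma T_word_Nil: "T_word r [] = \<one>\<^bsub>hecke r\<^esub>"
  unfolding T_word_def by (rule hecke_class_hom(3)[of "basis_elt []" r "basis_elt []"]; rule fa_basis_closed; simp)

lemma hecke_class_eq_if_relation:
  assumes "f \<in> carrier (free_algebra r)" "g \<in> carrier (free_algebra r)"
    "f \<ominus>\<^bsub>free_algebra r\<^esub> g \<in> hecke_relations r"
  shows "hecke_class r f = hecke_class r g"
proof -
  have "f \<ominus>\<^bsub>free_algebra r\<^esub> g \<in> hecke_ideal r"
    unfolding hecke_ideal_def using ring.genideal_self[OF free_algebra_ring hecke_relations_closed] assms(3) by blast
  then show ?thesis
    unfolding hecke_class_def by (rule ring.quotient_eq_iff_same_a_r_cos[OF free_algebra_ring hecke_ideal_ideal assms(1,2), THEN iffD1])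
qed

lemma T_word_quadratic:
  assumes "i \<in> {1..r}"
  shows "T_word r [i, i] = (qK - 1) \<odot>\<^bsub>hecke r\<^esub> T_word r [i] \<oplus>\<^bsub>hecke r\<^esub> qK \<odot>\<^bsub>hecke r\<^esub> T_word r []"
proof -
  interpret FA: ring "free_algebra r" by (rule free_algebra_ring)
  have b: "basis_elt [i] \<in> carrier (free_algebra r)" "basis_elt [] \<in> carrier (free_algebra r)"
    "basis_elt [i, i] \<in> carrier (free_algebra r)"
    using assms by (auto intro!: fa_basis_closed)
  note c = fa_scale_closed[OF qK_laurentA(2) b(1)] fa_scale_closed[OF qK_laurentA(1) b(2)]
  have "hecke_class r (basis_elt [i, i]) = hecke_class r (((qK - 1) \<odot>\<^bsub>free_algebra r\<^esub> basis_elt [i]) \<oplus>\<^bsub>free_algebra r\<^esub>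
      (qK \<odot>\<^bsub>free_algebra r\<^esub> basis_elt []))"
    by (rule hecke_class_eq_if_relation)
      (use assms b c in \<open>auto simp: hecke_relations_def fa_smult intro!: FA.a_closed\<close>)
  then show ?thesis
    by (simp add: T_word_def fa_add fa_smult hecke_class_hom(2)[OF c] hecke_class_smult b qK_laurentA)
qed

definition word_eq :: "nat \<Rightarrow> nat list \<Rightarrow> nat list \<Rightarrow> bool" where
  "word_eq r u u' \<longleftrightarrow> u \<in> lists {1..r} \<and> u' \<in> lists {1..r} \<and> T_word r u = T_word r u'"

lemma word_eq_trans [trans]: "word_eq r u v \<Longrightarrow> word_eq r v w \<Longrightarrow> word_eq r u w"
  by (simp add: word_eq_def)

lemma word_eq_refl: "u \<in> lists {1..r} \<Longrightarrow> word_eq r u u"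
  by (simp add: word_eq_def)

lemma word_eq_ctx: "word_eq r u u' \<Longrightarrow> x \<in> lists {1..r} \<Longrightarrow> y \<in> lists {1..r} \<Longrightarrow> word_eq r (x @ u @ y) (x @ u' @ y)"
  by (simp add: word_eq_def T_word_append)

lemma word_eq_left: "word_eq r u u' \<Longrightarrow> x \<in> lists {1..r} \<Longrightarrow> word_eq r (x @ u) (x @ u')"
  using word_eq_ctx[of r u u' x "[]"] by simp

lemma word_eq_right: "word_eq r u u' \<Longrightarrow> y \<in> lists {1..r} \<Longrightarrow> word_eq r (u @ y) (u' @ y)"
  using word_eq_ctx[of r u u' "[]" y] by simp

lemma word_eqI:
  "u \<in> lists {1..r} \<Longrightarrow> u' \<in> lists {1..r} \<Longrightarrow>
    basis_elt u \<ominus>\<^bsub>free_algebra r\<^esub> basis_elt u' \<in> hecke_relations r \<Longrightarrow> word_eq r u u'"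
  unfolding word_eq_def T_word_def by (simp add: hecke_class_eq_if_relation fa_basis_closed)

lemma hecke_one_smult: "X \<in> carrier (hecke r) \<Longrightarrow> 1 \<odot>\<^bsub>hecke r\<^esub> X = X"
  by (rule hecke_smult_laws(6)[OF _ _ laurentA_closed(1) laurentA_closed(1)])

lemma hecke_zero_smult: "X \<in> carrier (hecke r) \<Longrightarrow> 0 \<odot>\<^bsub>hecke r\<^esub> X = \<zero>\<^bsub>hecke r\<^esub>"
  by (rule hecke_smult_laws(7)[OF _ _ laurentA_closed(1) laurentA_closed(1)])

lemma word_eq_commute:
  assumes "i \<in> {1..r}" "j \<in> {1..r}" "i + 1 < j \<or> j + 1 < i"
  shows "word_eq r [i, j] [j, i]"
  by (rule word_eqI) (use assms in \<open>auto simp: hecke_relations_def\<close>)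

lemma word_eq_braid3:
  assumes "1 \<le> i" "j = i + 1" "j < r"
  shows "word_eq r [i, j, i] [j, i, j]" "word_eq r [j, i, j] [i, j, i]"
proof -
  show "word_eq r [i, j, i] [j, i, j]"
    by (rule word_eqI) (use assms in \<open>auto simp: hecke_relations_def\<close>)
  then show "word_eq r [j, i, j] [i, j, i]" by (simp add: word_eq_def)
qed

lemma word_eq_braid4:
  assumes "1 \<le> j" "r = j + 1"
  shows "word_eq r [j, r, j, r] [r, j, r, j]"
  by (rule word_eqI) (use assms in \<open>auto simp: hecke_relations_def\<close>)

text \<open>
The path of the token from its start at \<open>i - 1\<close> to the state \<open>(p, s)\<close>: the minimal coset
representative of that state.
\<close>

definition coset_word :: "nat \<Rightarrow> nat \<Rightarrow> nat \<Rightarrow> bool \<Rightarrow> nat list" where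
  "coset_word r i p s = (if s then [i..<p + 1] else [i..<r + 1] @ rev [p + 1..<r])"

lemma coset_word_lists: "1 \<le> i \<Longrightarrow> p < r \<Longrightarrow> coset_word r i p s \<in> lists {1..r}"
  by (auto simp: coset_word_def)

lemma coset_word_pos_step: "1 \<le> i \<Longrightarrow> i \<le> p \<Longrightarrow> coset_word r i p True = coset_word r i (p - 1) True @ [p]"
  by (cases p) (auto simp: coset_word_def)

lemma coset_word_flip: "i \<le> r \<Longrightarrow> 1 \<le> i \<Longrightarrow> coset_word r i (r - 1) False = coset_word r i (r - 1) True @ [r]"
  by (auto simp: coset_word_def)

lemma coset_word_neg_step: "p + 1 < r \<Longrightarrow> coset_word r i p False = coset_word r i (p + 1) False @ [p + 1]"
  by (simp add: coset_word_def upt_conv_Cons)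

text \<open>
A letter not adjacent to the end of the path commutes to the left, or meets its own occurrence in
the path and is changed by a braid relation. The induction removes one or two letters at the end.
\<close>

lemma coset_word_pass_pos:
  assumes "1 \<le> i" "i \<le> p + 1" "p < r" "i \<le> j" "j \<le> r" "j \<noteq> p" "j \<noteq> p + 1"
  shows "word_eq r (coset_word r i p True @ [j]) ((if p < j then j else j + 1) # coset_word r i p True)"
  using assms
proof (induction p arbitrary: j rule: less_induct)
  case (less p)
  show ?case
  proof (cases "i = p + 1")
    case True
    then show ?thesis using less.prems by (auto simp: coset_word_def intro!: word_eq_refl)
  next
    case False
    then have p: "i \<le> p" "1 \<le> p" using less.prems by auto
    note D = coset_word_pos_step[OF less.prems(1) p(1), of r]
    note DL = coset_word_lists[OF less.prems(1), of "p - 1" r True] coset_word_lists[OF less.prems(1), of "p - 2" r True]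
    show ?thesis
    proof (cases "j + 1 = p")
      case True
      note D' = coset_word_pos_step[of i "p - 1" r]
      have "word_eq r (coset_word r i (p - 2) True @ [p - 1, p, p - 1]) (coset_word r i (p - 2) True @ [p, p - 1, p])"
        by (rule word_eq_left[OF word_eq_braid3(1)]) (use True less.prems DL in auto)
      also have "word_eq r ((coset_word r i (p - 2) True @ [p]) @ [p - 1, p]) ((p # coset_word r i (p - 2) True) @ [p - 1, p])"
        using less.IH[of "p - 2" p] less.prems True
        by (intro word_eq_right) (auto split: if_splits)
      then have "word_eq r (coset_word r i (p - 2) True @ [p, p - 1, p]) (p # coset_word r i (p - 2) True @ [p - 1, p])"
        by simp
      finally show ?thesis
        using D D' True less.prems by (auto simp: numeral_2_eq_2)
    next
      case jp: False
      have "word_eq r (coset_word r i (p - 1) True @ [p, j]) (coset_word r i (p - 1) True @ [j, p])"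
        by (rule word_eq_left[OF word_eq_commute]) (use jp p less.prems DL in auto)
      also have "word_eq r ((coset_word r i (p - 1) True @ [j]) @ [p])
          (((if p - 1 < j then j else j + 1) # coset_word r i (p - 1) True) @ [p])"
        by (rule word_eq_right[OF less.IH]) (use jp less.prems p in auto)
      then have "word_eq r (coset_word r i (p - 1) True @ [j, p])
          ((if p - 1 < j then j else j + 1) # coset_word r i (p - 1) True @ [p])" by simp
      finally show ?thesis using D less.prems jp by (auto split: if_splits)
    qed
  qed
qed

text \<open>
As before, for paths which have turned at the node \<open>r\<close>. The letter \<open>r\<close> itself, following a path which
turned back by one step only, needs the braid relation of length four.
\<close>

lemma coset_word_pass_neg:
  assumes "1 \<le> i" "i \<le> p + 1" "p < r" "i \<le> j" "j \<le> r" "j \<noteq> p" "j \<noteq> p + 1"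
  shows "word_eq r (coset_word r i p False @ [j]) ((if p < j then j else j + 1) # coset_word r i p False)"
  using assms
proof (induction "r - p" arbitrary: p j rule: less_induct)
  case less
  show ?case
  proof (cases "p + 1 = r")
    case True
    then have p: "p = r - 1" and jr: "j + 1 < r" using less.prems by auto
    note D = coset_word_flip[of i r]
    have "word_eq r (coset_word r i (r - 1) True @ [r, j]) (coset_word r i (r - 1) True @ [j, r])"
      by (rule word_eq_left[OF word_eq_commute]) (use jr less.prems coset_word_lists in auto)
    also have "word_eq r ((coset_word r i (r - 1) True @ [j]) @ [r]) (((j + 1) # coset_word r i (r - 1) True) @ [r])"
      using coset_word_pass_pos[of i "r - 1" r j] less.prems p jr by (intro word_eq_right) (auto split: if_splits)
    then have "word_eq r (coset_word r i (r - 1) True @ [j, r]) ((j + 1) # coset_word r i (r - 1) True @ [r])" by simp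
    finally show ?thesis using D less.prems p jr by auto
  next
    case False
    then have p: "p + 1 < r" using less.prems by auto
    note D = coset_word_neg_step[OF p, of i]
    note DL = coset_word_lists[OF less.prems(1)]
    show ?thesis
    proof (cases "j = p + 2")
      case jp: True
      show ?thesis
      proof (cases "j = r")
        case True
        have i: "i \<le> r - 1" "1 \<le> r - 1" using less.prems p jp True by auto
        have D': "coset_word r i p False = coset_word r i (r - 2) True @ [r - 1, r, r - 1]"
          using D coset_word_flip[of i r] coset_word_pos_step[of i "r - 1" r] less.prems jp True i
          by (auto simp: numeral_2_eq_2)
        have "word_eq r (coset_word r i (r - 2) True @ [r - 1, r, r - 1, r]) (coset_word r i (r - 2) True @ [r, r - 1, r, r - 1])"
          by (rule word_eq_left[OF word_eq_braid4]) (use i p DL[of "r - 2" r True] in auto)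
        also have "word_eq r ((coset_word r i (r - 2) True @ [r]) @ [r - 1, r, r - 1]) ((r # coset_word r i (r - 2) True) @ [r - 1, r, r - 1])"
          using coset_word_pass_pos[of i "r - 2" r r] less.prems i p
          by (intro word_eq_right) (auto split: if_splits)
        then have "word_eq r (coset_word r i (r - 2) True @ [r, r - 1, r, r - 1]) (r # coset_word r i (r - 2) True @ [r - 1, r, r - 1])"
          by simp
        finally show ?thesis using D' jp True by auto
      next
        case False
        then have p2: "p + 2 < r" using less.prems jp by auto
        then have D': "coset_word r i p False = coset_word r i (p + 2) False @ [p + 2, p + 1]"
          using D coset_word_neg_step[of "p + 1" r i] by simp
        have "word_eq r (coset_word r i (p + 2) False @ [p + 2, p + 1, p + 2]) (coset_word r i (p + 2) False @ [p + 1, p + 2, p + 1])"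
          by (rule word_eq_left[OF word_eq_braid3(2)]) (use p2 less.prems DL[of "p + 2" r False] in auto)
        also have "word_eq r ((coset_word r i (p + 2) False @ [p + 1]) @ [p + 2, p + 1]) (((p + 2) # coset_word r i (p + 2) False) @ [p + 2, p + 1])"
          using less.hyps[of "p + 2" "p + 1"] less.prems p2
          by (intro word_eq_right) (auto split: if_splits)
        then have "word_eq r (coset_word r i (p + 2) False @ [p + 1, p + 2, p + 1]) ((p + 2) # coset_word r i (p + 2) False @ [p + 2, p + 1])"
          by simp
        finally show ?thesis using D' jp by auto
      qed
    next
      case jp: False
      have "word_eq r (coset_word r i (p + 1) False @ [p + 1, j]) (coset_word r i (p + 1) False @ [j, p + 1])"
        by (rule word_eq_left[OF word_eq_commute]) (use jp p less.prems DL[of "p + 1" r False] in auto)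
      also have "word_eq r ((coset_word r i (p + 1) False @ [j]) @ [p + 1])
          (((if p + 1 < j then j else j + 1) # coset_word r i (p + 1) False) @ [p + 1])"
        by (rule word_eq_right[OF less.hyps]) (use jp less.prems p in auto)
      then have "word_eq r (coset_word r i (p + 1) False @ [j, p + 1])
          ((if p + 1 < j then j else j + 1) # coset_word r i (p + 1) False @ [p + 1])" by simp
      finally show ?thesis using D less.prems jp by (auto split: if_splits)
    qed
  qed
qed

lemma coset_word_pass:
  assumes "1 \<le> i" "i \<le> p + 1" "p < r" "i \<le> j" "j \<le> r" "j \<noteq> p" "j \<noteq> p + 1"
  shows "word_eq r (coset_word r i p s @ [j]) ((if p < j then j else j + 1) # coset_word r i p s)"
  using coset_word_pass_pos[OF assms] coset_word_pass_neg[OF assms] by (cases s) auto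

fun normal_word :: "nat \<Rightarrow> nat \<Rightarrow> (nat \<times> bool) list \<Rightarrow> nat list" where
  "normal_word r i [] = []"
| "normal_word r i ((p, s) # u) = normal_word r (i + 1) u @ coset_word r i p s"

lemma normal_word_lists: "token_valid r i w \<Longrightarrow> 1 \<le> i \<Longrightarrow> normal_word r i w \<in> lists {1..r}"
  by (induction r i w rule: normal_word.induct) (use coset_word_lists in auto)

lemma normal_word_up_step:
  assumes "token_valid r i w" "1 \<le> i" "i \<le> j" "j \<le> r" "w = (p, s) # u" "j = p \<or> j = p + 1" "token_up j w"
  shows "normal_word r i (token_act r j w) = normal_word r i w @ [j]"
proof -
  consider "j = p" "\<not> s" | "j = p + 1" "s" "j < r" | "j = p + 1" "s" "j = r"
    by (cases "j < r") (use assms in \<open>auto split: if_splits\<close>)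
  then show ?thesis
  proof cases
    case 1
    then show ?thesis using assms coset_word_neg_step[of "p - 1" r i] by auto
  next
    case 2
    then show ?thesis using assms coset_word_pos_step[of i "p + 1" r] by auto
  next
    case 3
    then show ?thesis using assms coset_word_flip[of i r] by auto
  qed
qed

text \<open>
The multiplication rule of the standard basis. A letter adjacent to the first token lengthens its coset
word, or repeats the last letter and is resolved by the quadratic relation. Any other letter passes the
coset word and is absorbed by the induction hypothesis.
\<close>

lemma T_normal_word_mult:
  assumes "token_valid r i w" "1 \<le> i" "i \<le> j" "j \<le> r"
  shows "T_word r (normal_word r i w) \<otimes>\<^bsub>hecke r\<^esub> T_word r [j] =
    (if token_up j w then 1 else qK) \<odot>\<^bsub>hecke r\<^esub> T_word r (normal_word r i (token_act r j w)) \<oplus>\<^bsub>hecke r\<^esub>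
    (if token_up j w then 0 else qK - 1) \<odot>\<^bsub>hecke r\<^esub> T_word r (normal_word r i w)"
  using assms
proof (induction w arbitrary: i j)
  case (Cons t u)
  interpret H: ring "hecke r" by (rule hecke_ring)
  obtain p s where t: "t = (p, s)" by (cases t)
  define w where "w = t # u"
  note prems = Cons.prems[folded w_def]
  note NL = normal_word_lists[OF prems(1,2)]
  note aw = token_act_valid[OF prems(1,3,4)]
  note NL' = normal_word_lists[OF aw prems(2)]
  note T = T_word_closed[OF NL] T_word_closed[OF NL']
  have jr: "[j] \<in> lists {1..r}" using prems by auto
  note Tj = T_word_closed[OF jr]
  show ?case unfolding w_def[symmetric]
  proof (cases "j = p \<or> j = p + 1")
    case True
    show "T_word r (normal_word r i w) \<otimes>\<^bsub>hecke r\<^esub> T_word r [j] =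
      (if token_up j w then 1 else qK) \<odot>\<^bsub>hecke r\<^esub> T_word r (normal_word r i (token_act r j w)) \<oplus>\<^bsub>hecke r\<^esub>
      (if token_up j w then 0 else qK - 1) \<odot>\<^bsub>hecke r\<^esub> T_word r (normal_word r i w)"
    proof (cases "token_up j w")
      case token_up: True
      have "normal_word r i (token_act r j w) = normal_word r i w @ [j]"
        by (rule normal_word_up_step[OF prems]) (use True token_up in \<open>auto simp: w_def t\<close>)
      then have e: "T_word r (normal_word r i (token_act r j w)) = T_word r (normal_word r i w) \<otimes>\<^bsub>hecke r\<^esub> T_word r [j]"
        by (simp only: T_word_append[OF NL jr])
      show ?thesis using token_up by (simp add: e hecke_one_smult hecke_zero_smult T Tj)
    next
      case down: False
      obtain p' s' where a: "token_act r j w = (p', s') # u" "j = p' \<or> j = p' + 1"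
        by (cases "j < r") (use True prems in \<open>auto simp: w_def t split: if_splits\<close>)
      have "normal_word r i w = normal_word r i (token_act r j w) @ [j]"
        using normal_word_up_step[OF aw prems(2-4) a(1,2)] token_up_act[OF prems] token_act_involution[OF prems(1,3,4)] down by simp
      then have e: "T_word r (normal_word r i w) = T_word r (normal_word r i (token_act r j w)) \<otimes>\<^bsub>hecke r\<^esub> T_word r [j]"
        by (simp only: T_word_append[OF NL' jr])
      have jj: "T_word r [j] \<otimes>\<^bsub>hecke r\<^esub> T_word r [j] = T_word r [j, j]"
        using T_word_append[OF jr jr] by simp
      have "T_word r (normal_word r i w) \<otimes>\<^bsub>hecke r\<^esub> T_word r [j] =
          T_word r (normal_word r i (token_act r j w)) \<otimes>\<^bsub>hecke r\<^esub> T_word r [j, j]"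
        unfolding e by (simp add: H.m_assoc T Tj jj)
      also have "T_word r [j, j] = (qK - 1) \<odot>\<^bsub>hecke r\<^esub> T_word r [j] \<oplus>\<^bsub>hecke r\<^esub> qK \<odot>\<^bsub>hecke r\<^esub> \<one>\<^bsub>hecke r\<^esub>"
        using T_word_quadratic[of j r] jr by (simp add: T_word_Nil)
      also have "T_word r (normal_word r i (token_act r j w)) \<otimes>\<^bsub>hecke r\<^esub> \<dots> =
         (qK - 1) \<odot>\<^bsub>hecke r\<^esub> T_word r (normal_word r i w) \<oplus>\<^bsub>hecke r\<^esub> qK \<odot>\<^bsub>hecke r\<^esub> T_word r (normal_word r i (token_act r j w))"
        by (simp add: H.r_distr T Tj hecke_smult_closed qK_laurentA e[symmetric] hecke_smult_laws(5)[OF T(2) Tj qK_laurentA(2) qK_laurentA(1)]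
            hecke_smult_laws(5)[OF T(2) H.one_closed qK_laurentA(1) qK_laurentA(1)])
      finally show ?thesis using down by (simp add: H.a_comm hecke_smult_closed T qK_laurentA)
    qed
  next
    case False
    define j' where "j' = (if p < j then j else j + 1)"
    have v: "token_valid r (i + 1) u" "i + 1 \<le> j'" "j' \<le> r" "i \<le> p + 1" "p < r"
      using prems False by (auto simp: w_def t j'_def)
    have nfw: "normal_word r i w = normal_word r (i + 1) u @ coset_word r i p s" by (simp add: w_def t)
    have act_w: "normal_word r i (token_act r j w) = normal_word r (i + 1) (token_act r j' u) @ coset_word r i p s" "token_up j w = token_up j' u"
      using False by (simp_all add: w_def t j'_def)
    have L: "normal_word r (i + 1) u \<in> lists {1..r}" "normal_word r (i + 1) (token_act r j' u) \<in> lists {1..r}" "[j'] \<in> lists {1..r}"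
       "coset_word r i p s \<in> lists {1..r}"
      using normal_word_lists v token_act_valid[OF v(1-3)] prems(2) coset_word_lists by auto
    note TL = L[THEN T_word_closed]
    let ?a = "if token_up j w then 1 else qK" and ?g = "if token_up j w then 0 else qK - 1"
    have ag: "?a \<in> laurentA" "?g \<in> laurentA" by (auto simp: laurentA_closed qK_laurentA)
    have "word_eq r (normal_word r (i + 1) u @ (coset_word r i p s @ [j])) (normal_word r (i + 1) u @ (j' # coset_word r i p s))"
      unfolding j'_def by (rule word_eq_left[OF coset_word_pass L(1)]) (use prems v False in auto)
    then have "T_word r (normal_word r i w @ [j]) = T_word r ((normal_word r (i + 1) u @ [j']) @ coset_word r i p s)"
      by (simp add: word_eq_def nfw)
    also have "\<dots> = (T_word r (normal_word r (i + 1) u) \<otimes>\<^bsub>hecke r\<^esub> T_word r [j']) \<otimes>\<^bsub>hecke r\<^esub> T_word r (coset_word r i p s)"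
      using L by (subst T_word_append) (auto simp: T_word_append)
    also have "T_word r (normal_word r (i + 1) u) \<otimes>\<^bsub>hecke r\<^esub> T_word r [j'] =
       ?a \<odot>\<^bsub>hecke r\<^esub> T_word r (normal_word r (i + 1) (token_act r j' u)) \<oplus>\<^bsub>hecke r\<^esub> ?g \<odot>\<^bsub>hecke r\<^esub> T_word r (normal_word r (i + 1) u)"
      unfolding act_w(2) by (rule Cons.IH[OF v(1) _ v(2,3)]) simp
    also have "\<dots> \<otimes>\<^bsub>hecke r\<^esub> T_word r (coset_word r i p s) =
       ?a \<odot>\<^bsub>hecke r\<^esub> T_word r (normal_word r i (token_act r j w)) \<oplus>\<^bsub>hecke r\<^esub> ?g \<odot>\<^bsub>hecke r\<^esub> T_word r (normal_word r i w)"
      unfolding act_w(1) nfw T_word_append[OF L(1,4)] T_word_append[OF L(2,4)]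
      using ag by (simp only: H.l_distr TL hecke_smult_closed hecke_smult_laws(4)[OF TL(2) TL(4) ag] hecke_smult_laws(4)[OF TL(1) TL(4) ag(2,1)])
    finally show "T_word r (normal_word r i w) \<otimes>\<^bsub>hecke r\<^esub> T_word r [j] =
       ?a \<odot>\<^bsub>hecke r\<^esub> T_word r (normal_word r i (token_act r j w)) \<oplus>\<^bsub>hecke r\<^esub> ?g \<odot>\<^bsub>hecke r\<^esub> T_word r (normal_word r i w)"
      by (simp only: T_word_append[OF NL jr])
  qed
qed simp

definition base_state :: "nat \<Rightarrow> (nat \<times> bool) list" where
  "base_state r = map (\<lambda>p. (p, True)) [0..<r]"

lemma base_state_props: "base_state r \<in> token_states r" "normal_word r (Suc 0) (base_state r) = []"
proof -
  have "k \<le> r \<Longrightarrow> token_valid r (k + 1) (map (\<lambda>p. (p, True)) [k..<r]) \<and> normal_word r (k + 1) (map (\<lambda>p. (p, True)) [k..<r]) = []" for k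
    by (induction k rule: inc_induct) (auto simp: upt_conv_Cons coset_word_def)
  from this[of 0] show "base_state r \<in> token_states r" "normal_word r (Suc 0) (base_state r) = []"
    by (auto simp: base_state_def token_states_def)
qed

definition e_base :: "nat \<Rightarrow> (nat \<times> bool) list \<Rightarrow> K" where
  "e_base r w = (if w = base_state r then 1 else 0)"

text \<open>
The coordinates of an element of the Hecke algebra, that is its action on the basis vector of the
identity.
\<close>

definition coords :: "nat \<Rightarrow> (nat list \<Rightarrow> K) set \<Rightarrow> (nat \<times> bool) list \<Rightarrow> K" where
  "coords r X = right_act r (SOME f. f \<in> carrier (free_algebra r) \<and> hecke_class r f = X) (e_base r)"

lemma coords_hecke_class:
  assumes f: "f \<in> carrier (free_algebra r)"
  shows "coords r (hecke_class r f) = right_act r f (e_base r)"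
proof -
  define g where "g = (SOME g. g \<in> carrier (free_algebra r) \<and> hecke_class r g = hecke_class r f)"
  have g: "g \<in> carrier (free_algebra r)" "hecke_class r g = hecke_class r f"
    using someI_ex[of "\<lambda>g. g \<in> carrier (free_algebra r) \<and> hecke_class r g = hecke_class r f"] f by (auto simp: g_def)
  have "g \<ominus>\<^bsub>free_algebra r\<^esub> f \<in> hecke_ideal r"
    using ring.quotient_eq_iff_same_a_r_cos[OF free_algebra_ring hecke_ideal_ideal g(1) f] g(2) by (simp add: hecke_class_def)
  from right_act_hecke_ideal[OF this, of "e_base r"] have "right_act r g (e_base r) = right_act r f (e_base r)"
    by (simp add: right_act_minus g f fun_eq_iff)
  then show ?thesis by (simp add: coords_def g_def)
qed

lemma coords_add:
  "X \<in> carrier (hecke r) \<Longrightarrow> Y \<in> carrier (hecke r) \<Longrightarrow>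
    coords r (X \<oplus>\<^bsub>hecke r\<^esub> Y) = (\<lambda>w. coords r X w + coords r Y w)"
  using ring.ring_simprules(1)[OF free_algebra_ring]
  by (auto simp: hecke_carrier hecke_class_hom(2)[symmetric] coords_hecke_class right_act_add fa_finite fa_add)

lemma coords_smult:
  "X \<in> carrier (hecke r) \<Longrightarrow> c \<in> laurentA \<Longrightarrow> coords r (c \<odot>\<^bsub>hecke r\<^esub> X) = (\<lambda>w. c * coords r X w)"
  by (auto simp: hecke_carrier hecke_class_smult coords_hecke_class fa_scale_closed right_act_scale fa_finite)

lemma coords_mult_T:
  "X \<in> carrier (hecke r) \<Longrightarrow> j \<in> {1..r} \<Longrightarrow> coords r (X \<otimes>\<^bsub>hecke r\<^esub> T_word r [j]) = hecke_op qK r j (coords r X)"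
  by (auto simp: hecke_carrier T_word_def hecke_class_hom(1)[symmetric] fa_basis_closed coords_hecke_class right_act_mult right_act_basis
      ring.ring_simprules(5)[OF free_algebra_ring])

lemma fold_hecke_op_support:
  "(\<And>w. w \<notin> token_states r \<Longrightarrow> v w = 0) \<Longrightarrow> w \<notin> token_states r \<Longrightarrow> fold (hecke_op q r) u v w = 0"
  by (induction u arbitrary: v) (auto simp: hecke_op_def)

lemma coords_support: "X \<in> carrier (hecke r) \<Longrightarrow> w \<notin> token_states r \<Longrightarrow> coords r X w = 0"
  using base_state_props(1)[of r]
  by (auto simp: hecke_carrier coords_hecke_class right_act_def ma_eval_def e_base_def intro!: sum.neutral fold_hecke_op_support)

lemma hecke_op_laurentA: "(\<And>w. v w \<in> laurentA) \<Longrightarrow> hecke_op qK r j v w \<in> laurentA"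
  by (simp add: hecke_op_def laurentA_closed qK_laurentA)

lemma fold_hecke_op_laurentA: "(\<And>w. v w \<in> laurentA) \<Longrightarrow> fold (hecke_op qK r) u v w \<in> laurentA"
  by (induction u arbitrary: v) (auto simp: hecke_op_laurentA)

lemma e_base_laurentA: "e_base r w \<in> laurentA"
  by (simp add: e_base_def laurentA_closed)

text \<open>
The candidate for the inverse of the coordinate map.
\<close>

definition of_coords :: "nat \<Rightarrow> ((nat \<times> bool) list \<Rightarrow> K) \<Rightarrow> (nat list \<Rightarrow> K) set" where
  "of_coords r v = (\<Oplus>\<^bsub>hecke r\<^esub>w \<in> token_states r. v w \<odot>\<^bsub>hecke r\<^esub> T_word r (normal_word r (Suc 0) w))"

context
  fixes r :: nat
begin

interpretation H: ring "hecke r" by (rule hecke_ring)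

lemma T_normal_word_closed: "w \<in> token_states r \<Longrightarrow> T_word r (normal_word r (Suc 0) w) \<in> carrier (hecke r)"
  by (rule T_word_closed[OF normal_word_lists]) (auto simp: token_states_def)

lemma of_coords_term_closed:
  "w \<in> token_states r \<Longrightarrow> c \<in> laurentA \<Longrightarrow> c \<odot>\<^bsub>hecke r\<^esub> T_word r (normal_word r (Suc 0) w) \<in> carrier (hecke r)"
  by (rule hecke_smult_closed[OF T_normal_word_closed])

lemma of_coords_closed: "(\<And>w. v w \<in> laurentA) \<Longrightarrow> of_coords r v \<in> carrier (hecke r)"
  unfolding of_coords_def by (rule H.finsum_closed) (auto simp: of_coords_term_closed)

lemma of_coords_add:
  assumes "\<And>w. v w \<in> laurentA" "\<And>w. v' w \<in> laurentA"
  shows "of_coords r (\<lambda>w. v w + v' w) = of_coords r v \<oplus>\<^bsub>hecke r\<^esub> of_coords r v'"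
proof -
  have "of_coords r (\<lambda>w. v w + v' w) = (\<Oplus>\<^bsub>hecke r\<^esub>w \<in> token_states r.
      v w \<odot>\<^bsub>hecke r\<^esub> T_word r (normal_word r (Suc 0) w) \<oplus>\<^bsub>hecke r\<^esub> v' w \<odot>\<^bsub>hecke r\<^esub> T_word r (normal_word r (Suc 0) w))"
    unfolding of_coords_def
    by (rule H.finsum_cong')
      (auto simp: assms of_coords_term_closed hecke_smult_laws(2)[OF T_normal_word_closed T_normal_word_closed])
  also have "\<dots> = of_coords r v \<oplus>\<^bsub>hecke r\<^esub> of_coords r v'"
    unfolding of_coords_def by (rule H.finsum_addf) (auto simp: assms of_coords_term_closed)
  finally show ?thesis .
qed

lemma of_coords_scale:
  assumes v: "\<And>w. v w \<in> laurentA" and c: "c \<in> laurentA"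
  shows "of_coords r (\<lambda>w. c * v w) = c \<odot>\<^bsub>hecke r\<^esub> of_coords r v"
proof -
  have c1: "c \<odot>\<^bsub>hecke r\<^esub> \<one>\<^bsub>hecke r\<^esub> \<in> carrier (hecke r)" by (simp add: hecke_smult_closed c)
  have sm: "c \<odot>\<^bsub>hecke r\<^esub> X = (c \<odot>\<^bsub>hecke r\<^esub> \<one>\<^bsub>hecke r\<^esub>) \<otimes>\<^bsub>hecke r\<^esub> X" if "X \<in> carrier (hecke r)" for X
    using hecke_smult_laws(4)[OF H.one_closed that c c] that by simp
  have "of_coords r (\<lambda>w. c * v w) = (\<Oplus>\<^bsub>hecke r\<^esub>w \<in> token_states r.
      (c \<odot>\<^bsub>hecke r\<^esub> \<one>\<^bsub>hecke r\<^esub>) \<otimes>\<^bsub>hecke r\<^esub> (v w \<odot>\<^bsub>hecke r\<^esub> T_word r (normal_word r (Suc 0) w)))"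
    unfolding of_coords_def
    by (rule H.finsum_cong')
      (auto simp: assms c1 of_coords_term_closed sm[symmetric] hecke_smult_laws(3)[OF T_normal_word_closed T_normal_word_closed])
  also have "\<dots> = c \<odot>\<^bsub>hecke r\<^esub> of_coords r v"
    unfolding sm[OF of_coords_closed[OF v]] unfolding of_coords_def
    by (rule H.finsum_rdistr[symmetric]) (auto simp: assms c1 of_coords_term_closed finite_token_states)
  finally show ?thesis .
qed

text \<open>
This compares the rule \<open>T_normal_word_mult\<close> with the definition of \<open>hecke_op\<close>. The latter is the
transpose, so the sum has to be reindexed by the involution \<open>w \<mapsto> w s\<^sub>j\<close>.
\<close>

lemma of_coords_hecke_op:
  assumes v: "\<And>w. v w \<in> laurentA" and j: "1 \<le> j" "j \<le> r"
  shows "of_coords r (hecke_op qK r j v) = of_coords r v \<otimes>\<^bsub>hecke r\<^esub> T_word r [j]"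
proof -
  let ?b = "\<lambda>w. T_word r (normal_word r (Suc 0) w)"
  define \<alpha> where "\<alpha> w = (if token_up j w then 1 else qK)" for w
  define \<gamma> where "\<gamma> w = (if token_up j w then 0 else qK - 1)" for w
  have ag: "\<alpha> w \<in> laurentA" "\<gamma> w \<in> laurentA" for w by (auto simp: \<alpha>_def \<gamma>_def laurentA_closed qK_laurentA)
  have Tj: "T_word r [j] \<in> carrier (hecke r)" using j by (intro T_word_closed) auto
  have aW: "token_act r j w \<in> token_states r" "token_act r j (token_act r j w) = w" "token_up j (token_act r j w) = (\<not> token_up j w)" if "w \<in> token_states r" for w
    using that token_act_valid token_act_involution token_up_act j by (auto simp: token_states_def)
  have img: "token_act r j ` token_states r = token_states r" and inj: "inj_on (token_act r j) (token_states r)"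
    using token_act_bij[OF j] by (auto simp: bij_betw_def)
  have "of_coords r v \<otimes>\<^bsub>hecke r\<^esub> T_word r [j] = (\<Oplus>\<^bsub>hecke r\<^esub>w \<in> token_states r. (v w \<odot>\<^bsub>hecke r\<^esub> ?b w) \<otimes>\<^bsub>hecke r\<^esub> T_word r [j])"
    unfolding of_coords_def by (rule H.finsum_ldistr) (auto simp: v of_coords_term_closed Tj finite_token_states)
  also have "\<dots> = (\<Oplus>\<^bsub>hecke r\<^esub>w \<in> token_states r. (v w * \<alpha> w) \<odot>\<^bsub>hecke r\<^esub> ?b (token_act r j w) \<oplus>\<^bsub>hecke r\<^esub> (v w * \<gamma> w) \<odot>\<^bsub>hecke r\<^esub> ?b w)"
  proof (rule H.finsum_cong')
    fix w assume w: "w \<in> token_states r"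
    note c = T_normal_word_closed[OF w] T_normal_word_closed[OF aW(1)[OF w]]
    have "(v w \<odot>\<^bsub>hecke r\<^esub> ?b w) \<otimes>\<^bsub>hecke r\<^esub> T_word r [j] = v w \<odot>\<^bsub>hecke r\<^esub> (?b w \<otimes>\<^bsub>hecke r\<^esub> T_word r [j])"
      by (rule hecke_smult_laws(4)[OF c(1) Tj v v])
    also have "?b w \<otimes>\<^bsub>hecke r\<^esub> T_word r [j] = \<alpha> w \<odot>\<^bsub>hecke r\<^esub> ?b (token_act r j w) \<oplus>\<^bsub>hecke r\<^esub> \<gamma> w \<odot>\<^bsub>hecke r\<^esub> ?b w"
      unfolding \<alpha>_def \<gamma>_def by (rule T_normal_word_mult) (use w j in \<open>auto simp: token_states_def\<close>)
    also have "v w \<odot>\<^bsub>hecke r\<^esub> \<dots> = (v w * \<alpha> w) \<odot>\<^bsub>hecke r\<^esub> ?b (token_act r j w) \<oplus>\<^bsub>hecke r\<^esub> (v w * \<gamma> w) \<odot>\<^bsub>hecke r\<^esub> ?b w"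
      by (simp only: hecke_smult_laws(1)[OF hecke_smult_closed[OF c(2) ag(1)] hecke_smult_closed[OF c(1) ag(2)] v v]
          hecke_smult_laws(3)[OF c(2) c(2) v ag(1)] hecke_smult_laws(3)[OF c(1) c(1) v ag(2)])
    finally show "(v w \<odot>\<^bsub>hecke r\<^esub> ?b w) \<otimes>\<^bsub>hecke r\<^esub> T_word r [j] =
      (v w * \<alpha> w) \<odot>\<^bsub>hecke r\<^esub> ?b (token_act r j w) \<oplus>\<^bsub>hecke r\<^esub> (v w * \<gamma> w) \<odot>\<^bsub>hecke r\<^esub> ?b w" .
  qed (auto simp: v ag laurentA_closed of_coords_term_closed aW)
  also have "\<dots> = (\<Oplus>\<^bsub>hecke r\<^esub>w \<in> token_states r. (v w * \<alpha> w) \<odot>\<^bsub>hecke r\<^esub> ?b (token_act r j w)) \<oplus>\<^bsub>hecke r\<^esub> (\<Oplus>\<^bsub>hecke r\<^esub>w \<in> token_states r. (v w * \<gamma> w) \<odot>\<^bsub>hecke r\<^esub> ?b w)"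
    by (rule H.finsum_addf) (auto simp: v ag laurentA_closed of_coords_term_closed aW)
  also have "(\<Oplus>\<^bsub>hecke r\<^esub>w \<in> token_states r. (v w * \<alpha> w) \<odot>\<^bsub>hecke r\<^esub> ?b (token_act r j w)) =
      (\<Oplus>\<^bsub>hecke r\<^esub>w \<in> token_states r. (v (token_act r j (token_act r j w)) * \<alpha> (token_act r j (token_act r j w))) \<odot>\<^bsub>hecke r\<^esub> ?b (token_act r j w))"
    by (rule H.finsum_cong') (auto simp: v ag laurentA_closed of_coords_term_closed aW)
  also have "\<dots> = (\<Oplus>\<^bsub>hecke r\<^esub>w \<in> token_act r j ` token_states r. (v (token_act r j w) * \<alpha> (token_act r j w)) \<odot>\<^bsub>hecke r\<^esub> ?b w)"
    by (rule H.finsum_reindex[OF _ inj, symmetric]) (auto simp: v ag laurentA_closed of_coords_term_closed aW)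
  also have "token_act r j ` token_states r = token_states r" by (rule img)
  also have "(\<Oplus>\<^bsub>hecke r\<^esub>w \<in> token_states r. (v (token_act r j w) * \<alpha> (token_act r j w)) \<odot>\<^bsub>hecke r\<^esub> ?b w) \<oplus>\<^bsub>hecke r\<^esub> (\<Oplus>\<^bsub>hecke r\<^esub>w \<in> token_states r. (v w * \<gamma> w) \<odot>\<^bsub>hecke r\<^esub> ?b w)
     = of_coords r (\<lambda>w. v (token_act r j w) * \<alpha> (token_act r j w) + v w * \<gamma> w)"
    by (subst of_coords_add) (simp_all add: v ag laurentA_closed of_coords_def)
  also have "\<dots> = of_coords r (hecke_op qK r j v)"
    unfolding of_coords_def
    by (rule H.finsum_cong')
      (auto simp: v laurentA_closed hecke_op_laurentA of_coords_term_closed hecke_op_def \<alpha>_def \<gamma>_def aW qK_laurentA mult.commute)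
  finally show ?thesis by simp
qed

lemma of_coords_word:
  assumes "u \<in> lists {1..r}"
  shows "of_coords r (fold (hecke_op qK r) u (e_base r)) = T_word r u"
  using assms
proof (induction u rule: rev_induct)
  case Nil
  have "of_coords r (e_base r) = (\<Oplus>\<^bsub>hecke r\<^esub>w \<in> token_states r. if base_state r = w then T_word r [] else \<zero>\<^bsub>hecke r\<^esub>)"
    unfolding of_coords_def
    by (rule H.finsum_cong')
      (auto simp: e_base_def base_state_props hecke_one_smult hecke_zero_smult T_word_closed T_normal_word_closed
        base_state_props(2)[simplified])
  also have "\<dots> = T_word r []"
    by (rule H.finsum_singleton[OF base_state_props(1) finite_token_states]) (auto simp: T_word_closed)
  finally show ?case by simp
next
  case (snoc j u)
  then show ?case
    by (simp add: of_coords_hecke_op fold_hecke_op_laurentA e_base_laurentA T_word_append)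
qed

text \<open>
Both maps are compatible with right multiplication by the generators, and their composition fixes the
identity, which generates the right module \<open>H\<close>.
\<close>

lemma of_coords_coords:
  assumes "X \<in> carrier (hecke r)"
  shows "of_coords r (coords r X) = X" "coords r X w \<in> laurentA"
proof -
  obtain f where f: "f \<in> carrier (free_algebra r)" "X = hecke_class r f" using assms by (auto simp: hecke_carrier)
  have "(\<forall>w. right_act r f (e_base r) w \<in> laurentA) \<and> of_coords r (right_act r f (e_base r)) = hecke_class r f"
    using f(1)[unfolded free_algebra_eq] coeff_ring_laurentA
  proof (induction f rule: ma_induct)
    case zero
    have "of_coords r (\<lambda>w. 0) = (\<Oplus>\<^bsub>hecke r\<^esub>w \<in> token_states r. \<zero>\<^bsub>hecke r\<^esub>)"
      unfolding of_coords_def by (rule H.finsum_cong') (auto simp: hecke_zero_smult T_normal_word_closed)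
    then show ?case using hecke_class_hom(4)[OF f(1) f(1)] by (simp add: right_act_zero laurentA_closed)
  next
    case (scaled_basis a x)
    then have x: "x \<in> lists {1..r}" by simp
    note b = fa_basis_closed[OF x]
    note A = fold_hecke_op_laurentA[OF e_base_laurentA]
    show ?case
      by (simp add: right_act_scale[OF fa_finite[OF b]] right_act_basis A laurentA_closed scaled_basis of_coords_scale
          of_coords_word[OF x] T_word_def hecke_class_smult[OF b])
  next
    case (add f g)
    then show ?case
      by (simp add: right_act_add ma_finite laurentA_closed of_coords_add hecke_class_hom(2) free_algebra_eq)
  qed
  then show "of_coords r (coords r X) = X" "coords r X w \<in> laurentA" by (simp_all add: f coords_hecke_class)
qed

lemma coords_inj: "inj_on (coords r) (carrier (hecke r))"
  by (rule inj_on_inverseI[of _ "of_coords r"]) (rule of_coords_coords)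

text \<open>
The right module \<open>H\<close> is generated by the identity.
\<close>

lemma hecke_induct [consumes 1, case_names one mult_T add smult]:
  assumes "X \<in> carrier (hecke r)"
    and one: "P \<one>\<^bsub>hecke r\<^esub>"
    and mult_T: "\<And>X j. X \<in> carrier (hecke r) \<Longrightarrow> j \<in> {1..r} \<Longrightarrow> P X \<Longrightarrow> P (X \<otimes>\<^bsub>hecke r\<^esub> T_word r [j])"
    and add: "\<And>X Y. X \<in> carrier (hecke r) \<Longrightarrow> Y \<in> carrier (hecke r) \<Longrightarrow> P X \<Longrightarrow> P Y \<Longrightarrow> P (X \<oplus>\<^bsub>hecke r\<^esub> Y)"
    and smult: "\<And>a X. a \<in> laurentA \<Longrightarrow> X \<in> carrier (hecke r) \<Longrightarrow> P X \<Longrightarrow> P (a \<odot>\<^bsub>hecke r\<^esub> X)"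
  shows "P X"
proof -
  obtain f where f: "f \<in> carrier (free_algebra r)" "X = hecke_class r f" using assms by (auto simp: hecke_carrier)
  have T: "P (T_word r u)" if "u \<in> lists {1..r}" for u
    using that
  proof (induction u rule: rev_induct)
    case Nil
    then show ?case using one by (simp add: T_word_Nil)
  next
    case (snoc j u)
    then show ?case using mult_T[OF T_word_closed[of u r], of j] by (simp add: T_word_append)
  qed
  have "P (hecke_class r f)"
    using f(1)[unfolded free_algebra_eq] coeff_ring_laurentA
  proof (induction f rule: ma_induct)
    case zero
    have "P (0 \<odot>\<^bsub>hecke r\<^esub> \<one>\<^bsub>hecke r\<^esub>)" by (rule smult[OF laurentA_closed(1) H.one_closed one])
    then show ?case using hecke_class_hom(4)[OF f(1) f(1)] by (simp add: hecke_zero_smult)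
  next
    case (scaled_basis a x)
    then show ?case
      using smult[OF _ T_word_closed T, of a x] hecke_class_smult[OF fa_basis_closed, of x r a] by (simp add: T_word_def)
  next
    case (add f g)
    then show ?case
      using assms(4)[of "hecke_class r f" "hecke_class r g"] by (simp add: hecke_class_hom(2) free_algebra_eq hecke_carrier)
  qed
  then show ?thesis by (simp add: f)
qed

end

section \<open>The generators of the permutation modules\<close>

lemma coxeter_cong_lists: "coxeter_cong r u w \<Longrightarrow> u \<in> lists {1..r} \<and> w \<in> lists {1..r}"
  by (induction rule: coxeter_cong.induct) (auto simp: coxeter_mat_B_def)

lemma weyl_class_eq_iff:
  assumes "u \<in> lists {1..r}"
  shows "weyl_class r u = weyl_class r w \<longleftrightarrow> coxeter_cong r w u"
proof
  assume "weyl_class r u = weyl_class r w"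
  moreover have "u \<in> weyl_class r u" using cc_refl[OF assms] by (simp add: weyl_class_def)
  ultimately show "coxeter_cong r w u" by (simp add: weyl_class_def)
next
  assume "coxeter_cong r w u"
  then show "weyl_class r u = weyl_class r w"
    unfolding weyl_class_def by (blast intro: cc_sym cc_trans)
qed

lemma weyl_mult_class:
  assumes u: "u \<in> lists {1..r}" and v: "v \<in> lists {1..r}"
  shows "weyl_class r u \<otimes>\<^bsub>weyl_B r\<^esub> weyl_class r v = weyl_class r (u @ v)"
proof -
  have *: "weyl_class r (x @ y) = weyl_class r (u @ v)" if "x \<in> weyl_class r u" "y \<in> weyl_class r v" for x y
    using that cc_append[of r u x v y] coxeter_cong_lists[of r u x] coxeter_cong_lists[of r v y]
    by (subst weyl_class_eq_iff) (auto simp: weyl_class_def)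
  have "u \<in> weyl_class r u" "v \<in> weyl_class r v" using u v by (auto simp: weyl_class_def intro: cc_refl)
  then have ne: "weyl_class r u \<noteq> {}" "weyl_class r v \<noteq> {}" by blast+
  have "(\<Union>x \<in> weyl_class r u. \<Union>y \<in> weyl_class r v. weyl_class r (x @ y)) =
      (\<Union>x \<in> weyl_class r u. \<Union>y \<in> weyl_class r v. weyl_class r (u @ v))"
    by (intro SUP_cong refl *)
  also have "\<dots> = weyl_class r (u @ v)" using ne by simp
  finally show ?thesis by (simp add: weyl_B_def)
qed

lemma weyl_monoid: "monoid (weyl_B r)"
proof (rule monoidI)
  have one: "\<one>\<^bsub>weyl_B r\<^esub> = weyl_class r []" and c: "carrier (weyl_B r) = weyl_class r ` lists {1..r}"
    by (simp_all add: weyl_B_def)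
  show "\<one>\<^bsub>weyl_B r\<^esub> \<in> carrier (weyl_B r)" by (auto simp: one c)
  fix x y z
  assume "x \<in> carrier (weyl_B r)"
  then obtain u where u: "u \<in> lists {1..r}" "x = weyl_class r u" by (auto simp: c)
  show "\<one>\<^bsub>weyl_B r\<^esub> \<otimes>\<^bsub>weyl_B r\<^esub> x = x" "x \<otimes>\<^bsub>weyl_B r\<^esub> \<one>\<^bsub>weyl_B r\<^esub> = x"
    using weyl_mult_class[of "[]" r u] weyl_mult_class[of u r "[]"] u by (simp_all add: one)
  assume "y \<in> carrier (weyl_B r)"
  then obtain v where v: "v \<in> lists {1..r}" "y = weyl_class r v" by (auto simp: c)
  show "x \<otimes>\<^bsub>weyl_B r\<^esub> y \<in> carrier (weyl_B r)"
    unfolding c u(2) v(2) weyl_mult_class[OF u(1) v(1)] by (rule imageI) (use u v in simp)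
  assume "z \<in> carrier (weyl_B r)"
  then obtain w where w: "w \<in> lists {1..r}" "z = weyl_class r w" by (auto simp: c)
  show "x \<otimes>\<^bsub>weyl_B r\<^esub> y \<otimes>\<^bsub>weyl_B r\<^esub> z = x \<otimes>\<^bsub>weyl_B r\<^esub> (y \<otimes>\<^bsub>weyl_B r\<^esub> z)"
    unfolding u(2) v(2) w(2) weyl_mult_class[OF u(1) v(1)] weyl_mult_class[OF v(1) w(1)]
    by (subst (1 2) weyl_mult_class) (use u(1) v(1) w(1) in simp_all)
qed

text \<open>
The generated subgroup uses inverses, and these are under control only because the generators are
involutions, hence units of the monoid.
\<close>

lemma parabolic_carrier: "parabolic n r l \<subseteq> carrier (weyl_B r)"
proof
  interpret W: monoid "weyl_B r" by (rule weyl_monoid)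
  have gen: "weyl_class r [i] \<in> Units (weyl_B r)" if "i \<in> {1..r}" for i
  proof -
    have "coxeter_cong r [i, i] []" using cc_rel[OF that that] by (simp add: coxeter_mat_B_def)
    then have "weyl_class r [] = weyl_class r [i, i]" by (simp add: weyl_class_eq_iff)
    then have "weyl_class r [i] \<otimes>\<^bsub>weyl_B r\<^esub> weyl_class r [i] = \<one>\<^bsub>weyl_B r\<^esub>"
      using that by (simp add: weyl_mult_class) (simp add: weyl_B_def)
    moreover have "weyl_class r [i] \<in> carrier (weyl_B r)" using that by (auto simp: weyl_B_def)
    ultimately show ?thesis by (auto simp: Units_def)
  qed
  fix w assume "w \<in> parabolic n r l"
  then show "w \<in> carrier (weyl_B r)"
    unfolding parabolic_def
  proof (induction rule: generate.induct)
    case one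
    show ?case by simp
  next
    case (incl h)
    then obtain i where i: "i \<in> {1..r}" "h = weyl_class r [i]"
      by (metis (no_types, lifting) DiffD1 imageE)
    show ?case unfolding i(2) by (rule W.Units_closed[OF gen[OF i(1)]])
  next
    case (inv h)
    then obtain i where i: "i \<in> {1..r}" "h = weyl_class r [i]"
      by (metis (no_types, lifting) DiffD1 imageE)
    show ?case unfolding i(2) by (rule W.Units_inv_closed[OF gen[OF i(1)]])
  next
    case (eng h1 h2)
    then show ?case by simp
  qed
qed

lemma foldr_gen_closed:
  "u \<in> lists {1..r} \<Longrightarrow> foldr (\<lambda>i h. hecke_gen r i \<otimes>\<^bsub>hecke r\<^esub> h) u \<one>\<^bsub>hecke r\<^esub> \<in> carrier (hecke r)"
proof (induction u)
  case Nil
  show ?case using ring.ring_simprules(6)[OF hecke_ring] by simp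
next
  case (Cons i u)
  have "hecke_gen r i = T_word r [i]" by (simp add: hecke_gen_def T_word_def hecke_class_def)
  then show ?case using Cons T_word_closed[of "[i]" r] ring.ring_simprules(5)[OF hecke_ring] by simp
qed

lemma hecke_T_closed:
  assumes "w \<in> carrier (weyl_B r)"
  shows "hecke_T r w \<in> carrier (hecke r)"
proof -
  obtain u where u: "u \<in> lists {1..r}" "w = weyl_class r u" using assms by (auto simp: weyl_B_def)
  then have "u \<in> w" by (auto simp: weyl_class_def intro: cc_refl)
  then have "(ARG_MIN length u. u \<in> w) \<in> w" by (rule arg_min_natI)
  then have "(ARG_MIN length u. u \<in> w) \<in> lists {1..r}"
    using u(2) coxeter_cong_lists by (auto simp: weyl_class_def)
  then show ?thesis
    unfolding hecke_T_def by (rule foldr_gen_closed)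
qed

lemma x_elt_closed: "x_elt n r l \<in> carrier (hecke r)"
proof -
  interpret H: ring "hecke r" by (rule hecke_ring)
  show ?thesis
    unfolding x_elt_def using hecke_T_closed parabolic_carrier by (intro H.finsum_closed) blast
qed

section \<open>Extension of scalars\<close>

text \<open>
An algebra \<open>E\<close> over the subring \<open>A\<close> of a field \<open>k = Frac A\<close>, embedded by \<open>\<Psi>\<close> into a \<open>k\<close>-algebra \<open>R\<close> of
operators which is spanned by the image. The conclusion \<open>realize_iso\<close> is \<open>k \<otimes>\<^sub>A E \<cong> R\<close>. The ring laws of
\<open>E\<close> follow from those of \<open>R\<close>.
\<close>

locale scalar_extension =
  fixes A :: "'k::field set" and E :: "('k, 'e) module"
    and R :: "('k, ('x \<Rightarrow> 'k) \<Rightarrow> ('x \<Rightarrow> 'k)) module"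
    and \<Psi> :: "'e \<Rightarrow> ('x \<Rightarrow> 'k) \<Rightarrow> ('x \<Rightarrow> 'k)"
  assumes A: "coeff_ring A"
    and fractions: "\<exists>a\<in>A. \<exists>d\<in>A. d \<noteq> 0 \<and> c = a / d"
    and R_ring: "ring R"
    and R_ops: "mult R = (\<lambda>B C v. B (C v))" "add R = (\<lambda>B C v x. B v x + C v x)"
      "zero R = (\<lambda>v x. 0)" "module.smult R = (\<lambda>c B v x. c * B v x)"
    and R_smult: "B \<in> carrier R \<Longrightarrow> (\<lambda>v x. c * B v x) \<in> carrier R"
    and R_lin: "B \<in> carrier R \<Longrightarrow> lin_op B"
    and E_closed: "x \<in> carrier E \<Longrightarrow> y \<in> carrier E \<Longrightarrow> x \<otimes>\<^bsub>E\<^esub> y \<in> carrier E"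
      "x \<in> carrier E \<Longrightarrow> y \<in> carrier E \<Longrightarrow> x \<oplus>\<^bsub>E\<^esub> y \<in> carrier E"
      "\<one>\<^bsub>E\<^esub> \<in> carrier E" "\<zero>\<^bsub>E\<^esub> \<in> carrier E"
      "a \<in> A \<Longrightarrow> x \<in> carrier E \<Longrightarrow> a \<odot>\<^bsub>E\<^esub> x \<in> carrier E"
    and \<Psi>_closed: "x \<in> carrier E \<Longrightarrow> \<Psi> x \<in> carrier R"
    and \<Psi>_hom: "x \<in> carrier E \<Longrightarrow> y \<in> carrier E \<Longrightarrow> \<Psi> (x \<otimes>\<^bsub>E\<^esub> y) = \<Psi> x \<otimes>\<^bsub>R\<^esub> \<Psi> y"
      "x \<in> carrier E \<Longrightarrow> y \<in> carrier E \<Longrightarrow> \<Psi> (x \<oplus>\<^bsub>E\<^esub> y) = \<Psi> x \<oplus>\<^bsub>R\<^esub> \<Psi> y"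
      "\<Psi> \<one>\<^bsub>E\<^esub> = \<one>\<^bsub>R\<^esub>" "\<Psi> \<zero>\<^bsub>E\<^esub> = \<zero>\<^bsub>R\<^esub>"
      "a \<in> A \<Longrightarrow> x \<in> carrier E \<Longrightarrow> \<Psi> (a \<odot>\<^bsub>E\<^esub> x) = a \<odot>\<^bsub>R\<^esub> \<Psi> x"
    and \<Psi>_inj: "inj_on \<Psi> (carrier E)"
    and \<Psi>_span: "B \<in> carrier R \<Longrightarrow> \<exists>d\<in>A. \<exists>x\<in>carrier E. d \<noteq> 0 \<and> d \<odot>\<^bsub>R\<^esub> B = \<Psi> x"
begin

abbreviation "G \<equiv> \<lparr>carrier = (UNIV :: 'k set), mult = (*), one = 1\<rparr> \<times>\<times> E"
abbreviation "Sy \<equiv> symbol_algebra E"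
abbreviation "J \<equiv> Idl\<^bsub>Sy\<^esub> (tensor_relations A E)"
abbreviation "pt \<equiv> pure_tensor A E"

sublocale R: ring R by (rule R_ring)

lemma Sy_eq: "Sy = monoid_algebra UNIV G" by (simp add: symbol_algebra_def)

lemma \<Psi>_injD: "x \<in> carrier E \<Longrightarrow> y \<in> carrier E \<Longrightarrow> \<Psi> x = \<Psi> y \<Longrightarrow> x = y"
  using \<Psi>_inj by (auto dest: inj_onD)

lemma E_monoid: "monoid E"
  by (rule monoidI; (rule \<Psi>_injD)?) (auto simp: E_closed \<Psi>_hom R.m_assoc \<Psi>_closed)

lemma G_monoid: "monoid G"
  by (rule DirProd_monoid[OF _ E_monoid]) (rule monoidI; simp)

lemma coeff_UNIV: "coeff_ring (UNIV :: int set)" by (simp add: coeff_ring_def)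

sublocale Sy: ring "symbol_algebra E"
  unfolding Sy_eq by (rule ma_ring[OF coeff_UNIV G_monoid])

lemma G_carrier: "(c, x) \<in> carrier G \<longleftrightarrow> x \<in> carrier E"
  by (simp add: DirProd_def)

lemma symbol_closed: "x \<in> carrier E \<Longrightarrow> basis_elt (c, x) \<in> carrier Sy"
  unfolding Sy_eq by (rule basis_elt_carrier[OF coeff_UNIV]) (simp add: G_carrier)

lemma Sy_finite: "f \<in> carrier Sy \<Longrightarrow> finite {m. f m \<noteq> 0}"
  unfolding Sy_eq by (rule ma_finite)

definition ev :: "('k \<times> 'e \<Rightarrow> int) \<Rightarrow> ('x \<Rightarrow> 'k) \<Rightarrow> ('x \<Rightarrow> 'k)" where
  "ev f v y = ma_eval of_int (\<lambda>(c, x). c * \<Psi> x v y) f"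

lemma ev_basis: "ev (basis_elt (c, x)) = (\<lambda>v y. c * \<Psi> x v y)"
  by (simp add: ev_def fun_eq_iff ma_eval_basis[OF coeff_hom_of_int])

lemma ev_add: "f \<in> carrier Sy \<Longrightarrow> g \<in> carrier Sy \<Longrightarrow> ev (\<lambda>m. f m + g m) = (\<lambda>v y. ev f v y + ev g v y)"
  by (simp add: ev_def fun_eq_iff ma_eval_add[OF coeff_hom_of_int] Sy_finite)

lemma ev_closed:
  assumes "f \<in> carrier Sy"
  shows "ev f \<in> carrier R"
  using assms[unfolded Sy_eq] coeff_UNIV
proof (induction f rule: ma_induct)
  case zero
  have "ev (\<lambda>m. 0) = \<zero>\<^bsub>R\<^esub>" by (simp add: ev_def fun_eq_iff ma_eval_zero R_ops)
  then show ?case by simp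
next
  case (scaled_basis a p)
  obtain c x where p: "p = (c, x)" by (cases p)
  have x: "x \<in> carrier E" using scaled_basis by (simp add: p DirProd_def)
  have "ev (\<lambda>m. a * basis_elt p m) = (\<lambda>v y. of_int a * ev (basis_elt p) v y)"
    using Sy_finite[OF symbol_closed[OF x]]
    by (simp add: ev_def fun_eq_iff ma_eval_scale[OF coeff_hom_of_int] p)
  then have "ev (\<lambda>m. a * basis_elt p m) = (\<lambda>v y. (of_int a * c) * \<Psi> x v y)"
    by (simp add: p ev_basis mult.assoc)
  then show ?case using R_smult[OF \<Psi>_closed[OF x]] by simp
next
  case (add f g)
  then have "ev (\<lambda>m. f m + g m) = ev f \<oplus>\<^bsub>R\<^esub> ev g" by (simp add: ev_add Sy_eq R_ops)
  then show ?case using add by simp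
qed

lemma ev_mult:
  assumes f: "f \<in> carrier Sy" and g: "g \<in> carrier Sy"
  shows "ev (f \<otimes>\<^bsub>Sy\<^esub> g) = ev f \<otimes>\<^bsub>R\<^esub> ev g"
proof (intro ext)
  fix v y
  have supp: "snd p \<in> carrier E" if "f p \<noteq> 0 \<or> g p \<noteq> 0" for p
    using that f g by (auto simp: Sy_eq ma_carrier_iff DirProd_def)
  have ev_g: "ev g v = (\<lambda>y. \<Sum>p | g p \<noteq> 0. (of_int (g p) * fst p) * \<Psi> (snd p) v y)"
    by (simp add: ev_def fun_eq_iff ma_eval_def case_prod_beta mult.assoc)
  have "ev (f \<otimes>\<^bsub>Sy\<^esub> g) v y = (\<Sum>p | f p \<noteq> 0. \<Sum>p' | g p' \<noteq> 0. of_int (f p) * of_int (g p') *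
      (case p \<otimes>\<^bsub>G\<^esub> p' of (c, x) \<Rightarrow> c * \<Psi> x v y))"
    unfolding ev_def Sy_eq by (rule ma_eval_mult[OF coeff_hom_of_int Sy_finite[OF f] Sy_finite[OF g]])
  also have "\<dots> = (\<Sum>p | f p \<noteq> 0. \<Sum>p' | g p' \<noteq> 0. of_int (f p) * fst p * ((of_int (g p') * fst p') *
      \<Psi> (snd p) (\<Psi> (snd p') v) y))"
    by (intro sum.cong refl) (auto simp: DirProd_def case_prod_beta \<Psi>_hom(1) supp R_ops)
  also have "\<dots> = (\<Sum>p | f p \<noteq> 0. of_int (f p) * fst p * \<Psi> (snd p) (ev g v) y)"
    by (intro sum.cong refl) (auto simp: ev_g lin_op_sum[OF R_lin[OF \<Psi>_closed]] supp sum_distrib_left)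
  also have "\<dots> = ev f (ev g v) y"
    by (simp add: ev_def[of f] ma_eval_def case_prod_beta mult.assoc)
  finally show "ev (f \<otimes>\<^bsub>Sy\<^esub> g) v y = (ev f \<otimes>\<^bsub>R\<^esub> ev g) v y" by (simp add: R_ops)
qed

sublocale ev: ring_hom_ring "symbol_algebra E" R ev
proof (rule ring_hom_ringI[OF Sy.ring_axioms R_ring])
  show "ev \<one>\<^bsub>Sy\<^esub> = \<one>\<^bsub>R\<^esub>"
    by (simp add: Sy_eq ma_one DirProd_def ev_basis \<Psi>_hom(3))
qed (auto simp: ev_closed ev_mult ev_add R_ops, simp add: Sy_eq ma_add ev_add[unfolded Sy_eq])

lemma relations_closed: "tensor_relations A E \<subseteq> carrier Sy"
  unfolding tensor_relations_def
  by (auto intro!: Sy.minus_closed Sy.a_closed symbol_closed E_closed)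

lemma J_ideal: "ideal J Sy"
  by (rule Sy.genideal_ideal[OF relations_closed])

lemma ev_minus_zero:
  assumes "f \<in> carrier Sy" "g \<in> carrier Sy" "ev f = ev g"
  shows "ev (f \<ominus>\<^bsub>Sy\<^esub> g) = \<zero>\<^bsub>R\<^esub>"
  using assms by (simp add: a_minus_def R.r_neg)

lemma kernel_iff: "f \<in> a_kernel Sy R ev \<longleftrightarrow> f \<in> carrier Sy \<and> ev f = \<zero>\<^bsub>R\<^esub>"
  unfolding a_kernel_def' by blast

lemma relations_members:
  "x \<in> carrier E \<Longrightarrow> basis_elt (c + d, x) \<ominus>\<^bsub>Sy\<^esub> (basis_elt (c, x) \<oplus>\<^bsub>Sy\<^esub> basis_elt (d, x)) \<in> tensor_relations A E"
  "x \<in> carrier E \<Longrightarrow> y \<in> carrier E \<Longrightarrow>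
    basis_elt (c, x \<oplus>\<^bsub>E\<^esub> y) \<ominus>\<^bsub>Sy\<^esub> (basis_elt (c, x) \<oplus>\<^bsub>Sy\<^esub> basis_elt (c, y)) \<in> tensor_relations A E"
  "a \<in> A \<Longrightarrow> x \<in> carrier E \<Longrightarrow>
    basis_elt (c * a, x) \<ominus>\<^bsub>Sy\<^esub> basis_elt (c, a \<odot>\<^bsub>E\<^esub> x) \<in> tensor_relations A E"
  unfolding tensor_relations_def by blast+

lemma relations_kernel: "tensor_relations A E \<subseteq> a_kernel Sy R ev"
proof
  fix t assume t: "t \<in> tensor_relations A E"
  then have c: "t \<in> carrier Sy" using relations_closed by auto
  have sum: "ev (basis_elt p \<oplus>\<^bsub>Sy\<^esub> basis_elt p') = (\<lambda>v y. ev (basis_elt p) v y + ev (basis_elt p') v y)"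
    if "snd p \<in> carrier E" "snd p' \<in> carrier E" for p p'
    using that symbol_closed[of "snd p" "fst p"] symbol_closed[of "snd p'" "fst p'"]
    by (simp add: R_ops)
  from t consider
      c d x where "x \<in> carrier E" "t = basis_elt (c + d, x) \<ominus>\<^bsub>Sy\<^esub> (basis_elt (c, x) \<oplus>\<^bsub>Sy\<^esub> basis_elt (d, x))"
    | c x y where "x \<in> carrier E" "y \<in> carrier E"
        "t = basis_elt (c, x \<oplus>\<^bsub>E\<^esub> y) \<ominus>\<^bsub>Sy\<^esub> (basis_elt (c, x) \<oplus>\<^bsub>Sy\<^esub> basis_elt (c, y))"
    | c a x where "a \<in> A" "x \<in> carrier E" "t = basis_elt (c * a, x) \<ominus>\<^bsub>Sy\<^esub> basis_elt (c, a \<odot>\<^bsub>E\<^esub> x)"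
    unfolding tensor_relations_def by blast
  then have "ev t = \<zero>\<^bsub>R\<^esub>"
  proof cases
    case 1
    show ?thesis unfolding 1(2)
      by (rule ev_minus_zero) (use 1 in \<open>auto simp: symbol_closed sum ev_basis R_ops distrib_right\<close>)
  next
    case 2
    show ?thesis unfolding 2(3)
      by (rule ev_minus_zero)
        (use 2 in \<open>auto simp: symbol_closed E_closed sum ev_basis \<Psi>_hom(2) R_ops distrib_left\<close>)
  next
    case 3
    show ?thesis unfolding 3(3)
      by (rule ev_minus_zero)
        (use 3 in \<open>auto simp: symbol_closed E_closed ev_basis \<Psi>_hom(5) R_ops mult.assoc\<close>)
  qed
  with c show "t \<in> a_kernel Sy R ev" by (simp only: kernel_iff)
qed

lemma J_kernel: "J \<subseteq> a_kernel Sy R ev"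
  by (rule Sy.genideal_minimal[OF ev.kernel_is_ideal relations_kernel])

sublocale Q: ring "symbol_algebra E Quot J"
  by (rule ideal.quotient_is_ring[OF J_ideal])

lemma coset_eq:
  "f \<in> carrier Sy \<Longrightarrow> g \<in> carrier Sy \<Longrightarrow> f \<ominus>\<^bsub>Sy\<^esub> g \<in> tensor_relations A E \<Longrightarrow> J +>\<^bsub>Sy\<^esub> f = J +>\<^bsub>Sy\<^esub> g"
  using Sy.quotient_eq_iff_same_a_r_cos[OF J_ideal, of f g] Sy.genideal_self[OF relations_closed] by blast

sublocale cos: ring_hom_ring "symbol_algebra E" "symbol_algebra E Quot J" "(+>\<^bsub>symbol_algebra E\<^esub>) J"
  by (rule ideal.rcos_ring_hom_ring[OF J_ideal])

lemma pt_closed: "x \<in> carrier E \<Longrightarrow> pt c x \<in> carrier (Sy Quot J)"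
  unfolding pure_tensor_def by (rule cos.hom_closed[OF symbol_closed])

lemma pt_add_left:
  assumes x: "x \<in> carrier E"
  shows "pt (c + d) x = pt c x \<oplus>\<^bsub>Sy Quot J\<^esub> pt d x"
proof -
  have "pt (c + d) x = J +>\<^bsub>Sy\<^esub> (basis_elt (c, x) \<oplus>\<^bsub>Sy\<^esub> basis_elt (d, x))"
    unfolding pure_tensor_def by (rule coset_eq) (use x in \<open>simp_all add: symbol_closed relations_members\<close>)
  then show ?thesis by (simp only: cos.hom_add[OF symbol_closed[OF x] symbol_closed[OF x]] pure_tensor_def)
qed

lemma pt_add_right:
  assumes x: "x \<in> carrier E" and y: "y \<in> carrier E"
  shows "pt c (x \<oplus>\<^bsub>E\<^esub> y) = pt c x \<oplus>\<^bsub>Sy Quot J\<^esub> pt c y"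
proof -
  have "pt c (x \<oplus>\<^bsub>E\<^esub> y) = J +>\<^bsub>Sy\<^esub> (basis_elt (c, x) \<oplus>\<^bsub>Sy\<^esub> basis_elt (c, y))"
    unfolding pure_tensor_def by (rule coset_eq) (use x y in \<open>simp_all add: symbol_closed E_closed relations_members\<close>)
  then show ?thesis by (simp only: cos.hom_add[OF symbol_closed[OF x] symbol_closed[OF y]] pure_tensor_def)
qed

lemma pt_balanced: "x \<in> carrier E \<Longrightarrow> a \<in> A \<Longrightarrow> pt (c * a) x = pt c (a \<odot>\<^bsub>E\<^esub> x)"
  unfolding pure_tensor_def
  by (rule coset_eq) (auto simp: symbol_closed E_closed relations_members)

lemma pt_zero_left: "x \<in> carrier E \<Longrightarrow> pt 0 x = \<zero>\<^bsub>Sy Quot J\<^esub>"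
  using pt_add_left[of x 0 0] pt_closed[of x 0] Q.add.l_cancel_one'[of "pt 0 x" "pt 0 x"] by simp

lemma pt_zero_right: "pt c \<zero>\<^bsub>E\<^esub> = \<zero>\<^bsub>Sy Quot J\<^esub>"
proof -
  have "\<zero>\<^bsub>E\<^esub> \<oplus>\<^bsub>E\<^esub> \<zero>\<^bsub>E\<^esub> = \<zero>\<^bsub>E\<^esub>" by (rule \<Psi>_injD) (simp_all add: E_closed \<Psi>_hom)
  then have "pt c \<zero>\<^bsub>E\<^esub> = pt c \<zero>\<^bsub>E\<^esub> \<oplus>\<^bsub>Sy Quot J\<^esub> pt c \<zero>\<^bsub>E\<^esub>"
    using pt_add_right[OF E_closed(4) E_closed(4), of c] by simp
  then show ?thesis
    using pt_closed[OF E_closed(4), of c] Q.add.l_cancel_one'[of "pt c \<zero>\<^bsub>E\<^esub>" "pt c \<zero>\<^bsub>E\<^esub>"] by simp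
qed

lemma coset_int_multiple:
  assumes x: "x \<in> carrier E"
  shows "J +>\<^bsub>Sy\<^esub> (\<lambda>m. a * basis_elt (c, x) m) = pt (of_int a * c) x"
proof -
  let ?b = "\<lambda>a m. a * basis_elt (c, x) m"
  have b: "?b a \<in> carrier Sy" for a
    using symbol_closed[OF x, of c] unfolding Sy_eq ma_carrier_iff
    by (auto intro: finite_subset[rotated])
  have step: "J +>\<^bsub>Sy\<^esub> ?b (a + 1) = (J +>\<^bsub>Sy\<^esub> ?b a) \<oplus>\<^bsub>Sy Quot J\<^esub> pt c x" for a
  proof -
    have "?b (a + 1) = ?b a \<oplus>\<^bsub>Sy\<^esub> basis_elt (c, x)"
      by (simp add: Sy_eq ma_add distrib_right)
    then show ?thesis using cos.hom_add[OF b symbol_closed[OF x]] by (simp add: pure_tensor_def)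
  qed
  have pstep: "pt (of_int (a + 1) * c) x = pt (of_int a * c) x \<oplus>\<^bsub>Sy Quot J\<^esub> pt c x" for a
    using pt_add_left[OF x, of "of_int a * c" c] by (simp add: distrib_right)
  show ?thesis
  proof (induction a rule: int_induct[where k = 0])
    case base
    have "?b 0 = \<zero>\<^bsub>Sy\<^esub>" by (simp add: Sy_eq ma_zero)
    then show ?case using pt_zero_left[OF x] cos.hom_zero by simp
  next
    case (step1 i)
    then show ?case by (simp only: step pstep)
  next
    case (step2 i)
    have "(J +>\<^bsub>Sy\<^esub> ?b (i - 1)) \<oplus>\<^bsub>Sy Quot J\<^esub> pt c x = pt (of_int (i - 1) * c) x \<oplus>\<^bsub>Sy Quot J\<^esub> pt c x"
      using step[of "i - 1"] pstep[of "i - 1"] step2 by simp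
    then show ?case using Q.add.right_cancel pt_closed[OF x] cos.hom_closed[OF b] by blast
  qed
qed

text \<open>
In the tensor product every element is a pure tensor \<open>1/d \<otimes> x\<close>, by passing to common denominators.
This is what makes the kernel of the evaluation map computable.
\<close>

lemma coset_pure:
  assumes "f \<in> carrier Sy"
  shows "\<exists>d\<in>A. \<exists>x\<in>carrier E. d \<noteq> 0 \<and> J +>\<^bsub>Sy\<^esub> f = pt (1 / d) x"
  using assms[unfolded Sy_eq] coeff_UNIV
proof (induction f rule: ma_induct)
  case zero
  have "J +>\<^bsub>Sy\<^esub> (\<lambda>m. 0) = pt (1 / 1) \<zero>\<^bsub>E\<^esub>"
  proof -
    have "(\<lambda>m. 0) = \<zero>\<^bsub>Sy\<^esub>" by (simp add: Sy_eq ma_zero)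
    then show ?thesis using cos.hom_zero by (simp only: pt_zero_right)
  qed
  then show ?case using A E_closed(4) unfolding coeff_ring_def by (metis zero_neq_one)
next
  case (scaled_basis a p)
  obtain c x where p: "p = (c, x)" by (cases p)
  have x: "x \<in> carrier E" using scaled_basis by (simp add: p DirProd_def)
  obtain b d where bd: "b \<in> A" "d \<in> A" "d \<noteq> 0" "of_int a * c = b / d" using fractions by blast
  have "J +>\<^bsub>Sy\<^esub> (\<lambda>m. a * basis_elt p m) = pt ((1 / d) * b) x"
    unfolding p coset_int_multiple[OF x] using bd by simp
  also have "\<dots> = pt (1 / d) (b \<odot>\<^bsub>E\<^esub> x)" by (rule pt_balanced[OF x bd(1)])
  finally show ?case using bd E_closed(5)[OF bd(1) x] by blast
next
  case (add f g)
  then obtain d x d' x' where *: "d \<in> A" "x \<in> carrier E" "d \<noteq> 0" "J +>\<^bsub>Sy\<^esub> f = pt (1 / d) x"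
    "d' \<in> A" "x' \<in> carrier E" "d' \<noteq> 0" "J +>\<^bsub>Sy\<^esub> g = pt (1 / d') x'" by blast
  have "J +>\<^bsub>Sy\<^esub> (\<lambda>m. f m + g m) = pt (1 / d) x \<oplus>\<^bsub>Sy Quot J\<^esub> pt (1 / d') x'"
    using cos.hom_add[of f g] add * by (simp add: Sy_eq ma_add)
  also have "pt (1 / d) x = pt (1 / (d * d') * d') x" using * by simp
  also have "\<dots> = pt (1 / (d * d')) (d' \<odot>\<^bsub>E\<^esub> x)" by (rule pt_balanced) (use * in auto)
  also have "pt (1 / d') x' = pt (1 / (d * d') * d) x'" using * by simp
  also have "\<dots> = pt (1 / (d * d')) (d \<odot>\<^bsub>E\<^esub> x')" by (rule pt_balanced) (use * in auto)
  also have "pt (1 / (d * d')) (d' \<odot>\<^bsub>E\<^esub> x) \<oplus>\<^bsub>Sy Quot J\<^esub> pt (1 / (d * d')) (d \<odot>\<^bsub>E\<^esub> x') =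
      pt (1 / (d * d')) (d' \<odot>\<^bsub>E\<^esub> x \<oplus>\<^bsub>E\<^esub> d \<odot>\<^bsub>E\<^esub> x')"
    by (rule pt_add_right[symmetric]) (use * E_closed in auto)
  finally show ?case using * E_closed A unfolding coeff_ring_def by (metis no_zero_divisors)
qed

text \<open>
If \<open>1/d \<otimes> x\<close> evaluates to zero then \<open>\<Psi> x = 0\<close>, so \<open>x = 0\<close> because \<open>\<Psi>\<close> is injective.
\<close>

lemma kernel_eq: "a_kernel Sy R ev = J"
proof (rule equalityI[OF _ J_kernel], rule subsetI)
  fix f assume "f \<in> a_kernel Sy R ev"
  then have f: "f \<in> carrier Sy" "ev f = \<zero>\<^bsub>R\<^esub>" by (simp_all only: kernel_iff)
  obtain d x where d: "d \<in> A" "x \<in> carrier E" "d \<noteq> 0" "J +>\<^bsub>Sy\<^esub> f = pt (1 / d) x"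
    using coset_pure[OF f(1)] by blast
  let ?b = "basis_elt (1 / d, x)"
  have "f \<ominus>\<^bsub>Sy\<^esub> ?b \<in> J"
    using Sy.quotient_eq_iff_same_a_r_cos[OF J_ideal f(1) symbol_closed[OF d(2)]] d(4) by (simp add: pure_tensor_def)
  then have "ev (f \<ominus>\<^bsub>Sy\<^esub> ?b) = \<zero>\<^bsub>R\<^esub>" using J_kernel kernel_iff by blast
  then have "ev ?b = \<zero>\<^bsub>R\<^esub>"
    using f symbol_closed[OF d(2)] by (simp add: a_minus_def)
  then have "\<Psi> x = \<Psi> \<zero>\<^bsub>E\<^esub>" using d(3) by (simp add: ev_basis R_ops \<Psi>_hom(4) fun_eq_iff)
  then have "x = \<zero>\<^bsub>E\<^esub>" by (rule \<Psi>_injD[OF d(2) E_closed(4)])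
  then have "J +>\<^bsub>Sy\<^esub> f = J +>\<^bsub>Sy\<^esub> \<zero>\<^bsub>Sy\<^esub>" using d(4) cos.hom_zero by (simp add: pt_zero_right)
  then have "f \<ominus>\<^bsub>Sy\<^esub> \<zero>\<^bsub>Sy\<^esub> \<in> J" using Sy.quotient_eq_iff_same_a_r_cos[OF J_ideal f(1) Sy.zero_closed] by simp
  then show "f \<in> J" using f(1) by (simp add: a_minus_def)
qed

lemma ev_surj: "ev ` carrier Sy = carrier R"
proof
  show "carrier R \<subseteq> ev ` carrier Sy"
  proof
    fix B assume "B \<in> carrier R"
    then obtain d x where d: "d \<in> A" "x \<in> carrier E" "d \<noteq> 0" "d \<odot>\<^bsub>R\<^esub> B = \<Psi> x" using \<Psi>_span by blast
    have "ev (basis_elt (1 / d, x)) = B" using d(3) by (simp add: ev_basis d(4)[symmetric] R_ops)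
    then show "B \<in> ev ` carrier Sy" using symbol_closed[OF d(2)] by (metis imageI)
  qed
qed (auto simp: ev_closed)

definition realize :: "('k \<times> 'e \<Rightarrow> int) set \<Rightarrow> ('x \<Rightarrow> 'k) \<Rightarrow> ('x \<Rightarrow> 'k)" where
  "realize X = the_elem (ev ` X)"

lemma realize_pt: "x \<in> carrier E \<Longrightarrow> realize (pt c x) = (\<lambda>v y. c * \<Psi> x v y)"
  using ev.the_elem_simp[OF symbol_closed[of x c]]
  by (simp add: realize_def pure_tensor_def kernel_eq ev_basis)

lemma extend_scalars_fields:
  "carrier (extend_scalars A E) = carrier (Sy Quot J)" "mult (extend_scalars A E) = mult (Sy Quot J)"
  "one (extend_scalars A E) = one (Sy Quot J)" "zero (extend_scalars A E) = zero (Sy Quot J)"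
  "add (extend_scalars A E) = add (Sy Quot J)"
  "c \<odot>\<^bsub>extend_scalars A E\<^esub> X = pt c \<one>\<^bsub>E\<^esub> \<otimes>\<^bsub>Sy Quot J\<^esub> X"
  by (simp_all add: extend_scalars_def Let_def)

lemma extend_scalars_ring: "ring (extend_scalars A E)"
  by (rule ring_cong[OF Q.ring_axioms]) (simp_all add: extend_scalars_fields)

lemma realize_iso: "realize \<in> algebra_iso k (extend_scalars A E) R"
proof -
  have iso: "realize \<in> ring_iso (Sy Quot J) R"
    using ev.FactRing_iso_set[OF ev_surj] by (simp add: kernel_eq realize_def[abs_def])
  then have "realize \<in> ring_iso (extend_scalars A E) R"
    by (simp add: ring_iso_def ring_hom_def extend_scalars_fields)
  moreover have "realize (c \<odot>\<^bsub>extend_scalars A E\<^esub> X) = c \<odot>\<^bsub>R\<^esub> realize X"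
    if X: "X \<in> carrier (extend_scalars A E)" for c X
  proof -
    have X: "X \<in> carrier (Sy Quot J)" using X by (simp add: extend_scalars_fields)
    have "realize (c \<odot>\<^bsub>extend_scalars A E\<^esub> X) = realize (pt c \<one>\<^bsub>E\<^esub>) \<otimes>\<^bsub>R\<^esub> realize X"
      using ring_iso_memE(2)[OF iso pt_closed[OF E_closed(3)] X] by (simp add: extend_scalars_fields)
    also have "\<dots> = (\<lambda>v y. c * (\<one>\<^bsub>R\<^esub> \<otimes>\<^bsub>R\<^esub> realize X) v y)"
      by (simp add: realize_pt[OF E_closed(3)] \<Psi>_hom(3) R_ops)
    also have "\<one>\<^bsub>R\<^esub> \<otimes>\<^bsub>R\<^esub> realize X = realize X"
      using ring_iso_memE(1)[OF iso X] by simp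
    finally show ?thesis by (simp add: R_ops)
  qed
  ultimately show ?thesis by (simp add: algebra_iso_def)
qed

end

section \<open>The endomorphism algebra of a sum of permutation modules\<close>

lemma finite_compositions: "finite (compositions n r)"
proof -
  have "compositions n r \<subseteq> {l. \<forall>i. (i \<in> {1..n + 1} \<longrightarrow> l i \<in> {..r}) \<and> (i \<notin> {1..n + 1} \<longrightarrow> l i = 0)}"
    using member_le_sum[of _ "{1..n + 1}"] by (fastforce simp: compositions_def)
  then show ?thesis by (rule finite_subset) (rule finite_set_of_finite_funs; simp)
qed

definition block_op :: "nat \<Rightarrow> nat \<Rightarrow> ('l \<times> (nat \<times> bool) list \<Rightarrow> K) \<Rightarrow> 'l \<times> (nat \<times> bool) list \<Rightarrow> K" where
  "block_op r j v x = hecke_op qK r j (\<lambda>w. v (fst x, w)) (snd x)"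

lemma block_op_lin: "lin_op (block_op r j)"
  by (auto simp: lin_op_def block_op_def lin_opD[OF hecke_op_lin])

lemma block_op_adjoint:
  assumes "1 \<le> j" "j \<le> r"
  shows "wform (L \<times> token_states r) (\<lambda>x. token_weight qK r (snd x)) (block_op r j u) v =
    wform (L \<times> token_states r) (\<lambda>x. token_weight qK r (snd x)) u (block_op r j v)"
proof -
  have e: "wform (L \<times> token_states r) (\<lambda>x. token_weight qK r (snd x)) u v =
     (\<Sum>l\<in>L. wform (token_states r) (token_weight qK r) (\<lambda>w. u (l, w)) (\<lambda>w. v (l, w)))" for u v :: "'a \<times> (nat \<times> bool) list \<Rightarrow> K"
    by (simp add: wform_def sum.cartesian_product case_prod_beta)
  show ?thesis unfolding e by (simp add: block_op_def hecke_op_adjoint[OF assms])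
qed

definition block_ops :: "nat \<Rightarrow> (('l \<times> (nat \<times> bool) list \<Rightarrow> K) \<Rightarrow> 'l \<times> (nat \<times> bool) list \<Rightarrow> K) set" where
  "block_ops r = block_op r ` {1..r}"

lemma block_ops_I: "j \<in> {1..r} \<Longrightarrow> block_op r j \<in> block_ops r"
  by (simp add: block_ops_def)

text \<open>
Both algebras of the theorem are instances, for the set of all compositions and for those with last
part zero. The index set \<open>X\<close> of the ambient function space is the same in both cases.
\<close>

locale schur_block =
  fixes n r :: nat and L :: "(nat \<Rightarrow> nat) set"
  assumes L: "L \<subseteq> compositions n r"
begin

abbreviation "M \<equiv> perm_module n r L"
abbreviation "H \<equiv> hecke r"

sublocale H: ring "hecke r" by (rule hecke_ring)

sublocale selfadjoint_family "compositions n r \<times> token_states r" "\<lambda>x. token_weight qK r (snd x)"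
    "block_ops r :: (((nat \<Rightarrow> nat) \<times> (nat \<times> bool) list \<Rightarrow> K) \<Rightarrow> _) set"
  by unfold_locales
    (auto simp: block_ops_def finite_compositions finite_token_states token_weight_pos qK_pos block_op_lin intro!: block_op_adjoint)

lemma finite_L: "finite L" using L finite_compositions by (rule finite_subset)

lemma x_module_closed: "x_module n r l \<subseteq> carrier H"
  by (auto simp: x_module_def x_elt_closed)

lemma x_module_ops:
  assumes X: "X \<in> x_module n r l"
  shows "\<zero>\<^bsub>H\<^esub> \<in> x_module n r l" "h \<in> carrier H \<Longrightarrow> X \<otimes>\<^bsub>H\<^esub> h \<in> x_module n r l"
    "Y \<in> x_module n r l \<Longrightarrow> X \<oplus>\<^bsub>H\<^esub> Y \<in> x_module n r l" "a \<in> laurentA \<Longrightarrow> a \<odot>\<^bsub>H\<^esub> X \<in> x_module n r l"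
proof -
  note x = x_elt_closed[of n r l]
  obtain h where h: "h \<in> carrier H" "X = x_elt n r l \<otimes>\<^bsub>H\<^esub> h" using X by (auto simp: x_module_def)
  show "\<zero>\<^bsub>H\<^esub> \<in> x_module n r l"
    using H.r_null[OF x] H.zero_closed unfolding x_module_def by (metis (mono_tags, lifting) mem_Collect_eq)
  show "h' \<in> carrier H \<Longrightarrow> X \<otimes>\<^bsub>H\<^esub> h' \<in> x_module n r l" for h'
    using h x H.m_assoc[OF x h(1)] H.m_closed[OF h(1)] unfolding x_module_def by blast
  show "Y \<in> x_module n r l \<Longrightarrow> X \<oplus>\<^bsub>H\<^esub> Y \<in> x_module n r l"
  proof -
    assume "Y \<in> x_module n r l"
    then obtain h' where h': "h' \<in> carrier H" "Y = x_elt n r l \<otimes>\<^bsub>H\<^esub> h'" by (auto simp: x_module_def)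
    then show ?thesis
      using h x H.r_distr[OF h(1) h'(1) x] H.a_closed[OF h(1) h'(1)] unfolding x_module_def by auto
  qed
  assume a: "a \<in> laurentA"
  show "a \<odot>\<^bsub>H\<^esub> X \<in> x_module n r l"
    using h(2) hecke_smult_laws(5)[OF x h(1) a a] hecke_smult_closed[OF h(1) a] unfolding x_module_def by auto
qed

lemma x_module_nonempty: "x_elt n r l \<in> x_module n r l"
  using H.r_one[OF x_elt_closed] H.one_closed unfolding x_module_def by (metis (mono_tags, lifting) mem_Collect_eq)

lemma M_comp: "m \<in> M \<Longrightarrow> l \<in> L \<Longrightarrow> m l \<in> carrier H"
  using x_module_closed by (auto simp: perm_module_def)

lemma M_ext: "m \<in> M \<Longrightarrow> l \<notin> L \<Longrightarrow> m l = undefined"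
  by (auto simp: perm_module_def)

lemma pm_zero_closed: "pm_zero r L \<in> M"
  by (auto simp: perm_module_def pm_zero_def intro: x_module_ops(1)[OF x_module_nonempty])

lemma pm_add_closed: "m \<in> M \<Longrightarrow> m' \<in> M \<Longrightarrow> pm_add r L m m' \<in> M"
  by (auto simp: perm_module_def pm_add_def intro!: x_module_ops(3))

lemma pm_act_closed: "m \<in> M \<Longrightarrow> h \<in> carrier H \<Longrightarrow> pm_act r L m h \<in> M"
  by (auto simp: perm_module_def pm_act_def intro!: x_module_ops(2))

lemma pm_smult_closed: "m \<in> M \<Longrightarrow> a \<in> laurentA \<Longrightarrow> pm_smult r L a m \<in> M"
  by (auto simp: perm_module_def pm_smult_def intro!: x_module_ops(4))

lemma pm_smult_act:
  assumes "m \<in> M" "a \<in> laurentA"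
  shows "pm_smult r L a m = pm_act r L m (a \<odot>\<^bsub>H\<^esub> \<one>\<^bsub>H\<^esub>)"
  unfolding pm_smult_def pm_act_def
  by (rule restrict_ext) (simp add: hecke_smult_laws(5)[OF M_comp[OF assms(1)] H.one_closed assms(2) assms(2)] M_comp[OF assms(1)])

definition emb :: "perm_elt \<Rightarrow> (nat \<Rightarrow> nat) \<times> (nat \<times> bool) list \<Rightarrow> K" where
  "emb m x = (if fst x \<in> L then coords r (m (fst x)) (snd x) else 0)"

lemma coords_zero: "coords r \<zero>\<^bsub>H\<^esub> = (\<lambda>w. 0)"
  using coords_smult[OF H.zero_closed laurentA_closed(1)] hecke_zero_smult[OF H.zero_closed] by simp

lemma emb_zero: "emb (pm_zero r L) = (\<lambda>x. 0)"
  by (auto simp: emb_def pm_zero_def coords_zero)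

lemma emb_add: "m \<in> M \<Longrightarrow> m' \<in> M \<Longrightarrow> emb (pm_add r L m m') = (\<lambda>x. emb m x + emb m' x)"
  by (auto simp: emb_def pm_add_def coords_add M_comp)

lemma emb_smult: "m \<in> M \<Longrightarrow> a \<in> laurentA \<Longrightarrow> emb (pm_smult r L a m) = (\<lambda>x. a * emb m x)"
  by (auto simp: emb_def pm_smult_def coords_smult M_comp)

lemma emb_act_T: "m \<in> M \<Longrightarrow> j \<in> {1..r} \<Longrightarrow> emb (pm_act r L m (T_word r [j])) = block_op r j (emb m)"
  by (auto simp: fun_eq_iff emb_def pm_act_def coords_mult_T M_comp block_op_def) (simp add: hecke_op_def)

lemma emb_support: "m \<in> M \<Longrightarrow> x \<notin> compositions n r \<times> token_states r \<Longrightarrow> emb m x = 0"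
  using L by (cases x) (auto simp: emb_def coords_support M_comp)

lemma emb_inj:
  assumes "m \<in> M" "m' \<in> M" "emb m = emb m'"
  shows "m = m'"
proof
  fix l
  show "m l = m' l"
  proof (cases "l \<in> L")
    case True
    have "coords r (m l) w = coords r (m' l) w" for w
      using fun_cong[OF assms(3), of "(l, w)"] True by (simp add: emb_def)
    then show ?thesis
      using inj_onD[OF coords_inj[of r], of "m l" "m' l"] M_comp[OF assms(1) True] M_comp[OF assms(2) True] by auto
  qed (simp add: M_ext assms)
qed

text \<open>
The \<open>K\<close>-span of the embedded module.
\<close>

definition U :: "((nat \<Rightarrow> nat) \<times> (nat \<times> bool) list \<Rightarrow> K) set" where
  "U = {v. \<exists>d\<in>laurentA. \<exists>m\<in>M. d \<noteq> 0 \<and> (\<lambda>x. d * v x) = emb m}"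

lemma emb_U: "m \<in> M \<Longrightarrow> emb m \<in> U"
  unfolding U_def using laurentA_closed(2) by (auto intro!: bexI[of _ 1] bexI[of _ m])

lemma U_I: "d \<in> laurentA \<Longrightarrow> d \<noteq> 0 \<Longrightarrow> m \<in> M \<Longrightarrow> (\<lambda>x. d * v x) = emb m \<Longrightarrow> v \<in> U"
  unfolding U_def by blast

lemma U_scale: 
  assumes "v \<in> U"
  shows "(\<lambda>x. c * v x) \<in> U"
proof -
  obtain d m where d: "d \<in> laurentA" "d \<noteq> 0" "m \<in> M" "(\<lambda>x. d * v x) = emb m" using assms by (auto simp: U_def)
  obtain a b where ab: "a \<in> laurentA" "b \<in> laurentA" "b \<noteq> 0" "c = a / b" using laurentA_fractions by blast
  have "(\<lambda>x. (b * d) * (c * v x)) = emb (pm_smult r L a m)"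
    using fun_cong[OF d(4), symmetric] ab by (simp add: emb_smult d fun_eq_iff mult_ac)
  then show ?thesis
    by (rule U_I[rotated 3]) (use d ab laurentA_closed pm_smult_closed in auto)
qed

lemma U_add:
  assumes "v \<in> U" "v' \<in> U"
  shows "(\<lambda>x. v x + v' x) \<in> U"
proof -
  obtain d m where d: "d \<in> laurentA" "d \<noteq> 0" "m \<in> M" "(\<lambda>x. d * v x) = emb m" using assms by (auto simp: U_def)
  obtain d' m' where d': "d' \<in> laurentA" "d' \<noteq> 0" "m' \<in> M" "(\<lambda>x. d' * v' x) = emb m'" using assms by (auto simp: U_def)
  have "(\<lambda>x. (d * d') * (v x + v' x)) = emb (pm_add r L (pm_smult r L d' m) (pm_smult r L d m'))"
    using fun_cong[OF d(4), symmetric] fun_cong[OF d'(4), symmetric]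
    by (simp add: emb_add emb_smult pm_smult_closed d d' fun_eq_iff algebra_simps)
  then show ?thesis
    by (rule U_I[rotated 3]) (use d d' laurentA_closed pm_smult_closed pm_add_closed in auto)
qed

lemma T_gen_closed: "j \<in> {1..r} \<Longrightarrow> T_word r [j] \<in> carrier H"
  by (rule T_word_closed) auto

lemma U_stable: "stable U"
  unfolding stable_def subspace_fun_def
proof (intro conjI ballI allI impI)
  show "(\<lambda>x. 0) \<in> U" using emb_U[OF pm_zero_closed] by (simp add: emb_zero)
  show "u \<in> U \<Longrightarrow> v \<in> U \<Longrightarrow> (\<lambda>x. c * u x + d * v x) \<in> U" for c d u v
    using U_add[OF U_scale[of u c] U_scale[of v d]] by simp
next
  fix u x assume u: "u \<in> U" and x: "x \<notin> compositions n r \<times> token_states r"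
  obtain d m where d: "d \<noteq> 0" "m \<in> M" "(\<lambda>x. d * u x) = emb m" using u by (auto simp: U_def)
  then show "u x = 0" using fun_cong[OF d(3), of x] emb_support[OF d(2) x] by simp
next
  fix T :: "((nat \<Rightarrow> nat) \<times> (nat \<times> bool) list \<Rightarrow> K) \<Rightarrow> (nat \<Rightarrow> nat) \<times> (nat \<times> bool) list \<Rightarrow> K" and u
  assume "T \<in> block_ops r" "u \<in> U"
  then obtain j d m where j: "j \<in> {1..r}" "T = block_op r j" and d: "d \<in> laurentA" "d \<noteq> 0" "m \<in> M" "(\<lambda>x. d * u x) = emb m"
    by (auto simp: U_def block_ops_def)
  have "(\<lambda>x. d * T u x) = emb (pm_act r L m (T_word r [j]))"
    using lin_op_scale[OF block_op_lin, of r j d u] by (simp only: emb_act_T[OF d(3) j(1)] d(4) j(2))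
  then show "T u \<in> U" by (rule U_I[OF d(1,2) pm_act_closed[OF d(3) T_gen_closed[OF j(1)]]])
qed

abbreviation "E \<equiv> hecke_End n r L"

lemma E_D:
  assumes "\<phi> \<in> carrier E"
  shows "m \<in> M \<Longrightarrow> \<phi> m \<in> M" "m \<notin> M \<Longrightarrow> \<phi> m = undefined"
    "m \<in> M \<Longrightarrow> m' \<in> M \<Longrightarrow> \<phi> (pm_add r L m m') = pm_add r L (\<phi> m) (\<phi> m')"
    "m \<in> M \<Longrightarrow> h \<in> carrier H \<Longrightarrow> \<phi> (pm_act r L m h) = pm_act r L (\<phi> m) h"
  using assms by (auto simp: hecke_End_def)

lemma E_smult_D:
  assumes "\<phi> \<in> carrier E" "m \<in> M" "a \<in> laurentA"
  shows "\<phi> (pm_smult r L a m) = pm_smult r L a (\<phi> m)"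
  using assms E_D[OF assms(1)] by (simp add: pm_smult_act hecke_smult_closed)

text \<open>
The linear extension of an endomorphism to the \<open>K\<close>-span, by clearing the denominator of the argument.
\<close>

definition hat :: "(perm_elt \<Rightarrow> perm_elt) \<Rightarrow> ((nat \<Rightarrow> nat) \<times> (nat \<times> bool) list \<Rightarrow> K) \<Rightarrow> (nat \<Rightarrow> nat) \<times> (nat \<times> bool) list \<Rightarrow> K" where
  "hat \<phi> u = (SOME w. \<exists>d\<in>laurentA. \<exists>m\<in>M. d \<noteq> 0 \<and> (\<lambda>x. d * u x) = emb m \<and> w = (\<lambda>x. emb (\<phi> m) x / d))"

lemma hat_eq:
  assumes \<phi>: "\<phi> \<in> carrier E" and d: "d \<in> laurentA" "d \<noteq> 0" "m \<in> M" "(\<lambda>x. d * u x) = emb m"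
  shows "hat \<phi> u = (\<lambda>x. emb (\<phi> m) x / d)"
proof -
  have "hat \<phi> u = (SOME w. \<exists>d\<in>laurentA. \<exists>m\<in>M. d \<noteq> 0 \<and> (\<lambda>x. d * u x) = emb m \<and> w = (\<lambda>x. emb (\<phi> m) x / d))"
    by (simp add: hat_def)
  also have "\<dots> = (\<lambda>x. emb (\<phi> m) x / d)"
  proof (rule some_equality)
    show "\<exists>d'\<in>laurentA. \<exists>m'\<in>M. d' \<noteq> 0 \<and> (\<lambda>x. d' * u x) = emb m' \<and>
        (\<lambda>x. emb (\<phi> m) x / d) = (\<lambda>x. emb (\<phi> m') x / d')"
      using d by blast
    fix w assume "\<exists>d'\<in>laurentA. \<exists>m'\<in>M. d' \<noteq> 0 \<and> (\<lambda>x. d' * u x) = emb m' \<and> w = (\<lambda>x. emb (\<phi> m') x / d')"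
    then obtain d' m' where d': "d' \<in> laurentA" "d' \<noteq> 0" "m' \<in> M" "(\<lambda>x. d' * u x) = emb m'" "w = (\<lambda>x. emb (\<phi> m') x / d')"
      by blast
    have "pm_smult r L d m' = pm_smult r L d' m"
      by (rule emb_inj)
        (use fun_cong[OF d(4), symmetric] fun_cong[OF d'(4), symmetric] in
          \<open>simp_all add: pm_smult_closed emb_smult d d' fun_eq_iff mult_ac\<close>)
    then have "pm_smult r L d (\<phi> m') = pm_smult r L d' (\<phi> m)"
      using E_smult_D[OF \<phi> d'(3) d(1)] E_smult_D[OF \<phi> d(3) d'(1)] by simp
    then have "(\<lambda>x. d * emb (\<phi> m') x) = (\<lambda>x. d' * emb (\<phi> m) x)"
      using emb_smult[OF E_D(1)[OF \<phi> d'(3)] d(1)] emb_smult[OF E_D(1)[OF \<phi> d(3)] d'(1)] by simp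
    then show "w = (\<lambda>x. emb (\<phi> m) x / d)"
      using d(2) d'(2) unfolding d'(5) by (simp add: fun_eq_iff field_simps)
  qed
  finally show ?thesis .
qed

lemma U_obtain:
  assumes "u \<in> U"
  obtains d m where "d \<in> laurentA" "d \<noteq> 0" "m \<in> M" "(\<lambda>x. d * u x) = emb m"
  using assms unfolding U_def by blast

lemma hat_emb: "\<phi> \<in> carrier E \<Longrightarrow> m \<in> M \<Longrightarrow> hat \<phi> (emb m) = emb (\<phi> m)"
  by (subst hat_eq[of \<phi> 1 m]) (auto simp: laurentA_closed)

lemma hat_scaled:
  assumes "\<phi> \<in> carrier E" "u \<in> U"
  obtains d m where "d \<in> laurentA" "d \<noteq> 0" "m \<in> M" "u = (\<lambda>x. emb m x / d)" "hat \<phi> u = (\<lambda>x. emb (\<phi> m) x / d)"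
proof -
  obtain d m where d: "d \<in> laurentA" "d \<noteq> 0" "m \<in> M" "(\<lambda>x. d * u x) = emb m" using U_obtain[OF assms(2)] .
  have "u = (\<lambda>x. emb m x / d)" using d(2) by (simp add: d(4)[symmetric])
  then show ?thesis using that d hat_eq[OF assms(1) d] by blast
qed

lemma hat_in:
  assumes "\<phi> \<in> carrier E" "u \<in> U"
  shows "hat \<phi> u \<in> U"
proof -
  obtain d m where d: "m \<in> M" "hat \<phi> u = (\<lambda>x. emb (\<phi> m) x / d)" using hat_scaled[OF assms] by blast
  have "(\<lambda>x. (1 / d) * emb (\<phi> m) x) \<in> U" by (rule U_scale[OF emb_U[OF E_D(1)[OF assms(1) d(1)]]])
  then show ?thesis by (simp add: d(2))
qed

lemma hat_add:
  assumes \<phi>: "\<phi> \<in> carrier E" and u: "u \<in> U" and v: "v \<in> U"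
  shows "hat \<phi> (\<lambda>x. u x + v x) = (\<lambda>x. hat \<phi> u x + hat \<phi> v x)"
proof -
  obtain d m where d: "d \<in> laurentA" "d \<noteq> 0" "m \<in> M" "u = (\<lambda>x. emb m x / d)" "hat \<phi> u = (\<lambda>x. emb (\<phi> m) x / d)"
    using hat_scaled[OF \<phi> u] .
  obtain d' m' where d': "d' \<in> laurentA" "d' \<noteq> 0" "m' \<in> M" "v = (\<lambda>x. emb m' x / d')" "hat \<phi> v = (\<lambda>x. emb (\<phi> m') x / d')"
    using hat_scaled[OF \<phi> v] .
  let ?m = "pm_add r L (pm_smult r L d' m) (pm_smult r L d m')"
  note c = pm_smult_closed[OF d(3) d'(1)] pm_smult_closed[OF d'(3) d(1)]
  have e: "(\<lambda>x. (d * d') * (u x + v x)) = emb ?m"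
    using d(2) d'(2) by (simp add: emb_add emb_smult c d d' fun_eq_iff field_simps)
  have "hat \<phi> (\<lambda>x. u x + v x) = (\<lambda>x. emb (\<phi> ?m) x / (d * d'))"
    by (rule hat_eq[OF \<phi> _ _ _ e]) (use d d' c laurentA_closed pm_add_closed in auto)
  also have "\<phi> ?m = pm_add r L (pm_smult r L d' (\<phi> m)) (pm_smult r L d (\<phi> m'))"
    by (simp add: E_D(3)[OF \<phi> c] E_smult_D[OF \<phi>] d d')
  also have "(\<lambda>x. emb \<dots> x / (d * d')) = (\<lambda>x. hat \<phi> u x + hat \<phi> v x)"
    using d(2) d'(2) E_D(1)[OF \<phi>]
    by (simp add: emb_add emb_smult pm_smult_closed d(1,3,5) d'(1,3,5) fun_eq_iff field_simps)
  finally show ?thesis .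
qed

lemma hat_scale:
  assumes \<phi>: "\<phi> \<in> carrier E" and u: "u \<in> U"
  shows "hat \<phi> (\<lambda>x. c * u x) = (\<lambda>x. c * hat \<phi> u x)"
proof -
  obtain d m where d: "d \<in> laurentA" "d \<noteq> 0" "m \<in> M" "u = (\<lambda>x. emb m x / d)" "hat \<phi> u = (\<lambda>x. emb (\<phi> m) x / d)"
    using hat_scaled[OF \<phi> u] .
  obtain a b where ab: "a \<in> laurentA" "b \<in> laurentA" "b \<noteq> 0" "c = a / b" using laurentA_fractions by blast
  have e: "(\<lambda>x. (b * d) * (c * u x)) = emb (pm_smult r L a m)"
    using d(2) ab by (simp add: emb_smult d(3,4) fun_eq_iff)
  have "hat \<phi> (\<lambda>x. c * u x) = (\<lambda>x. emb (\<phi> (pm_smult r L a m)) x / (b * d))"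
    by (rule hat_eq[OF \<phi> _ _ _ e]) (use d ab laurentA_closed pm_smult_closed in auto)
  then show ?thesis
    using E_D(1)[OF \<phi> d(3)] by (simp add: E_smult_D[OF \<phi> d(3) ab(1)] emb_smult ab d(5))
qed

lemma hat_block_op:
  assumes \<phi>: "\<phi> \<in> carrier E" and u: "u \<in> U" and j: "j \<in> {1..r}"
  shows "hat \<phi> (block_op r j u) = block_op r j (hat \<phi> u)"
proof -
  obtain d m where d: "d \<in> laurentA" "d \<noteq> 0" "m \<in> M" "(\<lambda>x. d * u x) = emb m" using U_obtain[OF u] .
  have "(\<lambda>x. d * block_op r j u x) = emb (pm_act r L m (T_word r [j]))"
    using lin_op_scale[OF block_op_lin, of r j d u] by (simp only: emb_act_T[OF d(3) j] d(4))
  then have "hat \<phi> (block_op r j u) = (\<lambda>x. emb (\<phi> (pm_act r L m (T_word r [j]))) x / d)"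
    by (rule hat_eq[OF \<phi> d(1,2) pm_act_closed[OF d(3) T_gen_closed[OF j]]])
  also have "\<dots> = (\<lambda>x. (1 / d) * block_op r j (emb (\<phi> m)) x)"
    by (simp add: E_D(4)[OF \<phi> d(3) T_gen_closed[OF j]] emb_act_T[OF E_D(1)[OF \<phi> d(3)] j])
  also have "\<dots> = block_op r j (hat \<phi> u)"
    by (simp only: lin_op_scale[OF block_op_lin, symmetric] hat_eq[OF \<phi> d]) simp
  finally show ?thesis .
qed

definition \<Psi> :: "(perm_elt \<Rightarrow> perm_elt) \<Rightarrow> ((nat \<Rightarrow> nat) \<times> (nat \<times> bool) list \<Rightarrow> K) \<Rightarrow> (nat \<Rightarrow> nat) \<times> (nat \<times> bool) list \<Rightarrow> K" where
  "\<Psi> \<phi> v = hat \<phi> (proj U v)"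

lemma \<Psi>_closed: "\<phi> \<in> carrier E \<Longrightarrow> \<Psi> \<phi> \<in> commutant_ops U"
  unfolding commutant_ops_def lin_op_def \<Psi>_def
  by (auto simp: lin_opD[OF proj_lin[OF U_stable]] hat_add hat_scale U_scale proj_in[OF U_stable] hat_in
      proj_id[OF U_stable] proj_Theta[OF U_stable] hat_block_op block_ops_def)

lemma \<Psi>_emb: "\<phi> \<in> carrier E \<Longrightarrow> m \<in> M \<Longrightarrow> \<Psi> \<phi> (emb m) = emb (\<phi> m)"
  by (simp add: \<Psi>_def proj_id[OF U_stable] emb_U hat_emb)

text \<open>
The embedded module spans \<open>U\<close>.
\<close>

lemma commutant_eqI:
  assumes B: "B \<in> commutant_ops U" "C \<in> commutant_ops U" and e: "\<And>m. m \<in> M \<Longrightarrow> B (emb m) = C (emb m)"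
  shows "B = C"
proof
  fix v
  obtain d m where d: "d \<noteq> 0" "m \<in> M" "(\<lambda>x. d * proj U v x) = emb m"
    using U_obtain[OF proj_in[OF U_stable, of v]] by blast
  have "(\<lambda>x. d * B v x) = (\<lambda>x. d * C v x)"
    using e[OF d(2)] lin_op_scale[OF commutant_opsD(1)[OF B(1)], of d "proj U v"]
      lin_op_scale[OF commutant_opsD(1)[OF B(2)], of d "proj U v"]
    by (simp add: d(3) commutant_opsD(3)[OF B(1)] commutant_opsD(3)[OF B(2)])
  then show "B v = C v" using d(1) by (simp add: fun_eq_iff)
qed

lemma End_mult: "\<phi> \<in> carrier E \<Longrightarrow> \<psi> \<in> carrier E \<Longrightarrow> \<phi> \<otimes>\<^bsub>E\<^esub> \<psi> \<in> carrier E"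
  using E_D(1)[of \<psi>] E_D(1)[of \<phi>] pm_add_closed pm_act_closed
  by (auto simp: hecke_End_def compose_def)

lemma End_one: "\<one>\<^bsub>E\<^esub> \<in> carrier E"
  using pm_add_closed pm_act_closed by (auto simp: hecke_End_def)

lemma pm_add_4:
  assumes "a \<in> M" "b \<in> M" "c \<in> M" "d \<in> M"
  shows "pm_add r L (pm_add r L a b) (pm_add r L c d) = pm_add r L (pm_add r L a c) (pm_add r L b d)"
  by (rule emb_inj) (simp_all add: assms pm_add_closed emb_add add_ac)

lemma pm_add_act:
  assumes "a \<in> M" "b \<in> M" "h \<in> carrier H"
  shows "pm_act r L (pm_add r L a b) h = pm_add r L (pm_act r L a h) (pm_act r L b h)"
  unfolding pm_act_def pm_add_def
  by (rule restrict_ext) (simp add: H.l_distr M_comp assms)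

lemma End_add: "\<phi> \<in> carrier E \<Longrightarrow> \<psi> \<in> carrier E \<Longrightarrow> \<phi> \<oplus>\<^bsub>E\<^esub> \<psi> \<in> carrier E"
  using E_D(1)[of \<psi>] E_D(1)[of \<phi>] pm_add_closed pm_act_closed
  by (auto simp: hecke_End_def pm_add_4 pm_add_act)

lemma End_zero: "\<zero>\<^bsub>E\<^esub> \<in> carrier E"
proof -
  have "pm_zero r L = pm_add r L (pm_zero r L) (pm_zero r L)"
    by (rule emb_inj) (simp_all add: pm_zero_closed pm_add_closed emb_add emb_zero)
  moreover have "pm_zero r L = pm_act r L (pm_zero r L) h" if "h \<in> carrier H" for h
    unfolding pm_zero_def pm_act_def by (rule restrict_ext) (simp add: that)
  ultimately show ?thesis
    using pm_add_closed pm_act_closed pm_zero_closed by (auto simp: hecke_End_def)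
qed

lemma End_smult: "a \<in> laurentA \<Longrightarrow> \<phi> \<in> carrier E \<Longrightarrow> a \<odot>\<^bsub>E\<^esub> \<phi> \<in> carrier E"
proof -
  assume a: "a \<in> laurentA" and \<phi>: "\<phi> \<in> carrier E"
  have 1: "pm_smult r L a (pm_add r L x y) = pm_add r L (pm_smult r L a x) (pm_smult r L a y)" if "x \<in> M" "y \<in> M" for x y
    by (rule emb_inj) (simp_all add: that a pm_smult_closed pm_add_closed emb_add emb_smult distrib_left)
  have 2: "pm_smult r L a (pm_act r L x h) = pm_act r L (pm_smult r L a x) h" if "x \<in> M" "h \<in> carrier H" for x h
    unfolding pm_smult_def pm_act_def
    by (rule restrict_ext) (simp add: hecke_smult_laws(4)[OF M_comp[OF that(1)] that(2) a a])
  show ?thesis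
    using E_D[OF \<phi>] pm_add_closed pm_act_closed pm_smult_closed a
    by (auto simp: hecke_End_def 1 2)
qed

lemma \<Psi>_hom:
  assumes \<phi>: "\<phi> \<in> carrier E" and \<psi>: "\<psi> \<in> carrier E"
  shows "\<Psi> (\<phi> \<otimes>\<^bsub>E\<^esub> \<psi>) = (\<lambda>v. \<Psi> \<phi> (\<Psi> \<psi> v))"
    "\<Psi> (\<phi> \<oplus>\<^bsub>E\<^esub> \<psi>) = (\<lambda>v x. \<Psi> \<phi> v x + \<Psi> \<psi> v x)"
proof -
  note c = End_mult[OF \<phi> \<psi>] End_add[OF \<phi> \<psi>]
  note v = E_D(1)[OF \<phi>] E_D(1)[OF \<psi>]
  show "\<Psi> (\<phi> \<otimes>\<^bsub>E\<^esub> \<psi>) = (\<lambda>v. \<Psi> \<phi> (\<Psi> \<psi> v))"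
    by (rule commutant_eqI[OF \<Psi>_closed[OF c(1)] commutant_mult[OF \<Psi>_closed[OF \<phi>] \<Psi>_closed[OF \<psi>]]])
      (simp add: \<Psi>_emb[OF c(1)] \<Psi>_emb \<phi> \<psi> v, simp add: hecke_End_def compose_def)
  show "\<Psi> (\<phi> \<oplus>\<^bsub>E\<^esub> \<psi>) = (\<lambda>v x. \<Psi> \<phi> v x + \<Psi> \<psi> v x)"
    by (rule commutant_eqI[OF \<Psi>_closed[OF c(2)] commutant_add[OF U_stable \<Psi>_closed[OF \<phi>] \<Psi>_closed[OF \<psi>]]])
      (simp add: \<Psi>_emb[OF c(2)] \<Psi>_emb \<phi> \<psi> v, simp add: hecke_End_def emb_add v)
qed

lemma \<Psi>_smult:
  assumes \<phi>: "\<phi> \<in> carrier E" and a: "a \<in> laurentA"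
  shows "\<Psi> (a \<odot>\<^bsub>E\<^esub> \<phi>) = (\<lambda>v x. a * \<Psi> \<phi> v x)"
  by (rule commutant_eqI[OF \<Psi>_closed[OF End_smult[OF a \<phi>]] commutant_smult[OF U_stable \<Psi>_closed[OF \<phi>]]])
    (simp add: \<Psi>_emb[OF End_smult[OF a \<phi>]] \<Psi>_emb \<phi> E_D(1)[OF \<phi>],
      simp add: hecke_End_def emb_smult E_D(1)[OF \<phi>] a)

lemma \<Psi>_one: "\<Psi> \<one>\<^bsub>E\<^esub> = proj U"
  by (rule commutant_eqI[OF \<Psi>_closed[OF End_one] proj_commutant[OF U_stable U_stable order_refl]])
    (simp add: \<Psi>_emb[OF End_one] proj_id[OF U_stable] emb_U, simp add: hecke_End_def)

lemma \<Psi>_zero: "\<Psi> \<zero>\<^bsub>E\<^esub> = (\<lambda>v x. 0)"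
  by (rule commutant_eqI[OF \<Psi>_closed[OF End_zero] commutant_zero[OF U_stable]])
    (simp add: \<Psi>_emb[OF End_zero], simp add: hecke_End_def emb_zero)

lemma \<Psi>_inj: "inj_on \<Psi> (carrier E)"
proof (rule inj_onI, rule ext)
  fix \<phi> \<psi> m assume *: "\<phi> \<in> carrier E" "\<psi> \<in> carrier E" "\<Psi> \<phi> = \<Psi> \<psi>"
  show "\<phi> m = \<psi> m"
  proof (cases "m \<in> M")
    case True
    show ?thesis
      by (rule emb_inj) (use * True \<Psi>_emb E_D(1) in metis)+
  qed (simp add: E_D(2) *)
qed

text \<open>
The operator commutes with the generators, hence with all of \<open>H\<close>.
\<close>

lemma lift_act:
  assumes B: "B \<in> commutant_ops U" and m: "m \<in> M" "m' \<in> M" "emb m' = B (emb m)" and h: "h \<in> carrier H"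
  shows "emb (pm_act r L m' h) = B (emb (pm_act r L m h))"
  using h
proof (induction h rule: hecke_induct)
  case one
  have "pm_act r L m \<one>\<^bsub>H\<^esub> = m" if "m \<in> M" for m
  proof
    fix l show "pm_act r L m \<one>\<^bsub>H\<^esub> l = m l"
      using that by (cases "l \<in> L") (simp_all add: pm_act_def M_comp M_ext)
  qed
  then show ?case by (simp add: m)
next
  case (mult_T X j)
  have "pm_act r L m (X \<otimes>\<^bsub>H\<^esub> T_word r [j]) = pm_act r L (pm_act r L m X) (T_word r [j])" if "m \<in> M" for m
    unfolding pm_act_def
    by (rule restrict_ext) (simp add: H.m_assoc[OF M_comp[OF that] mult_T(1) T_gen_closed[OF mult_T(2)]])
  then show ?case
    using mult_T by (simp add: m emb_act_T pm_act_closed commutant_opsD(4)[OF B] block_ops_I)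
next
  case (add X Y)
  have "pm_act r L m (X \<oplus>\<^bsub>H\<^esub> Y) = pm_add r L (pm_act r L m X) (pm_act r L m Y)" if "m \<in> M" for m
    unfolding pm_act_def pm_add_def by (rule restrict_ext) (simp add: M_comp[OF that] add H.r_distr)
  then show ?case
    using add by (simp add: m emb_add pm_act_closed lin_op_add[OF commutant_opsD(1)[OF B]])
next
  case (smult a X)
  have "pm_act r L m (a \<odot>\<^bsub>H\<^esub> X) = pm_smult r L a (pm_act r L m X)" if "m \<in> M" for m
    unfolding pm_act_def pm_smult_def
    by (rule restrict_ext) (simp add: hecke_smult_laws(5)[OF M_comp[OF that] smult(2) smult(1) smult(1)])
  then show ?case
    using smult by (simp add: m emb_smult pm_act_closed lin_op_scale[OF commutant_opsD(1)[OF B]])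
qed

definition gen :: "(nat \<Rightarrow> nat) \<Rightarrow> perm_elt" where
  "gen l = (\<lambda>l'\<in>L. if l' = l then x_elt n r l else \<zero>\<^bsub>H\<^esub>)"

lemma gen_closed: "gen l \<in> M"
  by (auto simp: gen_def perm_module_def intro: x_module_nonempty x_module_ops(1)[OF x_module_nonempty])

lemma laurentA_prod: "(\<And>i. i \<in> I \<Longrightarrow> f i \<in> laurentA) \<Longrightarrow> prod f I \<in> laurentA"
  by (induction I rule: infinite_finite_induct) (auto simp: laurentA_closed)

lemma emb_image_sum:
  assumes "\<And>i. i \<in> I \<Longrightarrow> f i \<in> emb ` M"
  shows "(\<lambda>x. \<Sum>i\<in>I. f i x) \<in> emb ` M"
  using assms
proof (induction I rule: infinite_finite_induct)
  case (insert i I)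
  obtain m where m: "m \<in> M" "f i = emb m" using insert.prems[of i] by blast
  obtain m' where m': "m' \<in> M" "(\<lambda>x. \<Sum>i\<in>I. f i x) = emb m'" using insert.IH insert.prems by blast
  have "(\<lambda>x. \<Sum>i\<in>insert i I. f i x) = emb (pm_add r L m m')"
    using insert.hyps m(2) fun_cong[OF m'(2)] by (simp add: emb_add m(1) m'(1) fun_eq_iff)
  then show ?case using pm_add_closed[OF m(1) m'(1)] by (rule image_eqI)
qed (simp_all add: emb_zero[symmetric] pm_zero_closed)

text \<open>
The module has finitely many generators, one for each composition, so a common denominator exists.
\<close>

lemma commutant_integral:
  assumes B: "B \<in> commutant_ops U"
  shows "\<exists>d\<in>laurentA. d \<noteq> 0 \<and> (\<forall>m\<in>M. (\<lambda>x. d * B (emb m) x) \<in> emb ` M)"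
proof -
  have "\<exists>d. d \<in> laurentA \<and> d \<noteq> 0 \<and> (\<lambda>x. d * B (emb (gen l)) x) \<in> emb ` M" for l
    using U_obtain[OF commutant_opsD(2)[OF B], of "emb (gen l)"] by (metis image_eqI)
  then obtain d where d: "d l \<in> laurentA" "d l \<noteq> 0" "(\<lambda>x. d l * B (emb (gen l)) x) \<in> emb ` M" for l
    by metis
  define D where "D = prod d L"
  define C where "C = (\<lambda>v x. D * B v x)"
  have D: "D \<in> laurentA" "D \<noteq> 0" using d finite_L by (auto simp: D_def laurentA_prod)
  have C: "C \<in> commutant_ops U" unfolding C_def by (rule commutant_smult[OF U_stable B])
  have genC: "C (emb (pm_act r L (gen l) h)) \<in> emb ` M" if l: "l \<in> L" and h: "h \<in> carrier H" for l h
  proof -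
    obtain m where m: "m \<in> M" "(\<lambda>x. d l * B (emb (gen l)) x) = emb m" using d(3)[of l] by blast
    let ?c = "prod d (L - {l})"
    have c: "?c \<in> laurentA" using d by (simp add: laurentA_prod)
    have "D = ?c * d l" using prod.remove[OF finite_L l, of d] by (simp add: D_def mult.commute)
    then have "emb (pm_smult r L ?c m) = C (emb (gen l))"
      by (simp add: emb_smult m(1) c m(2)[symmetric] C_def mult.assoc)
    then show ?thesis
      using lift_act[OF C gen_closed pm_smult_closed[OF m(1) c] _ h]
        pm_act_closed[OF pm_smult_closed[OF m(1) c] h] by (metis image_eqI)
  qed
  have "C (emb m) \<in> emb ` M" if m: "m \<in> M" for m
  proof -
    have "\<exists>h. h \<in> carrier H \<and> m l = x_elt n r l \<otimes>\<^bsub>H\<^esub> h" if "l \<in> L" for l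
      using m that by (auto simp: perm_module_def x_module_def Pi_def PiE_def)
    then obtain h where h: "\<And>l. l \<in> L \<Longrightarrow> h l \<in> carrier H" "\<And>l. l \<in> L \<Longrightarrow> m l = x_elt n r l \<otimes>\<^bsub>H\<^esub> h l" by metis
    have "emb m = (\<lambda>x. \<Sum>l\<in>L. 1 * emb (pm_act r L (gen l) (h l)) x)"
    proof
      fix x
      have "(\<Sum>l\<in>L. 1 * emb (pm_act r L (gen l) (h l)) x) =
          (\<Sum>l\<in>L. if l = fst x then emb m x else 0)"
        by (rule sum.cong) (auto simp: emb_def pm_act_def gen_def h coords_zero)
      also have "\<dots> = emb m x" using finite_L by (simp add: emb_def)
      finally show "emb m x = (\<Sum>l\<in>L. 1 * emb (pm_act r L (gen l) (h l)) x)" by simp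
    qed
    then have "C (emb m) = (\<lambda>x. \<Sum>l\<in>L. 1 * C (emb (pm_act r L (gen l) (h l))) x)"
      by (simp only: lin_op_sum[OF commutant_opsD(1)[OF C]])
    then show ?thesis using emb_image_sum[of L "\<lambda>l. C (emb (pm_act r L (gen l) (h l)))"] genC h(1) by simp
  qed
  then show ?thesis using D by (auto simp: C_def)
qed

lemma \<Psi>_span:
  assumes B: "B \<in> commutant_ops U"
  shows "\<exists>d\<in>laurentA. \<exists>\<phi>\<in>carrier E. d \<noteq> 0 \<and> (\<lambda>v x. d * B v x) = \<Psi> \<phi>"
proof -
  obtain d where d: "d \<in> laurentA" "d \<noteq> 0" "\<And>m. m \<in> M \<Longrightarrow> (\<lambda>x. d * B (emb m) x) \<in> emb ` M"
    using commutant_integral[OF B] by blast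
  define C where "C = (\<lambda>v x. d * B v x)"
  have C: "C \<in> commutant_ops U" unfolding C_def by (rule commutant_smult[OF U_stable B])
  define \<phi> where "\<phi> = (\<lambda>m\<in>M. SOME m'. m' \<in> M \<and> emb m' = C (emb m))"
  have \<phi>: "\<phi> m \<in> M" "emb (\<phi> m) = C (emb m)" if "m \<in> M" for m
  proof -
    have "\<exists>m'. m' \<in> M \<and> emb m' = C (emb m)" using d(3)[OF that] unfolding C_def by (metis imageE)
    from someI_ex[OF this] show "\<phi> m \<in> M" "emb (\<phi> m) = C (emb m)" by (simp_all add: \<phi>_def that)
  qed
  have "\<phi> \<in> carrier E"
  proof -
    have "\<phi> \<in> M \<rightarrow>\<^sub>E M" using \<phi>(1) by (auto simp: \<phi>_def)
    moreover have "\<phi> (pm_add r L m m') = pm_add r L (\<phi> m) (\<phi> m')" if "m \<in> M" "m' \<in> M" for m m'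
      by (rule emb_inj) (simp_all add: that \<phi> pm_add_closed emb_add lin_op_add[OF commutant_opsD(1)[OF C]])
    moreover have "\<phi> (pm_act r L m h) = pm_act r L (\<phi> m) h" if "m \<in> M" "h \<in> carrier H" for m h
      by (rule emb_inj) (simp_all add: that \<phi> pm_act_closed lift_act[OF C that(1) \<phi>(1)[OF that(1)] \<phi>(2)[OF that(1)] that(2)])
    ultimately show ?thesis by (simp add: hecke_End_def)
  qed
  moreover from this have "C = \<Psi> \<phi>"
    by (intro commutant_eqI[OF C \<Psi>_closed]) (simp_all add: \<Psi>_emb \<phi>)
  ultimately show ?thesis using d unfolding C_def by blast
qed

sublocale ext: scalar_extension laurentA E "commutant U" \<Psi>
proof (rule scalar_extension.intro)
  fix B assume "B \<in> carrier (commutant U)"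
  then show "\<exists>d\<in>laurentA. \<exists>x\<in>carrier E. d \<noteq> 0 \<and> d \<odot>\<^bsub>commutant U\<^esub> B = \<Psi> x"
    using \<Psi>_span by simp
qed (use coeff_ring_laurentA laurentA_fractions commutant_ring[OF U_stable] commutant_smult[OF U_stable] in
    \<open>auto simp: commutant_def End_mult End_add End_one End_zero End_smult \<Psi>_closed \<Psi>_hom \<Psi>_smult \<Psi>_one \<Psi>_zero \<Psi>_inj
      dest: commutant_opsD(1)\<close>)

end

section \<open>Isomorphisms, centers and corners\<close>

lemma algebra_iso_D:
  assumes "h \<in> algebra_iso k S T"
  shows "x \<in> carrier S \<Longrightarrow> h x \<in> carrier T"
    "x \<in> carrier S \<Longrightarrow> y \<in> carrier S \<Longrightarrow> h (x \<otimes>\<^bsub>S\<^esub> y) = h x \<otimes>\<^bsub>T\<^esub> h y"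
    "x \<in> carrier S \<Longrightarrow> y \<in> carrier S \<Longrightarrow> h (x \<oplus>\<^bsub>S\<^esub> y) = h x \<oplus>\<^bsub>T\<^esub> h y"
    "h \<one>\<^bsub>S\<^esub> = \<one>\<^bsub>T\<^esub>" "inj_on h (carrier S)" "h ` carrier S = carrier T"
    "c \<in> carrier k \<Longrightarrow> x \<in> carrier S \<Longrightarrow> h (c \<odot>\<^bsub>S\<^esub> x) = c \<odot>\<^bsub>T\<^esub> h x"
  using assms by (auto simp: algebra_iso_def ring_iso_def ring_hom_def bij_betw_def)

lemma algebra_isoI:
  assumes "h ` carrier S = carrier T" "inj_on h (carrier S)"
    "\<And>x y. x \<in> carrier S \<Longrightarrow> y \<in> carrier S \<Longrightarrow> h (x \<otimes>\<^bsub>S\<^esub> y) = h x \<otimes>\<^bsub>T\<^esub> h y"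
    "\<And>x y. x \<in> carrier S \<Longrightarrow> y \<in> carrier S \<Longrightarrow> h (x \<oplus>\<^bsub>S\<^esub> y) = h x \<oplus>\<^bsub>T\<^esub> h y"
    "h \<one>\<^bsub>S\<^esub> = \<one>\<^bsub>T\<^esub>"
    "\<And>c x. c \<in> carrier k \<Longrightarrow> x \<in> carrier S \<Longrightarrow> h (c \<odot>\<^bsub>S\<^esub> x) = c \<odot>\<^bsub>T\<^esub> h x"
  shows "h \<in> algebra_iso k S T"
  using assms by (auto simp: algebra_iso_def ring_iso_def ring_hom_def bij_betw_def)

lemma algebra_iso_through:
  assumes f: "f \<in> algebra_iso k S T" and g: "g \<in> algebra_iso k S' T"
    and closed: "\<And>x y. x \<in> carrier S' \<Longrightarrow> y \<in> carrier S' \<Longrightarrow> x \<otimes>\<^bsub>S'\<^esub> y \<in> carrier S'"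
      "\<And>x y. x \<in> carrier S' \<Longrightarrow> y \<in> carrier S' \<Longrightarrow> x \<oplus>\<^bsub>S'\<^esub> y \<in> carrier S'"
      "\<one>\<^bsub>S'\<^esub> \<in> carrier S'" "\<And>c x. c \<in> carrier k \<Longrightarrow> x \<in> carrier S' \<Longrightarrow> c \<odot>\<^bsub>S'\<^esub> x \<in> carrier S'"
  shows "(\<lambda>x. inv_into (carrier S') g (f x)) \<in> algebra_iso k S S'"
proof -
  note fD = algebra_iso_D[OF f] and gD = algebra_iso_D[OF g]
  let ?i = "inv_into (carrier S') g"
  have i: "?i t \<in> carrier S'" "g (?i t) = t" if "t \<in> carrier T" for t
    using that gD(6) inv_into_into[of t g "carrier S'"] f_inv_into_f[of t g "carrier S'"] by auto
  have eq: "?i t = y" if "y \<in> carrier S'" "g y = t" for y t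
    using that inv_into_f_f[OF gD(5)] by auto
  show ?thesis
  proof (rule algebra_isoI)
    have "?i ` carrier T = carrier S'"
      using inv_into_image_cancel[OF gD(5) order_refl] by (simp add: gD(6))
    then show "(\<lambda>x. ?i (f x)) ` carrier S = carrier S'" using fD(6) by (metis image_image)
    show "inj_on (\<lambda>x. ?i (f x)) (carrier S)"
      by (rule inj_onI) (metis fD(1,5) i(2) inj_onD)
  qed (rule eq; simp add: closed i fD gD)+
qed

lemma algebra_center_ops:
  "x \<otimes>\<^bsub>algebra_center S\<^esub> y = x \<otimes>\<^bsub>S\<^esub> y" "x \<oplus>\<^bsub>algebra_center S\<^esub> y = x \<oplus>\<^bsub>S\<^esub> y"
  "\<one>\<^bsub>algebra_center S\<^esub> = \<one>\<^bsub>S\<^esub>" "c \<odot>\<^bsub>algebra_center S\<^esub> x = c \<odot>\<^bsub>S\<^esub> x"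
  by (simp_all add: algebra_center_def)

lemma algebra_iso_center:
  assumes h: "h \<in> algebra_iso k S T"
    and closed: "\<And>x y. x \<in> carrier S \<Longrightarrow> y \<in> carrier S \<Longrightarrow> x \<otimes>\<^bsub>S\<^esub> y \<in> carrier S"
  shows "h \<in> algebra_iso k (algebra_center S) (algebra_center T)"
proof -
  note hD = algebra_iso_D[OF h]
  have central: "h z \<in> carrier (algebra_center T) \<longleftrightarrow> z \<in> carrier (algebra_center S)" if z: "z \<in> carrier S" for z
  proof -
    have "(\<forall>t\<in>carrier T. h z \<otimes>\<^bsub>T\<^esub> t = t \<otimes>\<^bsub>T\<^esub> h z) \<longleftrightarrow> (\<forall>x\<in>carrier S. h z \<otimes>\<^bsub>T\<^esub> h x = h x \<otimes>\<^bsub>T\<^esub> h z)"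
      unfolding hD(6)[symmetric] by blast
    also have "\<dots> \<longleftrightarrow> (\<forall>x\<in>carrier S. h (z \<otimes>\<^bsub>S\<^esub> x) = h (x \<otimes>\<^bsub>S\<^esub> z))"
      by (simp add: hD z)
    also have "\<dots> \<longleftrightarrow> (\<forall>x\<in>carrier S. z \<otimes>\<^bsub>S\<^esub> x = x \<otimes>\<^bsub>S\<^esub> z)"
      using inj_on_eq_iff[OF hD(5)] closed z by simp
    finally show ?thesis using z hD(1) by (simp add: algebra_center_def)
  qed
  have sub: "carrier (algebra_center S) \<subseteq> carrier S" by (auto simp: algebra_center_def)
  show ?thesis
  proof (rule algebra_isoI)
    show "inj_on h (carrier (algebra_center S))" by (rule inj_on_subset[OF hD(5) sub])
    show "h ` carrier (algebra_center S) = carrier (algebra_center T)"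
    proof
      show "h ` carrier (algebra_center S) \<subseteq> carrier (algebra_center T)" using central sub by blast
      show "carrier (algebra_center T) \<subseteq> h ` carrier (algebra_center S)"
      proof
        fix t assume t: "t \<in> carrier (algebra_center T)"
        then have "t \<in> h ` carrier S" by (simp add: hD(6)) (simp add: algebra_center_def)
        then show "t \<in> h ` carrier (algebra_center S)" using central t by blast
      qed
    qed
  qed (use sub in \<open>simp_all add: algebra_center_ops hD(2,3,4,7) subset_iff\<close>)
qed

lemma algebra_iso_corner:
  assumes h: "h \<in> algebra_iso k S T" and S: "ring S" and e: "e \<in> carrier S"
  shows "h \<in> algebra_iso k (corner_algebra S e) (corner_algebra T (h e))"
proof -
  interpret S: ring S by (rule S)
  note hD = algebra_iso_D[OF h]
  have sub: "carrier (corner_algebra S e) \<subseteq> carrier S" using e by (auto simp: corner_algebra_def)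
  show ?thesis
  proof (rule algebra_isoI)
    show "inj_on h (carrier (corner_algebra S e))" by (rule inj_on_subset[OF hD(5) sub])
    have exe: "h (e \<otimes>\<^bsub>S\<^esub> x \<otimes>\<^bsub>S\<^esub> e) = h e \<otimes>\<^bsub>T\<^esub> h x \<otimes>\<^bsub>T\<^esub> h e" if "x \<in> carrier S" for x
      using that e by (simp add: hD)
    have "carrier (corner_algebra T (h e)) = {h e \<otimes>\<^bsub>T\<^esub> h x \<otimes>\<^bsub>T\<^esub> h e | x. x \<in> carrier S}"
      unfolding corner_algebra_def hD(6)[symmetric] by auto
    also have "\<dots> = h ` carrier (corner_algebra S e)"
      using exe by (force simp: corner_algebra_def)
    finally show "h ` carrier (corner_algebra S e) = carrier (corner_algebra T (h e))" by simp
  qed (use sub in \<open>simp_all add: corner_algebra_def hD(2,3,7) subset_iff\<close>)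
qed

lemma corner_iff:
  assumes S: "ring S" and e: "e \<in> carrier S" "e \<otimes>\<^bsub>S\<^esub> e = e"
  shows "x \<in> carrier (corner_algebra S e) \<longleftrightarrow> x \<in> carrier S \<and> e \<otimes>\<^bsub>S\<^esub> x = x \<and> x \<otimes>\<^bsub>S\<^esub> e = x"
proof
  interpret S: ring S by (rule S)
  assume "x \<in> carrier (corner_algebra S e)"
  then obtain b where b: "b \<in> carrier S" "x = e \<otimes>\<^bsub>S\<^esub> b \<otimes>\<^bsub>S\<^esub> e" by (auto simp: corner_algebra_def)
  have "e \<otimes>\<^bsub>S\<^esub> x = (e \<otimes>\<^bsub>S\<^esub> e) \<otimes>\<^bsub>S\<^esub> b \<otimes>\<^bsub>S\<^esub> e" unfolding b(2) using b(1) e(1) by (simp only: S.m_assoc S.m_closed)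
  moreover have "x \<otimes>\<^bsub>S\<^esub> e = e \<otimes>\<^bsub>S\<^esub> b \<otimes>\<^bsub>S\<^esub> (e \<otimes>\<^bsub>S\<^esub> e)" unfolding b(2) using b(1) e(1) by (simp only: S.m_assoc S.m_closed)
  ultimately show "x \<in> carrier S \<and> e \<otimes>\<^bsub>S\<^esub> x = x \<and> x \<otimes>\<^bsub>S\<^esub> e = x" using b e by simp
next
  assume x: "x \<in> carrier S \<and> e \<otimes>\<^bsub>S\<^esub> x = x \<and> x \<otimes>\<^bsub>S\<^esub> e = x"
  then show "x \<in> carrier (corner_algebra S e)"
    unfolding corner_algebra_def by (auto intro!: exI[of _ x])
qed

lemma corner_closed:
  assumes S: "ring S" and e: "e \<in> carrier S" "e \<otimes>\<^bsub>S\<^esub> e = e"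
    and x: "x \<in> carrier (corner_algebra S e)" and y: "y \<in> carrier (corner_algebra S e)"
  shows "x \<otimes>\<^bsub>S\<^esub> y \<in> carrier (corner_algebra S e)" "x \<oplus>\<^bsub>S\<^esub> y \<in> carrier (corner_algebra S e)"
proof -
  interpret S: ring S by (rule S)
  note c = x[unfolded corner_iff[OF S e]] y[unfolded corner_iff[OF S e]]
  have "e \<otimes>\<^bsub>S\<^esub> (x \<otimes>\<^bsub>S\<^esub> y) = x \<otimes>\<^bsub>S\<^esub> y" using S.m_assoc[of e x y] c e by simp
  then show "x \<otimes>\<^bsub>S\<^esub> y \<in> carrier (corner_algebra S e)"
    unfolding corner_iff[OF S e] using c e by (simp add: S.m_assoc)
  show "x \<oplus>\<^bsub>S\<^esub> y \<in> carrier (corner_algebra S e)"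
    unfolding corner_iff[OF S e] using c e by (simp add: S.l_distr S.r_distr)
qed

lemma center_corner_supset:
  assumes S: "ring S" and e: "e \<in> carrier S" "e \<otimes>\<^bsub>S\<^esub> e = e" and z: "z \<in> carrier (algebra_center S)"
  shows "e \<otimes>\<^bsub>S\<^esub> z \<otimes>\<^bsub>S\<^esub> e \<in> carrier (algebra_center (corner_algebra S e))"
proof -
  interpret S: ring S by (rule S)
  have zS: "z \<in> carrier S" and zc: "\<And>x. x \<in> carrier S \<Longrightarrow> z \<otimes>\<^bsub>S\<^esub> x = x \<otimes>\<^bsub>S\<^esub> z"
    using z by (auto simp: algebra_center_def)
  have ez: "e \<otimes>\<^bsub>S\<^esub> z \<otimes>\<^bsub>S\<^esub> e = z \<otimes>\<^bsub>S\<^esub> e"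
    by (simp only: zc[OF e(1), symmetric] S.m_assoc[OF zS e(1) e(1)] e(2))
  have "(z \<otimes>\<^bsub>S\<^esub> e) \<otimes>\<^bsub>S\<^esub> y = y \<otimes>\<^bsub>S\<^esub> (z \<otimes>\<^bsub>S\<^esub> e)" if "y \<in> carrier (corner_algebra S e)" for y
  proof -
    have y: "y \<in> carrier S" "e \<otimes>\<^bsub>S\<^esub> y = y" "y \<otimes>\<^bsub>S\<^esub> e = y" using that corner_iff[OF S e] by auto
    have "(z \<otimes>\<^bsub>S\<^esub> e) \<otimes>\<^bsub>S\<^esub> y = z \<otimes>\<^bsub>S\<^esub> y" by (simp only: S.m_assoc[OF zS e(1) y(1)] y(2))
    also have "\<dots> = y \<otimes>\<^bsub>S\<^esub> e \<otimes>\<^bsub>S\<^esub> z" by (simp only: zc[OF y(1)] y(3))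
    also have "\<dots> = y \<otimes>\<^bsub>S\<^esub> (z \<otimes>\<^bsub>S\<^esub> e)" by (simp only: S.m_assoc[OF y(1) e(1) zS] zc[OF e(1)])
    finally show ?thesis .
  qed
  moreover have "z \<otimes>\<^bsub>S\<^esub> e \<in> carrier (corner_algebra S e)"
    using zS unfolding corner_algebra_def by (auto simp: ez[symmetric])
  ultimately show ?thesis
    unfolding ez algebra_center_def by (simp add: corner_algebra_def)
qed

section \<open>The theorem\<close>

context schur_block
begin

lemma schur_ring: "ring (extend_scalars laurentA E)"
  by (rule ext.extend_scalars_ring)

lemma schur_smult_closed:
  "X \<in> carrier (extend_scalars laurentA E) \<Longrightarrow> c \<odot>\<^bsub>extend_scalars laurentA E\<^esub> X \<in> carrier (extend_scalars laurentA E)"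
  by (simp add: ext.extend_scalars_fields ext.pt_closed End_one)

end

lemma emb_restrict:
  assumes "schur_block n r L" "schur_block n r L'" "L' \<subseteq> L" "m \<in> perm_module n r L"
  shows "restrict m L' \<in> perm_module n r L'"
    "schur_block.emb r L' (restrict m L') = (\<lambda>x. if fst x \<in> L' then schur_block.emb r L m x else 0)"
  using assms by (auto simp: schur_block.emb_def perm_module_def fun_eq_iff)

lemma emb_extend:
  assumes "schur_block n r L" "schur_block n r L'" "L' \<subseteq> L" "m \<in> perm_module n r L'"
  shows "(\<lambda>l\<in>L. if l \<in> L' then m l else \<zero>\<^bsub>hecke r\<^esub>) \<in> perm_module n r L"
    "schur_block.emb r L (\<lambda>l\<in>L. if l \<in> L' then m l else \<zero>\<^bsub>hecke r\<^esub>) = schur_block.emb r L' m"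
proof -
  interpret schur_block n r L by (rule assms(1))
  show "(\<lambda>l\<in>L. if l \<in> L' then m l else \<zero>\<^bsub>hecke r\<^esub>) \<in> perm_module n r L"
    using assms(3,4) x_module_ops(1)[OF x_module_nonempty] by (auto simp: perm_module_def)
  show "emb (\<lambda>l\<in>L. if l \<in> L' then m l else \<zero>\<^bsub>hecke r\<^esub>) = schur_block.emb r L' m"
    using assms(3) by (auto simp: emb_def schur_block.emb_def[OF assms(2)] coords_zero fun_eq_iff)
qed

context
  fixes n r :: nat
begin

interpretation J: schur_block n r "compositions n r" by unfold_locales simp
interpretation I: schur_block n r "compositions0 n r" by unfold_locales (auto simp: compositions0_def)

lemma compositions0_sub: "compositions0 n r \<subseteq> compositions n r" by (auto simp: compositions0_def)

lemma U_sub: "I.U \<subseteq> J.U"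
proof
  fix u assume "u \<in> I.U"
  then obtain d m where d: "d \<in> laurentA" "d \<noteq> 0" "m \<in> I.M" "(\<lambda>x. d * u x) = I.emb m" by (rule I.U_obtain)
  then show "u \<in> J.U"
    using emb_extend[OF J.schur_block_axioms I.schur_block_axioms compositions0_sub d(3)] by (intro J.U_I) auto
qed

lemma U_restrict:
  assumes "u \<in> J.U"
  shows "(\<lambda>x. if fst x \<in> compositions0 n r then u x else 0) \<in> I.U"
proof -
  obtain d m where d: "d \<in> laurentA" "d \<noteq> 0" "m \<in> J.M" "(\<lambda>x. d * u x) = J.emb m" using assms by (rule J.U_obtain)
  show ?thesis
    by (rule I.U_I[OF d(1,2) emb_restrict(1)[OF J.schur_block_axioms I.schur_block_axioms compositions0_sub d(3)]])
      (use emb_restrict(2)[OF J.schur_block_axioms I.schur_block_axioms compositions0_sub d(3)] fun_cong[OF d(4)] in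
        \<open>auto simp: fun_eq_iff\<close>)
qed

lemma U_zero_outside: "u \<in> I.U \<Longrightarrow> fst x \<notin> compositions0 n r \<Longrightarrow> u x = 0"
proof -
  assume u: "u \<in> I.U" and x: "fst x \<notin> compositions0 n r"
  obtain d m where d: "d \<noteq> 0" "(\<lambda>x. d * u x) = I.emb m" using I.U_obtain[OF u] by metis
  then show "u x = 0" using fun_cong[OF d(2), of x] x by (simp add: I.emb_def)
qed

text \<open>
The span of the whole module is the orthogonal sum of the spans of its summands, so restricting the
support to some of the summands is an orthogonal projection.
\<close>

lemma proj_restrict: "J.proj I.U v = (\<lambda>x. if fst x \<in> compositions0 n r then J.proj J.U v x else 0)"
proof (rule J.proj_unique[OF I.U_stable U_restrict[OF J.proj_in[OF J.U_stable]]])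
  fix u assume u: "u \<in> I.U"
  have "J.form (\<lambda>x. if fst x \<in> compositions0 n r then J.proj J.U v x else 0) u = J.form (J.proj J.U v) u"
    unfolding wform_def by (rule sum.cong) (use U_zero_outside[OF u] in auto)
  also have "\<dots> = J.form v u" using u U_sub by (intro J.proj_form[OF J.U_stable]) auto
  finally show "J.form v u = J.form (\<lambda>x. if fst x \<in> compositions0 n r then J.proj J.U v x else 0) u" by simp
qed

lemma proj_End_closed:
  "proj_End n r l \<in> carrier J.E"
proof -
  have c: "(\<lambda>l'\<in>compositions n r. if l' = l then m l' else \<zero>\<^bsub>hecke r\<^esub>) \<in> J.M" if "m \<in> J.M" for m
    using that J.x_module_ops(1)[OF J.x_module_nonempty] by (auto simp: perm_module_def)
  have a: "pm_add r (compositions n r) m m' \<in> J.M" if "m \<in> J.M" "m' \<in> J.M" for m m' by (rule J.pm_add_closed[OF that])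
  have b: "pm_act r (compositions n r) m h \<in> J.M" if "m \<in> J.M" "h \<in> carrier (hecke r)" for m h by (rule J.pm_act_closed[OF that])
  show ?thesis
    by (auto simp: hecke_End_def proj_End_def c a b) (auto simp: pm_add_def pm_act_def intro!: restrict_ext)
qed

lemma \<Psi>_proj_End:
  assumes "l \<in> compositions n r"
  shows "J.\<Psi> (proj_End n r l) v x = (if fst x = l then J.proj J.U v x else 0)"
proof -
  obtain d m where d: "d \<in> laurentA" "d \<noteq> 0" "m \<in> J.M" "(\<lambda>x. d * J.proj J.U v x) = J.emb m"
    using J.U_obtain[OF J.proj_in[OF J.U_stable]] .
  have "J.\<Psi> (proj_End n r l) v x = J.emb (proj_End n r l m) x / d"
    unfolding J.\<Psi>_def by (simp add: J.hat_eq[OF proj_End_closed d])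
  also have "J.emb (proj_End n r l m) x = (if fst x = l then J.emb m x else 0)"
    using assms by (simp add: J.emb_def proj_End_def d(3) J.coords_zero)
  also have "J.emb m x = d * J.proj J.U v x" using fun_cong[OF d(4), of x] by simp
  finally show ?thesis using d(2) by simp
qed

abbreviation "Sj \<equiv> extend_scalars laurentA J.E"
abbreviation "Si \<equiv> extend_scalars laurentA I.E"

text \<open>
By induction on the set of compositions. For all compositions with last part zero it identifies \<open>e\<close>
with the projection of \<open>proj_restrict\<close>.
\<close>

lemma blm_sum:
  assumes "F \<subseteq> compositions n r"
  shows "(\<Oplus>\<^bsub>Sj\<^esub>l \<in> F. blm_diag n r l) \<in> carrier Sj \<and>
    J.ext.realize (\<Oplus>\<^bsub>Sj\<^esub>l \<in> F. blm_diag n r l) = (\<lambda>v x. if fst x \<in> F then J.proj J.U v x else 0)"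
proof -
  interpret S: ring Sj by (rule J.schur_ring)
  note D = algebra_iso_D[OF J.ext.realize_iso[of fieldK]]
  have "finite F" using assms finite_compositions finite_subset by blast
  have b: "blm_diag n r l \<in> carrier Sj" for l
    unfolding blm_diag_def by (simp add: J.ext.extend_scalars_fields J.ext.pt_closed proj_End_closed)
  have rb: "J.ext.realize (blm_diag n r l) = (\<lambda>v x. if fst x = l then J.proj J.U v x else 0)" if "l \<in> compositions n r" for l
    unfolding blm_diag_def by (simp add: J.ext.realize_pt proj_End_closed \<Psi>_proj_End[OF that] fun_eq_iff)
  show ?thesis using \<open>finite F\<close> assms
  proof (induction F rule: finite_induct)
    case empty
    have "J.ext.realize \<zero>\<^bsub>Sj\<^esub> \<oplus>\<^bsub>J.commutant J.U\<^esub> J.ext.realize \<zero>\<^bsub>Sj\<^esub> = J.ext.realize \<zero>\<^bsub>Sj\<^esub>"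
      using D(3)[OF S.zero_closed S.zero_closed] by simp
    then have "J.ext.realize \<zero>\<^bsub>Sj\<^esub> = (\<lambda>v x. 0)" by (simp add: fun_eq_iff)
    then show ?case by simp
  next
    case (insert l F)
    then have "(\<Oplus>\<^bsub>Sj\<^esub>l \<in> insert l F. blm_diag n r l) = blm_diag n r l \<oplus>\<^bsub>Sj\<^esub> (\<Oplus>\<^bsub>Sj\<^esub>l \<in> F. blm_diag n r l)"
      using b by (intro S.finsum_insert) auto
    moreover have "J.ext.realize (blm_diag n r l \<oplus>\<^bsub>Sj\<^esub> (\<Oplus>\<^bsub>Sj\<^esub>l \<in> F. blm_diag n r l)) =
        (\<lambda>v x. if fst x \<in> insert l F then J.proj J.U v x else 0)"
      using insert by (intro ext) (auto simp: D(3) b rb)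
    ultimately show ?case using insert b by simp
  qed
qed

lemma schur_corner:
  assumes e: "e = (\<Oplus>\<^bsub>Sj\<^esub>l \<in> compositions0 n r. blm_diag n r l)"
  shows "e \<in> carrier Sj \<and> e \<otimes>\<^bsub>Sj\<^esub> e = e \<and>
    algebra_iso fieldK Si (corner_algebra Sj e) \<noteq> {} \<and>
    algebra_iso fieldK (algebra_center Si) (algebra_center (corner_algebra Sj e)) \<noteq> {} \<and>
    carrier (algebra_center (corner_algebra Sj e)) =
      {e \<otimes>\<^bsub>Sj\<^esub> z \<otimes>\<^bsub>Sj\<^esub> e | z. z \<in> carrier (algebra_center Sj)}"
proof -
  let ?P = "J.proj I.U"
  interpret S: ring Sj by (rule J.schur_ring)
  interpret Si: ring Si by (rule I.schur_ring)
  note iso = J.ext.realize_iso[of fieldK]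
  note D = algebra_iso_D[OF iso]
  have eS: "e \<in> carrier Sj" and re: "J.ext.realize e = ?P"
    using blm_sum[OF compositions0_sub] proj_restrict by (auto simp: e fun_eq_iff)
  have ee: "e \<otimes>\<^bsub>Sj\<^esub> e = e"
    by (rule inj_onD[OF D(5)]) (simp_all add: D(2) eS re J.proj_id[OF I.U_stable J.proj_in[OF I.U_stable]])
  note CI = corner_iff[OF J.schur_ring eS ee]
  note CC = J.corner_commutant[OF J.U_stable I.U_stable U_sub]
  have iso_c: "J.ext.realize \<in> algebra_iso fieldK (corner_algebra Sj e) (J.commutant I.U)"
    using algebra_iso_corner[OF iso J.schur_ring eS] by (simp add: re CC)
  note Dc = algebra_iso_D[OF iso_c]
  have cs: "c \<odot>\<^bsub>corner_algebra Sj e\<^esub> x \<in> carrier (corner_algebra Sj e)" if "x \<in> carrier (corner_algebra Sj e)" for c x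
  proof -
    have x: "x \<in> carrier Sj" "e \<otimes>\<^bsub>Sj\<^esub> x = x" "x \<otimes>\<^bsub>Sj\<^esub> e = x" using that CI by auto
    have k: "c \<in> carrier fieldK" by (simp add: fieldK_def)
    note cx = J.schur_smult_closed[OF x(1), of c]
    have "J.ext.realize x \<in> J.commutant_ops J.U" using D(1)[OF x(1)] by simp
    note lin = J.commutant_opsD(1)[OF this]
    have r: "(\<lambda>v. ?P (J.ext.realize x v)) = J.ext.realize x" "(\<lambda>v. J.ext.realize x (?P v)) = J.ext.realize x"
      using D(2)[OF eS x(1)] D(2)[OF x(1) eS] x re by simp_all
    have "e \<otimes>\<^bsub>Sj\<^esub> (c \<odot>\<^bsub>Sj\<^esub> x) = c \<odot>\<^bsub>Sj\<^esub> x"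
      by (rule inj_onD[OF D(5)])
        (use fun_cong[OF r(1)] in \<open>simp_all add: D(2) D(7)[OF k] eS cx x re lin_op_scale[OF J.proj_lin[OF I.U_stable]]\<close>)
    moreover have "(c \<odot>\<^bsub>Sj\<^esub> x) \<otimes>\<^bsub>Sj\<^esub> e = c \<odot>\<^bsub>Sj\<^esub> x"
      by (rule inj_onD[OF D(5)]) (use fun_cong[OF r(2)] in \<open>simp_all add: D(2) D(7)[OF k] eS cx x re\<close>)
    ultimately show ?thesis using CI cx by (simp add: corner_algebra_def)
  qed
  have "(\<lambda>x. inv_into (carrier (corner_algebra Sj e)) J.ext.realize (I.ext.realize x)) \<in>
      algebra_iso fieldK Si (corner_algebra Sj e)" (is "?f \<in> _")
  proof (rule algebra_iso_through[OF I.ext.realize_iso iso_c])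
    show "\<one>\<^bsub>corner_algebra Sj e\<^esub> \<in> carrier (corner_algebra Sj e)"
      using CI eS ee by (simp add: corner_algebra_def)
  qed (use corner_closed[OF J.schur_ring eS ee] cs in \<open>auto simp: corner_algebra_def\<close>)
  moreover from this have "?f \<in> algebra_iso fieldK (algebra_center Si) (algebra_center (corner_algebra Sj e))"
    by (rule algebra_iso_center) simp
  moreover have "carrier (algebra_center (corner_algebra Sj e)) =
      {e \<otimes>\<^bsub>Sj\<^esub> z \<otimes>\<^bsub>Sj\<^esub> e | z. z \<in> carrier (algebra_center Sj)}"
  proof (intro equalityI subsetI)
    fix c assume c: "c \<in> carrier (algebra_center (corner_algebra Sj e))"
    then have cc: "c \<in> carrier (corner_algebra Sj e)" by (simp add: algebra_center_def)
    then have cS: "c \<in> carrier Sj" using CI by simp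
    have "J.ext.realize c \<in> carrier (algebra_center (J.commutant I.U))"
      using algebra_iso_D(1)[OF algebra_iso_center[OF iso_c] c] corner_closed(1)[OF J.schur_ring eS ee]
      by (simp add: corner_algebra_def)
    then have zc: "J.ext.realize c \<in> J.commutant_ops I.U"
      "\<And>B. B \<in> J.commutant_ops I.U \<Longrightarrow> (\<lambda>v. J.ext.realize c (B v)) = (\<lambda>v. B (J.ext.realize c v))"
      by (auto simp: algebra_center_def)
    obtain z' where z': "z' \<in> J.commutant_ops J.U"
      "\<forall>B\<in>J.commutant_ops J.U. (\<lambda>v. z' (B v)) = (\<lambda>v. B (z' v))"
      "\<forall>v. ?P (z' (?P v)) = J.ext.realize c v"
      using J.center_lift[OF J.U_stable I.U_stable U_sub zc] by blast
    have "z' \<in> J.ext.realize ` carrier Sj" using z'(1) by (simp only: D(6) J.commutant_simps)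
    then obtain z where z: "z \<in> carrier Sj" "J.ext.realize z = z'" by blast
    have "z \<in> carrier (algebra_center Sj)"
      unfolding algebra_center_def
    proof (simp add: z(1), intro ballI)
      fix x assume x: "x \<in> carrier Sj"
      show "z \<otimes>\<^bsub>Sj\<^esub> x = x \<otimes>\<^bsub>Sj\<^esub> z"
        by (rule inj_onD[OF D(5)]) (use z'(2) D(1)[OF x] in \<open>simp_all add: D(2) x z\<close>)
    qed
    moreover have "c = e \<otimes>\<^bsub>Sj\<^esub> z \<otimes>\<^bsub>Sj\<^esub> e"
      by (rule inj_onD[OF D(5)]) (simp_all add: D(2) z eS re z'(3) cS)
    ultimately show "c \<in> {e \<otimes>\<^bsub>Sj\<^esub> z \<otimes>\<^bsub>Sj\<^esub> e | z. z \<in> carrier (algebra_center Sj)}" by blast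
  next
    fix c assume "c \<in> {e \<otimes>\<^bsub>Sj\<^esub> z \<otimes>\<^bsub>Sj\<^esub> e | z. z \<in> carrier (algebra_center Sj)}"
    then show "c \<in> carrier (algebra_center (corner_algebra Sj e))"
      using center_corner_supset[OF J.schur_ring eS ee] by blast
  qed
  ultimately show ?thesis using eS ee by blast
qed

end

theorem mainTheorem13:
  fixes n r :: nat
  assumes "e = (\<Oplus>\<^bsub>schur_j n r\<^esub>l \<in> compositions0 n r. blm_diag n r l)"
  shows "e \<in> carrier (schur_j n r) \<and> e \<otimes>\<^bsub>schur_j n r\<^esub> e = e \<and>
    algebra_iso fieldK (schur_i n r) (corner_algebra (schur_j n r) e) \<noteq> {} \<and>
    algebra_iso fieldK (algebra_center (schur_i n r))
      (algebra_center (corner_algebra (schur_j n r) e)) \<noteq> {} \<and>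
    carrier (algebra_center (corner_algebra (schur_j n r) e)) =
      {e \<otimes>\<^bsub>schur_j n r\<^esub> z \<otimes>\<^bsub>schur_j n r\<^esub> e | z. z \<in> carrier (algebra_center (schur_j n r))}"
  using schur_corner[of e n r] assms unfolding schur_j_def schur_i_def by blast

end
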